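(* Let $f,\mu,\Omega,\phi,\Phi,g$, the Koopman operator $U$ and the hypothesis space $\mathcal W$ with orthogonal projection $\pi=\mathrm{proj}_{\mathcal W}$ be as in the context. Then the error of direct forecast is $$\mathrm{error}_{\mathrm{direct}}(n)=\|(\mathrm{Id}-\pi)U^n\phi\|_{L^2(\mu)}.$$ Assume moreover that the hypothesis spaces $\mathcal W$ considered are finite-dimensional subspaces of $L^2(\mu)$ containing the constant functions. Then there is a subset $\mathbb N'\subseteq\mathbb N$ of density $1$ such that: (i) For every $\epsilon>0$, if $\mathcal W$ is chosen large enough, then $\mathrm{error}_{\mathrm{direct}}(n)$ is, in the limit $n\to\infty$ along $\mathbb N'$, equal to $\|\phi-\mathrm{proj}_{\mathcal D}\phi\|_{L^2(\mu)}$ up to an error $\epsilon$, that is, $$\limsup_{n\in\mathbb N',\,n\to\infty}\left|\mathrm{error}_{\mathrm{direct}}(n)-\|\phi-\mathrm{proj}_{\mathcal D}\phi\|_{L^2(\mu)}\right|\le\epsilon.$$ (ii) If $f$ is weakly mixing, then for every choice of $\mathcal W$, $$\lim_{n\in\mathbb N',\,n\to\infty}\mathrm{error}_{\mathrm{direct}}(n)=\|\phi-\mu(\phi)\|_{L^2(\mu)}.$$ (iii) If $f$ is strongly mixing, then $\mathbb N'$ can be taken to be all of $\mathbb N$. (iv) If $f$ has purely discrete spectrum, then for every $\epsilon>0$, if $\mathcal W$ is chosen large enough, $\mathrm{error}_{\mathrm{direct}}(n)<\epsilon$ for all $n\in\mathbb N$.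
   Context: Setting. $f:\tilde\Omega\to\tilde\Omega$ is a $C^1$ dynamical system on an $m$-dimensional $C^1$ manifold $\tilde\Omega$, with an ergodic invariant measure $\mu$ with compact support $\Omega$. There are maps $\phi:\Omega\to\mathbb R^d$ (with components in $L^2(\mu)$) and $\Phi:\Omega\to\mathbb R^L$ such that $\Phi$ is injective, and there is a function $g:\mathbb R^d\times\mathbb R^L\to\mathbb R^L$ with $\Phi\circ f=g\circ(\phi,\Phi)$. Koopman operator. $L^2(\mu)$ is the space of complex-valued square-integrable functions. $U:L^2(\mu)\to L^2(\mu)$, $U^n\psi=\psi\circ f^n$; $U$ and its iterates are unitary. $\mathcal D$ is the closure in $L^2(\mu)$ of the span of all eigenfunctions of $U$, giving $L^2(\mu)=\mathcal D\oplus\mathcal D^\perp$. The system is weakly mixing if $\mathcal D$ consists only of the constants; strongly mixing if $\lim_{N\to\infty}\langle\phi_1,U^N\phi_2\rangle=\mu(\phi_1)\mu(\phi_2)$ for all $\phi_1,\phi_2\in L^2(\mu)$ (up to the usual complex conjugation, with $\mu(\psi)=\int\psi\,d\mu$); and has purely discrete spectrum if $\mathcal D^\perp=\{0\}$. All operators and projections act componentwise on vector-valued functions such as $\phi$. Direct forecast. Since $\Phi$ is injective, for each $n$ there is a function $w_n$ with $w_n\circ\Phi=U^n\phi$. It is approximated by $\hat w_n$ from a linear hypothesis space of functions on $\mathbb R^L$; $\mathcal W\subset L^2(\mu)$ is the subspace obtained by composing the hypothesis functions with $\Phi$, and $\hat w_n\circ\Phi=\mathrm{proj}_{\mathcal W}U^n\phi$.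 The direct forecast error is $$\mathrm{error}_{\mathrm{direct}}(n):=\|U^n\phi-\hat w_n\circ\Phi\|_{L^2(\mu)}.$$ "If $\mathcal W$ is chosen large enough" means: there is a finite-dimensional subspace $\mathcal W_0$ such that the assertion holds for every admissible $\mathcal W\supseteq\mathcal W_0$. *)

theory Defs
  imports "HOL-Probability.Probability" "HOL-Library.Function_Algebras"
begin

section \<open>\<open>C\<^sup>1\<close> manifolds and maps\<close>

text \<open>For open \<open>S\<close>: the Frechet derivative exists on \<open>S\<close> and is continuous in operator norm.\<close>

definition C1_on :: "'e::real_normed_vector set \<Rightarrow> ('e \<Rightarrow> 'f::real_normed_vector) \<Rightarrow> bool" where
  "C1_on S F \<longleftrightarrow>
     (\<exists>F' :: 'e \<Rightarrow> 'e \<Rightarrow>\<^sub>L 'f.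
        (\<forall>x\<in>S. (F has_derivative blinfun_apply (F' x)) (at x)) \<and> continuous_on S F')"

text \<open>A chart is a pair \<open>(U, k)\<close>; only the values of \<open>k\<close> on \<open>U\<close> matter.
  The manifold is the whole type \<open>'a\<close>.\<close>

type_synonym ('a, 'm) chart = "'a set \<times> ('a \<Rightarrow> real ^ 'm)"

definition is_chart :: "('a::topological_space, 'm::finite) chart \<Rightarrow> bool" where
  "is_chart c \<longleftrightarrow>
     (case c of (U, k) \<Rightarrow>
        open U \<and> open (k ` U) \<and> homeomorphism U (k ` U) k (inv_into U k))"

definition C1_atlas :: "('a::topological_space, 'm::finite) chart set \<Rightarrow> bool" where
  "C1_atlas A \<longleftrightarrow>
     (\<forall>c\<in>A. is_chart c) \<and>
     (\<Union>(U, k)\<in>A. U) = UNIV \<and>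
     (\<forall>(U, k)\<in>A. \<forall>(V, l)\<in>A. C1_on (k ` (U \<inter> V)) (l \<circ> inv_into U k))"

definition C1_map :: "('a::topological_space, 'm::finite) chart set \<Rightarrow> ('a \<Rightarrow> 'a) \<Rightarrow> bool" where
  "C1_map A f \<longleftrightarrow>
     continuous_on UNIV f \<and>
     (\<forall>(U, k)\<in>A. \<forall>(V, l)\<in>A. C1_on (k ` (U \<inter> f -` V)) (l \<circ> f \<circ> inv_into U k))"


section \<open>Ergodic invariant measures\<close>

definition measure_support :: "'a::topological_space measure \<Rightarrow> 'a set" where
  "measure_support \<mu> = {x. \<forall>U. open U \<longrightarrow> x \<in> U \<longrightarrow> 0 < emeasure \<mu> U}"

definition invariant_measure :: "'a measure \<Rightarrow> ('a \<Rightarrow> 'a) \<Rightarrow> bool" where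
  "invariant_measure \<mu> f \<longleftrightarrow> f \<in> measurable \<mu> \<mu> \<and> distr \<mu> \<mu> f = \<mu>"

definition ergodic_measure :: "'a measure \<Rightarrow> ('a \<Rightarrow> 'a) \<Rightarrow> bool" where
  "ergodic_measure \<mu> f \<longleftrightarrow>
     (\<forall>A\<in>sets \<mu>. f -` A \<inter> space \<mu> = A \<longrightarrow> measure \<mu> A = 0 \<or> measure \<mu> A = 1)"


section \<open>The space \<open>L\<^sup>2\<close>\<close>

text \<open>Elements of \<open>L\<^sup>2\<close> are represented by square-integrable functions; equality in \<open>L\<^sup>2\<close> is
  equality almost everywhere.  Accordingly, subspaces of \<open>L\<^sup>2\<close> are sets of functions
  that are closed under changes on null sets.\<close>

definition L2 :: "'a measure \<Rightarrow> ('a \<Rightarrow> complex) set" where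
  "L2 M = {\<psi> \<in> borel_measurable M. integrable M (\<lambda>x. (norm (\<psi> x))\<^sup>2)}"

text \<open>For \<open>complex ^ 'd\<close>-valued functions the square of this is the sum of the squares of the norms
  of the components.\<close>

definition L2norm :: "'a measure \<Rightarrow> ('a \<Rightarrow> 'v::real_normed_vector) \<Rightarrow> real" where
  "L2norm M \<psi> = sqrt (\<integral>x. (norm (\<psi> x))\<^sup>2 \<partial>M)"

definition L2inner :: "'a measure \<Rightarrow> ('a \<Rightarrow> complex) \<Rightarrow> ('a \<Rightarrow> complex) \<Rightarrow> complex" where
  "L2inner M \<phi> \<psi> = (\<integral>x. \<phi> x * cnj (\<psi> x) \<partial>M)"

definition cscale :: "complex \<Rightarrow> ('b \<Rightarrow> complex) \<Rightarrow> 'b \<Rightarrow> complex" where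
  "cscale c \<psi> = (\<lambda>x. c * \<psi> x)"

interpretation cfun: vector_space cscale
  by unfold_locales (auto simp: cscale_def fun_eq_iff algebra_simps)

definition L2_subspace :: "'a measure \<Rightarrow> ('a \<Rightarrow> complex) set \<Rightarrow> bool" where
  "L2_subspace M W \<longleftrightarrow>
     W \<subseteq> L2 M \<and> cfun.subspace W \<and>
     (\<forall>\<psi>\<in>W. \<forall>\<eta>\<in>L2 M. (AE x in M. \<eta> x = \<psi> x) \<longrightarrow> \<eta> \<in> W)"

definition L2_closure :: "'a measure \<Rightarrow> ('a \<Rightarrow> complex) set \<Rightarrow> ('a \<Rightarrow> complex) set" where
  "L2_closure M S = {\<psi> \<in> L2 M. \<forall>e>0. \<exists>\<eta>\<in>S. L2norm M (\<lambda>x. \<psi> x - \<eta> x) < e}"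

definition L2_finite_dim :: "'a measure \<Rightarrow> ('a \<Rightarrow> complex) set \<Rightarrow> bool" where
  "L2_finite_dim M W \<longleftrightarrow>
     (\<exists>B. finite B \<and> B \<subseteq> W \<and> (\<forall>\<psi>\<in>W. \<exists>\<eta>\<in>cfun.span B. AE x in M. \<psi> x = \<eta> x))"

definition L2_orthogonal :: "'a measure \<Rightarrow> ('a \<Rightarrow> complex) set \<Rightarrow> ('a \<Rightarrow> complex) set" where
  "L2_orthogonal M W = {\<psi> \<in> L2 M. \<forall>\<eta>\<in>W. L2inner M \<psi> \<eta> = 0}"

text \<open>Orthogonal projection onto a closed subspace \<open>W\<close>; it is determined up to null sets.\<close>

definition L2_proj :: "'a measure \<Rightarrow> ('a \<Rightarrow> complex) set \<Rightarrow> ('a \<Rightarrow> complex) \<Rightarrow> 'a \<Rightarrow> complex" where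
  "L2_proj M W \<psi> = (SOME p. p \<in> W \<and> (\<lambda>x. \<psi> x - p x) \<in> L2_orthogonal M W)"

definition L2_proj_vec ::
  "'a measure \<Rightarrow> ('a \<Rightarrow> complex) set \<Rightarrow> ('a \<Rightarrow> complex ^ 'd) \<Rightarrow> 'a \<Rightarrow> complex ^ 'd" where
  "L2_proj_vec M W \<psi> = (\<lambda>x. \<chi> i. L2_proj M W (\<lambda>y. \<psi> y $ i) x)"


section \<open>The Koopman operator\<close>

definition koopman :: "('a \<Rightarrow> 'a) \<Rightarrow> ('a \<Rightarrow> 'v) \<Rightarrow> 'a \<Rightarrow> 'v" where
  "koopman f \<psi> = \<psi> \<circ> f"

lemma koopman_funpow: "(koopman f ^^ n) \<psi> = \<psi> \<circ> (f ^^ n)"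
  by (induction n) (auto simp: koopman_def fun_eq_iff funpow_swap1)

definition koopman_eigenfunctions :: "'a measure \<Rightarrow> ('a \<Rightarrow> 'a) \<Rightarrow> ('a \<Rightarrow> complex) set" where
  "koopman_eigenfunctions M f =
     {\<psi> \<in> L2 M. \<not> (AE x in M. \<psi> x = 0) \<and> (\<exists>c. AE x in M. koopman f \<psi> x = c * \<psi> x)}"

definition discrete_part :: "'a measure \<Rightarrow> ('a \<Rightarrow> 'a) \<Rightarrow> ('a \<Rightarrow> complex) set" where
  "discrete_part M f = L2_closure M (cfun.span (koopman_eigenfunctions M f))"

definition weakly_mixing :: "'a measure \<Rightarrow> ('a \<Rightarrow> 'a) \<Rightarrow> bool" where
  "weakly_mixing M f \<longleftrightarrow> (\<forall>\<psi>\<in>discrete_part M f. \<exists>c. AE x in M. \<psi> x = c)"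

definition strongly_mixing :: "'a measure \<Rightarrow> ('a \<Rightarrow> 'a) \<Rightarrow> bool" where
  "strongly_mixing M f \<longleftrightarrow>
     (\<forall>\<psi>\<in>L2 M. \<forall>\<eta>\<in>L2 M.
        (\<lambda>N. L2inner M \<psi> ((koopman f ^^ N) \<eta>)) \<longlonglongrightarrow> (\<integral>x. \<psi> x \<partial>M) * cnj (\<integral>x. \<eta> x \<partial>M))"

definition purely_discrete_spectrum :: "'a measure \<Rightarrow> ('a \<Rightarrow> 'a) \<Rightarrow> bool" where
  "purely_discrete_spectrum M f \<longleftrightarrow>
     (\<forall>\<psi>\<in>L2_orthogonal M (discrete_part M f). AE x in M. \<psi> x = 0)"


section \<open>Direct forecast\<close>

text \<open>\<open>H\<close> is a linear space of scalar functions of the variable \<open>\<Phi>\<close>; vector-valued hypothesis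
  functions are those all of whose components lie in \<open>H\<close>.\<close>

definition hypothesis_space :: "'a measure \<Rightarrow> ('a \<Rightarrow> 'y) \<Rightarrow> ('y \<Rightarrow> complex) set \<Rightarrow> bool" where
  "hypothesis_space M \<Phi> H \<longleftrightarrow> cfun.subspace H \<and> (\<forall>h\<in>H. h \<circ> \<Phi> \<in> L2 M)"

text \<open>The subspace of \<open>L\<^sup>2\<close> obtained by composing the hypothesis functions with \<open>\<Phi>\<close>.\<close>

definition hyp_subspace ::
  "'a measure \<Rightarrow> ('a \<Rightarrow> 'y) \<Rightarrow> ('y \<Rightarrow> complex) set \<Rightarrow> ('a \<Rightarrow> complex) set" where
  "hyp_subspace M \<Phi> H = {\<psi> \<in> L2 M. \<exists>h\<in>H. AE x in M. \<psi> x = h (\<Phi> x)}"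

definition admissible_hypothesis_space ::
  "'a measure \<Rightarrow> ('a \<Rightarrow> 'y) \<Rightarrow> ('y \<Rightarrow> complex) set \<Rightarrow> bool" where
  "admissible_hypothesis_space M \<Phi> H \<longleftrightarrow>
     hypothesis_space M \<Phi> H \<and>
     L2_finite_dim M (hyp_subspace M \<Phi> H) \<and>
     (\<forall>c. (\<lambda>_. c) \<in> hyp_subspace M \<Phi> H)"

definition direct_forecast ::
  "'a measure \<Rightarrow> ('a \<Rightarrow> 'a) \<Rightarrow> ('a \<Rightarrow> complex ^ 'd) \<Rightarrow> ('a \<Rightarrow> 'y) \<Rightarrow> ('y \<Rightarrow> complex) set
    \<Rightarrow> nat \<Rightarrow> 'y \<Rightarrow> complex ^ 'd" where
  "direct_forecast M f \<phi> \<Phi> H n =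
     (SOME w. (\<forall>i. (\<lambda>y. w y $ i) \<in> H) \<and>
        (AE x in M. w (\<Phi> x) = L2_proj_vec M (hyp_subspace M \<Phi> H) ((koopman f ^^ n) \<phi>) x))"

definition error_direct ::
  "'a measure \<Rightarrow> ('a \<Rightarrow> 'a) \<Rightarrow> ('a \<Rightarrow> complex ^ 'd) \<Rightarrow> ('a \<Rightarrow> 'y) \<Rightarrow> ('y \<Rightarrow> complex) set
    \<Rightarrow> nat \<Rightarrow> real" where
  "error_direct M f \<phi> \<Phi> H n =
     L2norm M (\<lambda>x. (koopman f ^^ n) \<phi> x - direct_forecast M f \<phi> \<Phi> H n (\<Phi> x))"


section \<open>Limits along sets of density one\<close>

definition density_one :: "nat set \<Rightarrow> bool" where
  "density_one S \<longleftrightarrow> (\<lambda>N. real (card (S \<inter> {..<N})) / real N) \<longlonglongrightarrow> 1"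

definition at_infinity_along :: "nat set \<Rightarrow> nat filter" where
  "at_infinity_along S = inf sequentially (principal S)"

end

theory Submission
  imports Defs
begin

text \<open>
  Let \<open>U\<close> be the Koopman operator on \<open>L\<^sup>2\<close> of the support, which carries all the mass and is mapped to itself
  by \<open>f\<close> (\<open>measure_preserving_on_support\<close>).  Split each component of \<open>\<phi>\<close> as \<open>d + c\<close>
  with \<open>d\<close> in the closed span of the eigenfunctions and \<open>c\<close> orthogonal to it.  The error at time
  \<open>n\<close> is the distance of \<open>U ^ n \<phi>\<close> to \<open>W\<close>.  The part \<open>d\<close> is close to a combination of finitely many
  eigenfunctions.  These span a finite-dimensional invariant space, and once \<open>W\<close> contains it this part is
  forecast well at all times.  The part \<open>U ^ n c\<close> keeps its norm but converges weakly to zero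
  along a set of density one, so its projection to the finite-dimensional space \<open>W\<close> tends to zero
  in norm and the distance tends to the norm of \<open>c\<close> (\<open>error_direct_close\<close>, \<open>finite_dim_proj_tendsto_0\<close>).

  The substance is the weak convergence (\<open>weakly_null_along_density_one\<close>).  It follows from the
  vanishing of \<open>\<bar>\<langle>U ^ n c, c\<rangle>\<bar>\<^sup>2\<close> in Cesaro mean by the Koopman--von Neumann lemma.  The
  mean-square statement is proved without a spectral measure.  By the mean ergodic theorem the
  averages of \<open>z ^ n * U ^ n c\<close> tend to zero for every \<open>z\<close> on the unit circle, since a nonzero limit would
  be an eigenfunction not orthogonal to \<open>c\<close>.  Dini's argument makes this uniform in \<open>z\<close>
  (\<open>uniform_mean_ergodic\<close>).  The squared norms of these averages are nonnegative
  trigonometric polynomials in \<open>z\<close> whose coefficients are weighted autocorrelations of \<open>c\<close>, and a Parseval-type estimate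
  over roots of unity turns the uniform bound into the mean-square bound
  (\<open>autocorrelation_square_sum_le\<close>).
\<close>

section \<open>Geometry of square-integrable functions\<close>

lemma L2_measurable [measurable_dest]: "\<psi> \<in> L2 M \<Longrightarrow> \<psi> \<in> borel_measurable M"
  by (simp add: L2_def)

lemma L2_integrable_square: "\<psi> \<in> L2 M \<Longrightarrow> integrable M (\<lambda>x. (norm (\<psi> x))\<^sup>2)"
  by (simp add: L2_def)

lemma L2I:
  "\<psi> \<in> borel_measurable M \<Longrightarrow> integrable M (\<lambda>x. (norm (\<psi> x))\<^sup>2) \<Longrightarrow> \<psi> \<in> L2 M"
  by (simp add: L2_def)

lemma norm_add_square_le: "(norm (a + b))\<^sup>2 \<le> 2 * (norm a)\<^sup>2 + 2 * (norm b)\<^sup>2"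
  for a b :: "'v::real_normed_vector"
proof -
  have "(norm (a + b))\<^sup>2 \<le> (norm a + norm b)\<^sup>2"
    by (intro power_mono norm_triangle_ineq) auto
  also have "\<dots> \<le> 2 * (norm a)\<^sup>2 + 2 * (norm b)\<^sup>2"
    using sum_squares_bound[of "norm a" "norm b"] by (simp add: power2_sum)
  finally show ?thesis .
qed

lemma subspace_L2: "cfun.subspace (L2 M)"
  unfolding cfun.subspace_def
proof (intro conjI ballI allI)
  show "0 \<in> L2 M"
    unfolding zero_fun_def by (intro L2I) auto
next
  fix \<psi> \<eta> assume [measurable]: "\<psi> \<in> L2 M" "\<eta> \<in> L2 M"
  then have "integrable M (\<lambda>x. 2 * (norm (\<psi> x))\<^sup>2 + 2 * (norm (\<eta> x))\<^sup>2)"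
    using L2_integrable_square[of \<psi> M] L2_integrable_square[of \<eta> M] by simp
  then have "integrable M (\<lambda>x. (norm (\<psi> x + \<eta> x))\<^sup>2)"
    by (rule Bochner_Integration.integrable_bound) (auto simp: norm_add_square_le)
  then show "\<psi> + \<eta> \<in> L2 M"
    unfolding plus_fun_def by (intro L2I) auto
next
  fix c \<psi> assume [measurable]: "\<psi> \<in> L2 M"
  show "cscale c \<psi> \<in> L2 M"
    unfolding cscale_def norm_mult power_mult_distrib
    using L2_integrable_square[OF \<open>\<psi> \<in> L2 M\<close>]
    by (intro L2I) (auto simp: norm_mult power_mult_distrib)
qed

lemmas L2_zero [simp, intro] = cfun.subspace_0[OF subspace_L2]
  and L2_add [simp, intro] = cfun.subspace_add[OF subspace_L2]
  and L2_diff [simp, intro] = cfun.subspace_diff[OF subspace_L2]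
  and L2_cscale [simp, intro] = cfun.subspace_scale[OF subspace_L2]
  and L2_sum [simp, intro] = cfun.subspace_sum[OF subspace_L2]

lemma (in finite_measure) L2_const [simp, intro]: "(\<lambda>_. c) \<in> L2 M"
  by (intro L2I) auto

lemma borel_measurable_cnj [measurable]: "cnj \<in> borel_measurable borel"
  by (intro borel_measurable_continuous_onI continuous_intros)

lemma L2_integrable_mult:
  assumes [measurable]: "\<psi> \<in> L2 M" "\<eta> \<in> L2 M"
  shows "integrable M (\<lambda>x. \<psi> x * cnj (\<eta> x))"
proof -
  have "integrable M (\<lambda>x. (norm (\<psi> x))\<^sup>2 + (norm (\<eta> x))\<^sup>2)"
    using L2_integrable_square[of \<psi> M] L2_integrable_square[of \<eta> M] assms by simp
  moreover have "(\<lambda>x. \<psi> x * cnj (\<eta> x)) \<in> borel_measurable M"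
    by measurable
  moreover have "norm (\<psi> x * cnj (\<eta> x)) \<le> norm ((norm (\<psi> x))\<^sup>2 + (norm (\<eta> x))\<^sup>2)" for x
    using sum_squares_bound[of "norm (\<psi> x)" "norm (\<eta> x)"]
      mult_nonneg_nonneg[OF norm_ge_zero[of "\<psi> x"] norm_ge_zero[of "\<eta> x"]]
    unfolding norm_mult complex_mod_cnj real_norm_def by linarith
  ultimately show ?thesis
    by (metis (no_types, lifting) Bochner_Integration.integrable_bound AE_I2)
qed

lemma L2inner_add_left:
  "\<psi> \<in> L2 M \<Longrightarrow> \<theta> \<in> L2 M \<Longrightarrow> \<eta> \<in> L2 M \<Longrightarrow>
    L2inner M (\<psi> + \<theta>) \<eta> = L2inner M \<psi> \<eta> + L2inner M \<theta> \<eta>"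
  by (simp add: L2inner_def distrib_right L2_integrable_mult)

lemma L2inner_cscale_left: "L2inner M (cscale c \<psi>) \<eta> = c * L2inner M \<psi> \<eta>"
  by (simp add: L2inner_def cscale_def mult.assoc)

lemma L2inner_commute: "L2inner M \<eta> \<psi> = cnj (L2inner M \<psi> \<eta>)"
  unfolding L2inner_def by (subst Bochner_Integration.integral_cnj[symmetric]) (simp add: mult.commute)

lemma L2inner_cscale_right: "L2inner M \<psi> (cscale c \<eta>) = cnj c * L2inner M \<psi> \<eta>"
  by (simp add: L2inner_def cscale_def mult.left_commute)

lemma L2inner_add_right:
  "\<psi> \<in> L2 M \<Longrightarrow> \<theta> \<in> L2 M \<Longrightarrow> \<eta> \<in> L2 M \<Longrightarrow>
    L2inner M \<eta> (\<psi> + \<theta>) = L2inner M \<eta> \<psi> + L2inner M \<eta> \<theta>"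
  by (simp add: L2inner_def distrib_left L2_integrable_mult)

lemma L2inner_diff_left:
  "\<psi> \<in> L2 M \<Longrightarrow> \<theta> \<in> L2 M \<Longrightarrow> \<eta> \<in> L2 M \<Longrightarrow>
    L2inner M (\<psi> - \<theta>) \<eta> = L2inner M \<psi> \<eta> - L2inner M \<theta> \<eta>"
  by (simp add: L2inner_def left_diff_distrib L2_integrable_mult)

lemma L2inner_diff_right:
  "\<psi> \<in> L2 M \<Longrightarrow> \<theta> \<in> L2 M \<Longrightarrow> \<eta> \<in> L2 M \<Longrightarrow>
    L2inner M \<eta> (\<psi> - \<theta>) = L2inner M \<eta> \<psi> - L2inner M \<eta> \<theta>"
  by (simp add: L2inner_def right_diff_distrib L2_integrable_mult)

lemma L2inner_zero_left [simp]: "L2inner M 0 \<eta> = 0"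
  by (simp add: L2inner_def)

lemma L2inner_zero_right [simp]: "L2inner M \<eta> 0 = 0"
  by (simp add: L2inner_def)

lemma L2inner_sum_left:
  "(\<And>i. i \<in> I \<Longrightarrow> \<psi> i \<in> L2 M) \<Longrightarrow> \<eta> \<in> L2 M \<Longrightarrow>
    L2inner M (\<Sum>i\<in>I. \<psi> i) \<eta> = (\<Sum>i\<in>I. L2inner M (\<psi> i) \<eta>)"
  by (induction I rule: infinite_finite_induct) (auto simp: L2inner_add_left)

lemma L2inner_sum_right:
  "(\<And>i. i \<in> I \<Longrightarrow> \<psi> i \<in> L2 M) \<Longrightarrow> \<eta> \<in> L2 M \<Longrightarrow>
    L2inner M \<eta> (\<Sum>i\<in>I. \<psi> i) = (\<Sum>i\<in>I. L2inner M \<eta> (\<psi> i))"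
  by (induction I rule: infinite_finite_induct) (auto simp: L2inner_add_right)

lemma L2inner_cong_AE:
  assumes "\<psi> \<in> L2 M" "\<psi>' \<in> L2 M" "\<eta> \<in> L2 M" "\<eta>' \<in> L2 M"
    and "AE x in M. \<psi> x = \<psi>' x" "AE x in M. \<eta> x = \<eta>' x"
  shows "L2inner M \<psi> \<eta> = L2inner M \<psi>' \<eta>'"
proof -
  note [measurable] = assms(1-4)
  have "AE x in M. \<psi> x * cnj (\<eta> x) = \<psi>' x * cnj (\<eta>' x)"
    using assms(5,6) by eventually_elim simp
  then show ?thesis
    unfolding L2inner_def by (intro integral_cong_AE) auto
qed

lemma L2norm_nonneg [simp]: "0 \<le> L2norm M \<psi>"
  by (simp add: L2norm_def)

lemma L2norm_square: "(L2norm M \<psi>)\<^sup>2 = (\<integral>x. (norm (\<psi> x))\<^sup>2 \<partial>M)"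
  by (simp add: L2norm_def)

lemma L2inner_self: "L2inner M \<psi> \<psi> = complex_of_real ((L2norm M \<psi>)\<^sup>2)"
  unfolding L2inner_def L2norm_square complex_norm_square[symmetric]
  by (rule integral_complex_of_real)

lemma L2norm_square_add:
  assumes "\<psi> \<in> L2 M" "\<eta> \<in> L2 M"
  shows "(L2norm M (\<psi> + \<eta>))\<^sup>2 = (L2norm M \<psi>)\<^sup>2 + 2 * Re (L2inner M \<psi> \<eta>) + (L2norm M \<eta>)\<^sup>2"
proof -
  have Re_self: "(L2norm M \<theta>)\<^sup>2 = Re (L2inner M \<theta> \<theta>)" for \<theta>
    by (simp only: L2inner_self Re_complex_of_real)
  have "L2inner M (\<psi> + \<eta>) (\<psi> + \<eta>)
      = L2inner M \<psi> \<psi> + L2inner M \<psi> \<eta> + (L2inner M \<eta> \<psi> + L2inner M \<eta> \<eta>)"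
    using assms by (simp add: L2inner_add_left L2inner_add_right)
  moreover have "Re (L2inner M \<eta> \<psi>) = Re (L2inner M \<psi> \<eta>)"
    by (subst L2inner_commute) simp
  ultimately show ?thesis
    unfolding Re_self by simp
qed

lemma L2norm_cscale: "L2norm M (cscale c \<psi>) = norm c * L2norm M \<psi>"
  by (simp add: L2norm_def cscale_def norm_mult power_mult_distrib real_sqrt_mult)

lemma L2norm_square_diff:
  assumes "\<psi> \<in> L2 M" "\<eta> \<in> L2 M"
  shows "(L2norm M (\<psi> - \<eta>))\<^sup>2 = (L2norm M \<psi>)\<^sup>2 - 2 * Re (L2inner M \<psi> \<eta>) + (L2norm M \<eta>)\<^sup>2"
proof -
  have "\<psi> - \<eta> = \<psi> + cscale (-1) \<eta>"
    by (simp add: fun_eq_iff cscale_def)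
  then have "(L2norm M (\<psi> - \<eta>))\<^sup>2 = (L2norm M (\<psi> + cscale (-1) \<eta>))\<^sup>2"
    by (rule arg_cong)
  also have "\<dots> = (L2norm M \<psi>)\<^sup>2 + 2 * Re (L2inner M \<psi> (cscale (-1) \<eta>))
      + (L2norm M (cscale (-1) \<eta>))\<^sup>2"
    using assms by (intro L2norm_square_add L2_cscale)
  finally show ?thesis
    unfolding L2inner_cscale_right L2norm_cscale by simp
qed

lemma L2norm_minus_commute: "L2norm M (\<psi> - \<eta>) = L2norm M (\<eta> - \<psi>)"
  by (simp add: L2norm_def norm_minus_commute)

lemma L2norm_zero [simp]: "L2norm M (0 :: _ \<Rightarrow> complex) = 0"
  by (simp add: L2norm_def)

lemma L2norm_eq_0_iff:
  assumes "\<psi> \<in> L2 M"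
  shows "L2norm M \<psi> = 0 \<longleftrightarrow> (AE x in M. \<psi> x = 0)"
  using integral_nonneg_eq_0_iff_AE[OF L2_integrable_square[OF assms]] by (simp add: L2norm_def)

lemma L2norm_cong_AE:
  assumes "\<psi> \<in> borel_measurable M" "\<eta> \<in> borel_measurable M" "AE x in M. \<psi> x = \<eta> x"
  shows "L2norm M \<psi> = L2norm M \<eta>"
proof -
  note [measurable] = assms(1,2)
  have "AE x in M. (norm (\<psi> x))\<^sup>2 = (norm (\<eta> x))\<^sup>2"
    using assms(3) by eventually_elim simp
  then show ?thesis
    unfolding L2norm_def by (intro arg_cong[where f = sqrt] integral_cong_AE) auto
qed

text \<open>The gain from subtracting the component along \<open>\<eta>\<close> yields both the Cauchy--Schwarz inequality
  (the left-hand side is nonnegative) and the orthogonality of a nearest point (no gain is possible).\<close>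

lemma L2norm_square_remove_component:
  assumes "\<psi> \<in> L2 M" "\<eta> \<in> L2 M" and "L2norm M \<eta> \<noteq> 0"
  shows "(L2norm M (\<psi> - cscale (L2inner M \<psi> \<eta> / (L2norm M \<eta>)\<^sup>2) \<eta>))\<^sup>2
      = (L2norm M \<psi>)\<^sup>2 - (norm (L2inner M \<psi> \<eta>))\<^sup>2 / (L2norm M \<eta>)\<^sup>2"
proof -
  define a where "a = L2inner M \<psi> \<eta>"
  define b where "b = (L2norm M \<eta>)\<^sup>2"
  have b: "b \<noteq> 0"
    using assms by (simp add: b_def)
  have "Re (L2inner M \<psi> (cscale (a / b) \<eta>)) = (norm a)\<^sup>2 / b"
    unfolding L2inner_cscale_right a_def[symmetric] cmod_power2
    by (simp add: power2_eq_square add_divide_distrib)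
  moreover have "(L2norm M (cscale (a / b) \<eta>))\<^sup>2 = (norm a)\<^sup>2 / b"
    using b by (simp add: L2norm_cscale power_mult_distrib norm_divide power_divide
        b_def[symmetric] power2_eq_square[of b])
  ultimately have "(L2norm M (\<psi> - cscale (a / b) \<eta>))\<^sup>2 = (L2norm M \<psi>)\<^sup>2 - (norm a)\<^sup>2 / b"
    using L2norm_square_diff[of \<psi> M "cscale (a / b) \<eta>"] assms by simp
  then show ?thesis
    by (simp add: a_def b_def)
qed

lemma L2_Cauchy_Schwarz:
  assumes "\<psi> \<in> L2 M" "\<eta> \<in> L2 M"
  shows "norm (L2inner M \<psi> \<eta>) \<le> L2norm M \<psi> * L2norm M \<eta>"
proof (cases "L2norm M \<eta> = 0")
  case True
  then have "AE x in M. \<eta> x = 0"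
    using assms L2norm_eq_0_iff by blast
  then have "L2inner M \<psi> \<eta> = L2inner M \<psi> 0"
    using assms by (intro L2inner_cong_AE) auto
  then show ?thesis
    by simp
next
  case False
  then have "0 \<le> (L2norm M \<psi>)\<^sup>2 - (norm (L2inner M \<psi> \<eta>))\<^sup>2 / (L2norm M \<eta>)\<^sup>2"
    using L2norm_square_remove_component[OF assms False] by (metis zero_le_power2)
  then have "(norm (L2inner M \<psi> \<eta>))\<^sup>2 \<le> (L2norm M \<psi> * L2norm M \<eta>)\<^sup>2"
    using False by (simp add: field_simps power_mult_distrib)
  then show ?thesis
    by (rule power2_le_imp_le) simp
qed

lemma L2norm_triangle:
  assumes "\<psi> \<in> L2 M" "\<eta> \<in> L2 M"
  shows "L2norm M (\<psi> + \<eta>) \<le> L2norm M \<psi> + L2norm M \<eta>"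
proof (rule power2_le_imp_le)
  have "Re (L2inner M \<psi> \<eta>) \<le> L2norm M \<psi> * L2norm M \<eta>"
    using L2_Cauchy_Schwarz[OF assms] complex_Re_le_cmod[of "L2inner M \<psi> \<eta>"] by linarith
  then show "(L2norm M (\<psi> + \<eta>))\<^sup>2 \<le> (L2norm M \<psi> + L2norm M \<eta>)\<^sup>2"
    unfolding L2norm_square_add[OF assms] power2_sum by linarith
  show "0 \<le> L2norm M \<psi> + L2norm M \<eta>"
    by (intro add_nonneg_nonneg L2norm_nonneg)
qed

lemma L2norm_triangle_diff:
  assumes "\<psi> \<in> L2 M" "\<eta> \<in> L2 M" "\<theta> \<in> L2 M"
  shows "L2norm M (\<psi> - \<eta>) \<le> L2norm M (\<psi> - \<theta>) + L2norm M (\<theta> - \<eta>)"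
proof -
  have "L2norm M ((\<psi> - \<theta>) + (\<theta> - \<eta>)) \<le> L2norm M (\<psi> - \<theta>) + L2norm M (\<theta> - \<eta>)"
    using assms by (intro L2norm_triangle L2_diff)
  then show ?thesis
    by (simp only: diff_add_cancel add_diff_eq)
qed

lemma L2norm_reverse_triangle:
  assumes "\<psi> \<in> L2 M" "\<eta> \<in> L2 M"
  shows "\<bar>L2norm M \<psi> - L2norm M \<eta>\<bar> \<le> L2norm M (\<psi> - \<eta>)"
proof -
  have *: "L2norm M \<alpha> \<le> L2norm M (\<alpha> - \<beta>) + L2norm M \<beta>" if "\<alpha> \<in> L2 M" "\<beta> \<in> L2 M" for \<alpha> \<beta>
    using L2norm_triangle[OF L2_diff[OF that] that(2)] by (simp only: diff_add_cancel)
  show ?thesis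
    using *[OF assms] *[OF assms(2,1)] L2norm_minus_commute[of M \<psi> \<eta>] by linarith
qed

lemma L2norm_sum_le:
  assumes "\<And>i. i \<in> I \<Longrightarrow> \<psi> i \<in> L2 M"
  shows "L2norm M (\<Sum>i\<in>I. \<psi> i) \<le> (\<Sum>i\<in>I. L2norm M (\<psi> i))"
  using assms
proof (induction I rule: infinite_finite_induct)
  case (insert i I)
  have "L2norm M (\<psi> i + (\<Sum>i\<in>I. \<psi> i)) \<le> L2norm M (\<psi> i) + L2norm M (\<Sum>i\<in>I. \<psi> i)"
    using insert.prems by (intro L2norm_triangle L2_sum) auto
  moreover have "L2norm M (\<Sum>i\<in>I. \<psi> i) \<le> (\<Sum>i\<in>I. L2norm M (\<psi> i))"
    using insert by simp
  ultimately show ?case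
    unfolding sum.insert[OF insert.hyps(1,2)] by linarith
qed simp_all

lemma L2norm_square_mono:
  assumes "\<psi> \<in> L2 M" "\<eta> \<in> L2 M" "L2inner M \<psi> \<eta> = 0"
  shows "L2norm M \<psi> \<le> L2norm M (\<psi> + \<eta>)"
proof (rule power2_le_imp_le)
  show "(L2norm M \<psi>)\<^sup>2 \<le> (L2norm M (\<psi> + \<eta>))\<^sup>2"
    using L2norm_square_add[OF assms(1,2)] assms(3) by simp
qed simp

section \<open>Completeness and orthogonal projection\<close>

text \<open>The Riesz--Fischer theorem for rapidly convergent sequences: the increments are summable in
  \<open>L\<^sup>1\<close>, hence almost everywhere, and Fatou's lemma identifies the pointwise limit as the limit
  in \<open>L\<^sup>2\<close>.\<close>

lemma (in prob_space) L2_complete: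
  assumes r: "\<And>n. r n \<in> L2 M"
    and cauchy: "\<And>m n. n \<le> m \<Longrightarrow> L2norm M (r m - r n) \<le> (1 / 2) ^ n"
  shows "\<exists>p\<in>L2 M. \<forall>n. L2norm M (p - r n) \<le> (1 / 2) ^ n"
proof -
  note [measurable] = L2_measurable[OF r]
  have nn: "(\<integral>\<^sup>+x. ennreal ((norm (\<psi> x))\<^sup>2) \<partial>M) = ennreal ((L2norm M \<psi>)\<^sup>2)" if "\<psi> \<in> L2 M" for \<psi>
    unfolding L2norm_square using L2_integrable_square[OF that]
    by (intro nn_integral_eq_integral) auto
  define d where "d n x = norm (r (Suc n) x - r n x)" for n x
  have d_nonneg: "0 \<le> d n x" for n x
    by (simp add: d_def)
  have [measurable]: "d n \<in> borel_measurable M" for n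
    unfolding d_def by measurable
  have d_L2: "(\<lambda>x. complex_of_real (d n x)) \<in> L2 M" for n
    using L2_integrable_square[OF L2_diff[OF r[of "Suc n"] r[of n]]]
    by (intro L2I) (auto simp: d_def)
  have d_int: "integrable M (d n)" for n
    using L2_integrable_mult[OF d_L2[of n] L2_const[of 1]] complex_of_real_integrable_eq[of M "d n"] by simp
  have d_le: "(\<integral>x. d n x \<partial>M) \<le> (1 / 2) ^ n" for n
  proof -
    have "norm (L2inner M (\<lambda>x. complex_of_real (d n x)) (\<lambda>_. 1))
        \<le> L2norm M (\<lambda>x. complex_of_real (d n x)) * L2norm M (\<lambda>_. 1 :: complex)"
      by (intro L2_Cauchy_Schwarz d_L2 L2_const)
    also have "L2norm M (\<lambda>x. complex_of_real (d n x)) = L2norm M (r (Suc n) - r n)"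
      by (simp add: L2norm_def d_def)
    also have "L2norm M (\<lambda>_. 1 :: complex) = 1"
      by (simp add: L2norm_def prob_space)
    also have "norm (L2inner M (\<lambda>x. complex_of_real (d n x)) (\<lambda>_. 1)) = \<bar>\<integral>x. d n x \<partial>M\<bar>"
      by (simp add: L2inner_def)
    finally show ?thesis
      using cauchy[of n "Suc n"] by linarith
  qed
  have "(\<integral>\<^sup>+x. (\<Sum>n. ennreal (d n x)) \<partial>M) = (\<Sum>n. \<integral>\<^sup>+x. ennreal (d n x) \<partial>M)"
    by (rule nn_integral_suminf) measurable
  also have "\<dots> = (\<Sum>n. ennreal (\<integral>x. d n x \<partial>M))"
    using d_int by (intro suminf_cong nn_integral_eq_integral) (auto simp: d_nonneg)
  also have "\<dots> \<le> (\<Sum>n. ennreal ((1 / 2) ^ n))"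
    by (intro suminf_le ennreal_leI d_le) auto
  also have "\<dots> < \<infinity>"
    unfolding infinity_ennreal_def less_top[symmetric]
    by (intro ennreal_suminf_neq_top summable_geometric) auto
  finally have "AE x in M. (\<Sum>n. ennreal (d n x)) \<noteq> \<infinity>"
    by (intro nn_integral_PInf_AE) auto
  then have lim: "AE x in M. (\<lambda>n. r n x) \<longlonglongrightarrow> lim (\<lambda>n. r n x)"
  proof eventually_elim
    case (elim x)
    then have "summable (\<lambda>n. d n x)"
      by (intro summable_suminf_not_top) (auto simp: d_def)
    then have "summable (\<lambda>n. r (Suc n) x - r n x)"
      unfolding d_def by (rule summable_norm_cancel)
    then have "convergent (\<lambda>n. \<Sum>i<n. r (Suc i) x - r i x)"
      by (simp add: summable_iff_convergent)
    then have "convergent (\<lambda>n. r n x - r 0 x)"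
      by (simp only: sum_lessThan_telescope[where f = "\<lambda>n. r n x"])
    then have "convergent (\<lambda>n. (r n x - r 0 x) + r 0 x)"
      by (intro convergent_add convergent_const)
    then show ?case
      by (simp add: convergent_LIMSEQ_iff)
  qed
  define p where "p x = lim (\<lambda>n. r n x)" for x
  have [measurable]: "p \<in> borel_measurable M"
    unfolding p_def by measurable
  have fatou: "(\<integral>\<^sup>+x. ennreal ((norm (p x - r n x))\<^sup>2) \<partial>M) \<le> ennreal (((1 / 2) ^ n)\<^sup>2)" for n
  proof -
    have "AE x in M. ennreal ((norm (p x - r n x))\<^sup>2)
        = liminf (\<lambda>m. ennreal ((norm (r m x - r n x))\<^sup>2))"
      using lim
    proof eventually_elim
      case (elim x)
      then have "(\<lambda>m. ennreal ((norm (r m x - r n x))\<^sup>2)) \<longlonglongrightarrow> ennreal ((norm (p x - r n x))\<^sup>2)"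
        unfolding p_def by (intro tendsto_intros)
      then show ?case
        using lim_imp_Liminf[OF sequentially_bot] by metis
    qed
    then have "(\<integral>\<^sup>+x. ennreal ((norm (p x - r n x))\<^sup>2) \<partial>M)
        = (\<integral>\<^sup>+x. liminf (\<lambda>m. ennreal ((norm (r m x - r n x))\<^sup>2)) \<partial>M)"
      by (rule nn_integral_cong_AE)
    also have "\<dots> \<le> liminf (\<lambda>m. \<integral>\<^sup>+x. ennreal ((norm (r m x - r n x))\<^sup>2) \<partial>M)"
      by (rule nn_integral_liminf) measurable
    also have "\<dots> \<le> ennreal (((1 / 2) ^ n)\<^sup>2)"
    proof (rule Liminf_le)
      show "\<forall>\<^sub>F m in sequentially.
          (\<integral>\<^sup>+x. ennreal ((norm (r m x - r n x))\<^sup>2) \<partial>M) \<le> ennreal (((1 / 2) ^ n)\<^sup>2)"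
        using eventually_ge_at_top[of n]
      proof eventually_elim
        case (elim m)
        show ?case
          using nn[OF L2_diff[OF r[of m] r[of n]]] cauchy[OF elim]
          by (auto intro!: ennreal_leI power_mono)
      qed
    qed simp
    finally show ?thesis .
  qed
  have diff_L2: "p - r n \<in> L2 M" for n
    unfolding fun_diff_def
  proof (intro L2I integrableI_bounded)
    show "(\<integral>\<^sup>+x. ennreal (norm ((norm (p x - r n x))\<^sup>2)) \<partial>M) < \<infinity>"
      using order_le_less_trans[OF fatou[of n] ennreal_less_top] by simp
  qed measurable
  have "L2norm M (p - r n) \<le> (1 / 2) ^ n" for n
  proof -
    have "ennreal ((L2norm M (p - r n))\<^sup>2) \<le> ennreal (((1 / 2) ^ n)\<^sup>2)"
      using nn[OF diff_L2[of n]] fatou[of n] by simp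
    then have "(L2norm M (p - r n))\<^sup>2 \<le> ((1 / 2) ^ n)\<^sup>2"
      by (subst (asm) ennreal_le_iff) auto
    then show ?thesis
      by (rule power2_le_imp_le) simp
  qed
  moreover have "p \<in> L2 M"
    using L2_add[OF diff_L2[of 0] r[of 0]] by simp
  ultimately show ?thesis
    by blast
qed

lemma L2_closure_iff:
  "\<psi> \<in> L2_closure M S \<longleftrightarrow> \<psi> \<in> L2 M \<and> (\<forall>e>0. \<exists>\<eta>\<in>S. L2norm M (\<psi> - \<eta>) < e)"
  by (simp add: L2_closure_def fun_diff_def)

lemma L2_closure_subset_L2: "L2_closure M S \<subseteq> L2 M"
  by (auto simp: L2_closure_def)

lemma subset_L2_closure: "S \<subseteq> L2 M \<Longrightarrow> S \<subseteq> L2_closure M S"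
proof
  fix \<psi> assume \<psi>: "\<psi> \<in> S" "S \<subseteq> L2 M"
  have "L2norm M (\<psi> - \<psi>) = 0"
    by (simp add: L2norm_def)
  then have "\<exists>\<eta>\<in>S. L2norm M (\<psi> - \<eta>) < e" if "e > 0" for e
    using \<psi>(1) that by (intro bexI[of _ \<psi>]) simp_all
  then show "\<psi> \<in> L2_closure M S"
    unfolding L2_closure_iff using \<psi> by blast
qed

lemma subspace_L2_closure:
  assumes R: "cfun.subspace R" "R \<subseteq> L2 M"
  shows "cfun.subspace (L2_closure M R)"
  unfolding cfun.subspace_def
proof (intro conjI ballI allI)
  show "0 \<in> L2_closure M R"
    using subset_L2_closure[OF R(2)] cfun.subspace_0[OF R(1)] by blast
next
  fix \<psi> \<eta> assume *: "\<psi> \<in> L2_closure M R" "\<eta> \<in> L2_closure M R"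
  then have L2: "\<psi> \<in> L2 M" "\<eta> \<in> L2 M"
    by (auto simp: L2_closure_iff)
  show "\<psi> + \<eta> \<in> L2_closure M R"
    unfolding L2_closure_iff
  proof (intro conjI allI impI)
    fix e :: real assume "e > 0"
    then obtain a b where ab: "a \<in> R" "b \<in> R" "L2norm M (\<psi> - a) < e / 2" "L2norm M (\<eta> - b) < e / 2"
      using * unfolding L2_closure_iff by (meson half_gt_zero)
    then have "L2norm M ((\<psi> - a) + (\<eta> - b)) < e"
      using L2norm_triangle[of "\<psi> - a" M "\<eta> - b"] L2 R by fastforce
    then show "\<exists>c\<in>R. L2norm M (\<psi> + \<eta> - c) < e"
      using ab cfun.subspace_add[OF R(1)] by (intro bexI[of _ "a + b"]) (auto simp: add_diff_add)
  qed (use L2 in auto)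
next
  fix c \<psi> assume *: "\<psi> \<in> L2_closure M R"
  show "cscale c \<psi> \<in> L2_closure M R"
    unfolding L2_closure_iff
  proof (intro conjI allI impI)
    fix e :: real assume "e > 0"
    then have "e / (norm c + 1) > 0"
      by (simp add: add_nonneg_pos)
    then obtain a where a: "a \<in> R" "L2norm M (\<psi> - a) < e / (norm c + 1)"
      using * unfolding L2_closure_iff by blast
    have "norm c * L2norm M (\<psi> - a) \<le> (norm c + 1) * L2norm M (\<psi> - a)"
      by (intro mult_right_mono) auto
    also have "\<dots> < e"
      using a(2) by (subst (asm) pos_less_divide_eq) (auto simp: mult.commute add_nonneg_pos)
    finally have "L2norm M (cscale c \<psi> - cscale c a) < e"
      by (simp add: L2norm_cscale flip: cfun.scale_right_diff_distrib)
    then show "\<exists>b\<in>R. L2norm M (cscale c \<psi> - b) < e"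
      using a(1) cfun.subspace_scale[OF R(1)] by blast
  qed (use * in \<open>auto simp: L2_closure_iff\<close>)
qed

lemma L2_closure_closed: 
  assumes "S \<subseteq> L2 M"
  shows "L2_closure M (L2_closure M S) \<subseteq> L2_closure M S"
proof
  fix \<psi> assume *: "\<psi> \<in> L2_closure M (L2_closure M S)"
  show "\<psi> \<in> L2_closure M S"
    unfolding L2_closure_iff
  proof (intro conjI allI impI)
    fix e :: real assume "e > 0"
    then obtain \<eta> where \<eta>: "\<eta> \<in> L2_closure M S" "L2norm M (\<psi> - \<eta>) < e / 2"
      using * unfolding L2_closure_iff[of \<psi>] by (meson half_gt_zero)
    then obtain \<theta> where \<theta>: "\<theta> \<in> S" "L2norm M (\<eta> - \<theta>) < e / 2"
      using \<open>e > 0\<close> unfolding L2_closure_iff by (meson half_gt_zero)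
    have "L2norm M (\<psi> - \<theta>) < e"
      using L2norm_triangle_diff[of \<psi> M \<theta> \<eta>] \<eta> \<theta> assms * by (force simp: L2_closure_iff)
    then show "\<exists>\<eta>\<in>S. L2norm M (\<psi> - \<eta>) < e"
      using \<theta> by blast
  qed (use * in \<open>auto simp: L2_closure_iff\<close>)
qed

lemma L2_closure_AE:
  assumes "\<psi> \<in> L2_closure M S" "\<eta> \<in> L2 M" "S \<subseteq> L2 M" "AE x in M. \<eta> x = \<psi> x"
  shows "\<eta> \<in> L2_closure M S"
  unfolding L2_closure_iff
proof (intro conjI allI impI)
  fix e :: real assume "e > 0"
  then obtain \<theta> where \<theta>: "\<theta> \<in> S" "L2norm M (\<psi> - \<theta>) < e"
    using assms(1) unfolding L2_closure_iff by blast
  have "\<psi> \<in> L2 M"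
    using assms(1) by (simp add: L2_closure_iff)
  then have "L2norm M (\<eta> - \<theta>) = L2norm M (\<psi> - \<theta>)"
    using assms \<theta>(1) by (intro L2norm_cong_AE L2_measurable L2_diff) auto
  then show "\<exists>\<theta>\<in>S. L2norm M (\<eta> - \<theta>) < e"
    using \<theta> by metis
qed (rule assms)

lemma L2_orthogonal_iff:
  "\<psi> \<in> L2_orthogonal M W \<longleftrightarrow> \<psi> \<in> L2 M \<and> (\<forall>\<eta>\<in>W. L2inner M \<psi> \<eta> = 0)"
  by (simp add: L2_orthogonal_def)

lemma L2_orthogonal_closure:
  assumes "S \<subseteq> L2 M" "\<psi> \<in> L2_orthogonal M S"
  shows "\<psi> \<in> L2_orthogonal M (L2_closure M S)"
  unfolding L2_orthogonal_iff
proof (intro conjI ballI)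
  show \<psi>: "\<psi> \<in> L2 M"
    using assms by (simp add: L2_orthogonal_iff)
  fix \<eta> assume \<eta>: "\<eta> \<in> L2_closure M S"
  have "norm (L2inner M \<psi> \<eta>) \<le> 0 + e" if "e > 0" for e
  proof -
    have "e / (L2norm M \<psi> + 1) > 0"
      using that by (simp add: add_nonneg_pos)
    then obtain \<theta> where \<theta>: "\<theta> \<in> S" "L2norm M (\<eta> - \<theta>) < e / (L2norm M \<psi> + 1)"
      using \<eta> unfolding L2_closure_iff by blast
    have "L2inner M \<psi> (\<eta> - \<theta>) = L2inner M \<psi> \<eta>"
      using assms \<theta> \<eta> by (auto simp: L2inner_diff_right L2_closure_iff L2_orthogonal_iff subsetD)
    then have "norm (L2inner M \<psi> \<eta>) \<le> L2norm M \<psi> * L2norm M (\<eta> - \<theta>)"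
      using L2_Cauchy_Schwarz[of \<psi> M "\<eta> - \<theta>"] \<psi> \<eta> \<theta> assms(1) by (auto simp: L2_closure_iff)
    also have "\<dots> \<le> (L2norm M \<psi> + 1) * L2norm M (\<eta> - \<theta>)"
      by (intro mult_right_mono) auto
    also have "\<dots> \<le> e"
      using \<theta>(2) by (subst (asm) pos_less_divide_eq) (auto simp: mult.commute add_nonneg_pos)
    finally show ?thesis by simp
  qed
  then show "L2inner M \<psi> \<eta> = 0"
    using field_le_epsilon[of "norm (L2inner M \<psi> \<eta>)" 0] by simp
qed

text \<open>A minimizing sequence for the distance to \<open>\<psi>\<close> is a Cauchy sequence by the parallelogram
  identity.  Its members are nearly orthogonal to \<open>R\<close>, since subtracting the component along
  \<open>\<eta>\<close> cannot bring the distance below the infimum.\<close>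

lemma (in prob_space) L2_projection_exists:
  assumes R: "cfun.subspace R" "R \<subseteq> L2 M" and \<psi>: "\<psi> \<in> L2 M"
  shows "\<exists>p\<in>L2_closure M R. \<psi> - p \<in> L2_orthogonal M (L2_closure M R)"
proof -
  define D where "D = (INF \<eta>\<in>R. (L2norm M (\<psi> - \<eta>))\<^sup>2)"
  have D_le: "D \<le> (L2norm M (\<psi> - \<eta>))\<^sup>2" if "\<eta> \<in> R" for \<eta>
    unfolding D_def using that by (intro cINF_lower bdd_belowI[of _ 0]) auto
  have "\<exists>\<eta>\<in>R. (L2norm M (\<psi> - \<eta>))\<^sup>2 < D + (1 / 4) ^ n / 4" for n
  proof -
    have "R \<noteq> {}"
      using cfun.subspace_0[OF R(1)] by blast
    moreover have "D < D + (1 / 4) ^ n / 4"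
      by simp
    ultimately show ?thesis
      unfolding D_def by (subst (asm) cINF_less_iff) (auto intro!: bdd_belowI[of _ 0])
  qed
  then obtain r where r: "\<And>n. r n \<in> R" and r_lt: "\<And>n. (L2norm M (\<psi> - r n))\<^sup>2 < D + (1 / 4) ^ n / 4"
    by metis
  have rL2: "r n \<in> L2 M" for n
    using r R by blast
  have pow: "(1 / 4 :: real) ^ n = ((1 / 2) ^ n)\<^sup>2" for n
    unfolding power2_eq_square power_mult_distrib[symmetric] by simp
  have cauchy: "L2norm M (r m - r n) \<le> (1 / 2) ^ n" if "n \<le> m" for m n
  proof (rule power2_le_imp_le)
    define a b where "a = \<psi> - r m" and "b = \<psi> - r n"
    have ab: "a \<in> L2 M" "b \<in> L2 M"
      using \<psi> rL2 by (auto simp: a_def b_def)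
    have "cscale (1 / 2) (r m + r n) \<in> R"
      using R r cfun.subspace_add cfun.subspace_scale by blast
    from D_le[OF this] have "4 * D \<le> 4 * (L2norm M (\<psi> - cscale (1 / 2) (r m + r n)))\<^sup>2"
      by simp
    also have "a + b = cscale 2 (\<psi> - cscale (1 / 2) (r m + r n))"
      by (auto simp: a_def b_def cscale_def algebra_simps)
    then have "4 * (L2norm M (\<psi> - cscale (1 / 2) (r m + r n)))\<^sup>2 = (L2norm M (a + b))\<^sup>2"
      by (simp add: L2norm_cscale power_mult_distrib)
    finally have low: "4 * D \<le> (L2norm M (a + b))\<^sup>2" .
    have "b - a = r m - r n"
      by (simp add: a_def b_def)
    then have parallelogram: "(L2norm M (r m - r n))\<^sup>2 + (L2norm M (a + b))\<^sup>2
        = 2 * (L2norm M a)\<^sup>2 + 2 * (L2norm M b)\<^sup>2"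
      using L2norm_square_add[OF ab] L2norm_square_diff[OF ab] L2norm_minus_commute[of M a b] by simp
    have up: "(L2norm M a)\<^sup>2 < D + (1 / 4) ^ m / 4" "(L2norm M b)\<^sup>2 < D + (1 / 4) ^ n / 4"
      using r_lt by (simp_all add: a_def b_def)
    have "(1 / 4 :: real) ^ m \<le> (1 / 4) ^ n"
      using that by (intro power_decreasing) auto
    with low parallelogram up have "(L2norm M (r m - r n))\<^sup>2 \<le> (1 / 4) ^ n"
      by linarith
    then show "(L2norm M (r m - r n))\<^sup>2 \<le> ((1 / 2) ^ n)\<^sup>2"
      by (simp only: pow)
  qed simp
  obtain p where p: "p \<in> L2 M" and p_r: "\<And>n. L2norm M (p - r n) \<le> (1 / 2) ^ n"
    using L2_complete[of r, OF rL2 cauchy] by auto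
  have half: "(\<lambda>n. (1 / 2 :: real) ^ n) \<longlonglongrightarrow> 0"
    by (intro LIMSEQ_realpow_zero) auto
  have p_cl: "p \<in> L2_closure M R"
    unfolding L2_closure_iff
  proof (intro conjI p allI impI)
    fix e :: real assume "e > 0"
    then have "\<forall>\<^sub>F n in sequentially. (1 / 2 :: real) ^ n < e"
      using half order_tendstoD(2) by blast
    then obtain n where "(1 / 2 :: real) ^ n < e"
      by (meson eventually_happens' sequentially_bot)
    then show "\<exists>\<eta>\<in>R. L2norm M (p - \<eta>) < e"
      using p_r[of n] r[of n] by (intro bexI[of _ "r n"]) auto
  qed
  have "L2inner M (\<psi> - p) \<eta> = 0" if \<eta>: "\<eta> \<in> R" for \<eta>
  proof -
    have \<eta>L2: "\<eta> \<in> L2 M"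
      using \<eta> R by blast
    have near: "norm (L2inner M (\<psi> - r n) \<eta>) \<le> (1 / 2) ^ n * L2norm M \<eta>" for n
    proof (cases "L2norm M \<eta> = 0")
      case True
      then show ?thesis
        using L2_Cauchy_Schwarz[OF L2_diff[OF \<psi> rL2] \<eta>L2, of n] by simp
    next
      case False
      define t where "t = L2inner M (\<psi> - r n) \<eta> / (L2norm M \<eta>)\<^sup>2"
      have "r n + cscale t \<eta> \<in> R"
        using R r \<eta> cfun.subspace_add cfun.subspace_scale by blast
      from D_le[OF this] have "D \<le> (L2norm M (\<psi> - r n - cscale t \<eta>))\<^sup>2"
        by (simp add: diff_diff_eq)
      also have "\<dots> = (L2norm M (\<psi> - r n))\<^sup>2 - (norm (L2inner M (\<psi> - r n) \<eta>))\<^sup>2 / (L2norm M \<eta>)\<^sup>2"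
        unfolding t_def using False by (intro L2norm_square_remove_component L2_diff \<psi> rL2 \<eta>L2)
      finally have "(norm (L2inner M (\<psi> - r n) \<eta>))\<^sup>2 / (L2norm M \<eta>)\<^sup>2 \<le> ((1 / 2) ^ n)\<^sup>2"
        using r_lt[of n] pow[of n] zero_le_power2[of "(1 / 2 :: real) ^ n"] by linarith
      then have "(norm (L2inner M (\<psi> - r n) \<eta>))\<^sup>2 \<le> ((1 / 2) ^ n * L2norm M \<eta>)\<^sup>2"
        using False by (simp add: field_simps power_mult_distrib)
      then show ?thesis
        by (rule power2_le_imp_le) simp
    qed
    have "norm (L2inner M (\<psi> - p) \<eta>) \<le> (1 / 2) ^ n * (2 * L2norm M \<eta>)" for n
    proof -
      have "L2inner M (\<psi> - p) \<eta> = L2inner M (\<psi> - r n) \<eta> - L2inner M (p - r n) \<eta>"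
        using \<psi> p rL2 \<eta>L2 by (simp add: L2inner_diff_left)
      then have "norm (L2inner M (\<psi> - p) \<eta>)
          \<le> norm (L2inner M (\<psi> - r n) \<eta>) + norm (L2inner M (p - r n) \<eta>)"
        by (simp only: norm_triangle_ineq4)
      moreover have "norm (L2inner M (p - r n) \<eta>) \<le> (1 / 2) ^ n * L2norm M \<eta>"
        using L2_Cauchy_Schwarz[OF L2_diff[OF p rL2] \<eta>L2, of n] p_r[of n]
        by (meson L2norm_nonneg mult_right_mono order_trans)
      ultimately show ?thesis
        using near[of n] by linarith
    qed
    moreover have "(\<lambda>n. (1 / 2) ^ n * (2 * L2norm M \<eta>)) \<longlonglongrightarrow> 0"
      using tendsto_mult_right[OF half, of "2 * L2norm M \<eta>"] by simp
    ultimately have "norm (L2inner M (\<psi> - p) \<eta>) \<le> 0"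
      by (intro LIMSEQ_le_const) auto
    then show ?thesis by simp
  qed
  then have "\<psi> - p \<in> L2_orthogonal M R"
    using \<psi> p by (simp add: L2_orthogonal_iff)
  then show ?thesis
    using p_cl L2_orthogonal_closure[OF R(2)] by blast
qed

lemma (in prob_space)
  assumes W: "cfun.subspace W" "W \<subseteq> L2 M" "L2_closure M W \<subseteq> W" and \<psi>: "\<psi> \<in> L2 M"
  shows L2_proj_in: "L2_proj M W \<psi> \<in> W"
    and L2_proj_orthogonal: "\<psi> - L2_proj M W \<psi> \<in> L2_orthogonal M W"
proof -
  have "\<exists>p. p \<in> W \<and> \<psi> - p \<in> L2_orthogonal M W"
    using L2_projection_exists[OF W(1,2) \<psi>] W(3) subset_L2_closure[OF W(2)]
    unfolding L2_orthogonal_iff by blast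
  then have "L2_proj M W \<psi> \<in> W \<and> (\<lambda>x. \<psi> x - L2_proj M W \<psi> x) \<in> L2_orthogonal M W"
    unfolding L2_proj_def fun_diff_def by (rule someI_ex)
  then show "L2_proj M W \<psi> \<in> W" "\<psi> - L2_proj M W \<psi> \<in> L2_orthogonal M W"
    by (auto simp: fun_diff_def)
qed

section \<open>Twisted ergodic averages\<close>

lemma
  fixes f :: "'a \<Rightarrow> 'a" and \<psi> \<eta> :: "'a \<Rightarrow> complex"
  shows koopman_pow_add [simp]: "(koopman f ^^ n) (\<psi> + \<eta>) = (koopman f ^^ n) \<psi> + (koopman f ^^ n) \<eta>"
    and koopman_pow_diff [simp]: "(koopman f ^^ n) (\<psi> - \<eta>) = (koopman f ^^ n) \<psi> - (koopman f ^^ n) \<eta>"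
    and koopman_pow_cscale [simp]: "(koopman f ^^ n) (cscale c \<psi>) = cscale c ((koopman f ^^ n) \<psi>)"
  by (auto simp: koopman_funpow cscale_def)

locale measure_preserving = prob_space M for M :: "'a measure" +
  fixes f :: "'a \<Rightarrow> 'a"
  assumes measurable_f [measurable]: "f \<in> measurable M M"
    and distr_f: "distr M M f = M"
begin

lemma AE_comp:
  assumes "AE x in M. P x"
  shows "AE x in M. P (f x)"
proof (rule AE_distrD[OF measurable_f])
  show "AE x in distr M M f. P x"
    using assms by (simp only: distr_f)
qed

lemma integral_comp:
  fixes h :: "'a \<Rightarrow> 'v::{banach, second_countable_topology}"
  assumes "h \<in> borel_measurable M"
  shows "(\<integral>x. h (f x) \<partial>M) = (\<integral>x. h x \<partial>M)"
  using integral_distr[OF measurable_f assms] by (simp only: distr_f)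

lemma koopman_L2:
  assumes "\<psi> \<in> L2 M"
  shows "koopman f \<psi> \<in> L2 M"
proof -
  have "integrable (distr M M f) (\<lambda>x. (norm (\<psi> x))\<^sup>2)"
    using L2_integrable_square[OF assms] by (simp only: distr_f)
  then have "integrable M (\<lambda>x. (norm (\<psi> (f x)))\<^sup>2)"
    by (rule integrable_distr[OF measurable_f])
  moreover have "(\<lambda>x. \<psi> (f x)) \<in> borel_measurable M"
    by (intro measurable_compose[OF measurable_f L2_measurable[OF assms]])
  ultimately show ?thesis
    unfolding koopman_def comp_def by (intro L2I)
qed

lemma koopman_pow_L2 [simp, intro]: "\<psi> \<in> L2 M \<Longrightarrow> (koopman f ^^ n) \<psi> \<in> L2 M"
  by (induction n) (auto simp: koopman_L2)

lemma L2inner_koopman: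
  assumes [measurable]: "\<psi> \<in> L2 M" "\<eta> \<in> L2 M"
  shows "L2inner M (koopman f \<psi>) (koopman f \<eta>) = L2inner M \<psi> \<eta>"
  unfolding L2inner_def koopman_def comp_def by (intro integral_comp) measurable

lemma L2inner_koopman_pow:
  "\<psi> \<in> L2 M \<Longrightarrow> \<eta> \<in> L2 M \<Longrightarrow>
    L2inner M ((koopman f ^^ (m + n)) \<psi>) ((koopman f ^^ m) \<eta>) = L2inner M ((koopman f ^^ n) \<psi>) \<eta>"
  by (induction m) (auto simp: L2inner_koopman)

lemma L2norm_koopman_pow [simp]:
  assumes "\<psi> \<in> L2 M"
  shows "L2norm M ((koopman f ^^ n) \<psi>) = L2norm M \<psi>"
proof -
  have "(L2norm M ((koopman f ^^ n) \<psi>))\<^sup>2 = (L2norm M \<psi>)\<^sup>2"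
    using L2inner_koopman_pow[OF assms assms, of n 0] by (simp add: L2inner_self del: of_real_power)
  then show ?thesis
    by (simp add: power2_eq_iff_nonneg)
qed

definition twisted_sum :: "complex \<Rightarrow> nat \<Rightarrow> ('a \<Rightarrow> complex) \<Rightarrow> 'a \<Rightarrow> complex" where
  "twisted_sum z N \<psi> = (\<Sum>n<N. cscale (z ^ n) ((koopman f ^^ n) \<psi>))"

lemma twisted_sum_L2 [simp, intro]: "\<psi> \<in> L2 M \<Longrightarrow> twisted_sum z N \<psi> \<in> L2 M"
  unfolding twisted_sum_def by (intro L2_sum L2_cscale koopman_pow_L2)

lemma twisted_sum_add: "twisted_sum z N (\<psi> + \<eta>) = twisted_sum z N \<psi> + twisted_sum z N \<eta>"
  unfolding twisted_sum_def koopman_pow_add cfun.scale_right_distrib sum.distrib ..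

lemma norm_twisted_sum_le:
  assumes "\<psi> \<in> L2 M" "norm z = 1"
  shows "L2norm M (twisted_sum z N \<psi>) \<le> real N * L2norm M \<psi>"
proof -
  have "L2norm M (twisted_sum z N \<psi>) \<le> (\<Sum>n<N. L2norm M (cscale (z ^ n) ((koopman f ^^ n) \<psi>)))"
    unfolding twisted_sum_def using assms by (intro L2norm_sum_le L2_cscale koopman_pow_L2)
  also have "\<dots> = real N * L2norm M \<psi>"
    using assms by (simp add: L2norm_cscale norm_power)
  finally show ?thesis .
qed

lemma twisted_sum_coboundary:
  "twisted_sum z N (cscale z (koopman f \<eta>) - \<eta>) = cscale (z ^ N) ((koopman f ^^ N) \<eta>) - \<eta>"
proof -
  have "(koopman f ^^ n) (koopman f \<eta>) = (koopman f ^^ Suc n) \<eta>" for n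
    by (simp add: funpow_swap1)
  then have "cscale (z ^ n) ((koopman f ^^ n) (cscale z (koopman f \<eta>) - \<eta>))
      = cscale (z ^ Suc n) ((koopman f ^^ Suc n) \<eta>) - cscale (z ^ n) ((koopman f ^^ n) \<eta>)" for n
    unfolding koopman_pow_diff koopman_pow_cscale
    by (simp add: cscale_def fun_eq_iff algebra_simps)
  then have "twisted_sum z N (cscale z (koopman f \<eta>) - \<eta>)
      = (\<Sum>n<N. cscale (z ^ Suc n) ((koopman f ^^ Suc n) \<eta>) - cscale (z ^ n) ((koopman f ^^ n) \<eta>))"
    unfolding twisted_sum_def by (intro sum.cong refl)
  also have "\<dots> = cscale (z ^ N) ((koopman f ^^ N) \<eta>) - cscale (z ^ 0) ((koopman f ^^ 0) \<eta>)"
    by (rule sum_lessThan_telescope[where f = "\<lambda>n. cscale (z ^ n) ((koopman f ^^ n) \<eta>)"])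
  finally show ?thesis
    by (simp add: cscale_def)
qed

lemma twisted_sum_append:
  "twisted_sum z (N + K) \<psi> = twisted_sum z N \<psi> + cscale (z ^ N) ((koopman f ^^ N) (twisted_sum z K \<psi>))"
proof (induction K)
  case 0
  then show ?case
    by (simp add: twisted_sum_def cscale_def koopman_funpow fun_eq_iff)
next
  case (Suc K)
  have step: "twisted_sum z (Suc k) \<psi> = twisted_sum z k \<psi> + cscale (z ^ k) ((koopman f ^^ k) \<psi>)" for k
    by (simp only: twisted_sum_def sum.lessThan_Suc)
  have "(koopman f ^^ N) ((koopman f ^^ K) \<psi>) = (koopman f ^^ (N + K)) \<psi>"
    by (simp only: funpow_add comp_def)
  then show ?case
    unfolding add_Suc_right step Suc.IH koopman_pow_add koopman_pow_cscale cfun.scale_right_distrib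
    by (simp only: cfun.scale_scale power_add add.assoc)
qed

lemma norm_twisted_sum_double:
  assumes "\<psi> \<in> L2 M" "norm z = 1"
  shows "L2norm M (twisted_sum z (2 * N) \<psi>) \<le> 2 * L2norm M (twisted_sum z N \<psi>)"
proof -
  have "L2norm M (twisted_sum z (N + N) \<psi>) \<le> L2norm M (twisted_sum z N \<psi>)
      + L2norm M (cscale (z ^ N) ((koopman f ^^ N) (twisted_sum z N \<psi>)))"
    unfolding twisted_sum_append using assms
    by (intro L2norm_triangle L2_cscale koopman_pow_L2 twisted_sum_L2)
  also have "\<dots> = 2 * L2norm M (twisted_sum z N \<psi>)"
    using assms by (simp add: L2norm_cscale norm_power)
  finally show ?thesis
    unfolding mult_2[of N] .
qed

text \<open>The mean ergodic theorem for the isometry \<open>\<psi> \<mapsto> z * U \<psi>\<close>.  A function orthogonal to all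
  coboundaries \<open>z * U \<eta> - \<eta>\<close> is fixed by this isometry, hence an eigenfunction of \<open>U\<close>.  A function
  orthogonal to all eigenfunctions is therefore a limit of coboundaries, whose sums telescope.\<close>

lemma mean_ergodic:
  assumes c: "c \<in> L2 M" and orth: "\<And>\<psi>. \<psi> \<in> koopman_eigenfunctions M f \<Longrightarrow> L2inner M c \<psi> = 0"
    and z: "norm z = 1"
  shows "(\<lambda>N. L2norm M (twisted_sum z N c) / real N) \<longlonglongrightarrow> 0"
proof -
  define V where "V \<eta> = cscale z (koopman f \<eta>)" for \<eta>
  have V_L2: "V \<eta> \<in> L2 M" if "\<eta> \<in> L2 M" for \<eta>
    using that by (simp add: V_def koopman_L2)
  define R where "R = (\<lambda>\<eta>. V \<eta> - \<eta>) ` L2 M"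
  have R_L2: "R \<subseteq> L2 M"
    unfolding R_def using V_L2 by blast
  have R_sub: "cfun.subspace R"
    unfolding cfun.subspace_def
  proof (intro conjI ballI allI)
    have "0 = V 0 - 0"
      by (simp add: V_def cscale_def koopman_def fun_eq_iff)
    then show "0 \<in> R"
      unfolding R_def by blast
  next
    fix x y assume "x \<in> R" "y \<in> R"
    then obtain a b where ab: "a \<in> L2 M" "b \<in> L2 M" "x = V a - a" "y = V b - b"
      unfolding R_def by blast
    then have "x + y = V (a + b) - (a + b)"
      by (simp add: V_def cscale_def koopman_def fun_eq_iff algebra_simps)
    then show "x + y \<in> R"
      unfolding R_def using ab L2_add by blast
  next
    fix k x assume "x \<in> R"
    then obtain a where a: "a \<in> L2 M" "x = V a - a"
      unfolding R_def by blast
    have "cscale k x = V (cscale k a) - cscale k a"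
      unfolding a(2) by (simp add: V_def cscale_def koopman_def fun_eq_iff algebra_simps)
    then show "cscale k x \<in> R"
      unfolding R_def using a L2_cscale by blast
  qed
  obtain p where p: "p \<in> L2_closure M R" and cp: "c - p \<in> L2_orthogonal M (L2_closure M R)"
    using L2_projection_exists[OF R_sub R_L2 c] by blast
  define q where "q = c - p"
  have p_L2: "p \<in> L2 M"
    using p by (simp add: L2_closure_iff)
  have q: "q \<in> L2 M" and q_orth: "\<And>\<eta>. \<eta> \<in> L2_closure M R \<Longrightarrow> L2inner M q \<eta> = 0"
    using cp by (auto simp: L2_orthogonal_iff q_def)
  have "V q - q \<in> L2_closure M R"
    using subset_L2_closure[OF R_L2] q by (auto simp: R_def)
  then have "L2inner M q (V q) = L2inner M q q"
    using q_orth[of "V q - q"] q V_L2[OF q] by (simp add: L2inner_diff_right)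
  moreover have "L2norm M (V q) = L2norm M q"
    using L2norm_koopman_pow[OF q, of 1] z by (simp add: V_def L2norm_cscale)
  ultimately have "(L2norm M (q - V q))\<^sup>2 = 0"
    using L2norm_square_diff[OF q V_L2[OF q]] by (simp add: L2inner_self del: of_real_power)
  then have "L2norm M (q - V q) = 0"
    by simp
  then have "AE x in M. (q - V q) x = 0"
    using L2norm_eq_0_iff[OF L2_diff[OF q V_L2[OF q]]] by simp
  then have eigen: "AE x in M. koopman f q x = inverse z * q x"
  proof eventually_elim
    case (elim x)
    then have "inverse z * q x = (inverse z * z) * koopman f q x"
      by (simp add: V_def cscale_def mult.assoc)
    moreover have "inverse z * z = 1"
      using z by (intro left_inverse) auto
    ultimately show ?case by simp
  qed
  have "L2norm M q = 0"
  proof (cases "AE x in M. q x = 0")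
    case True
    then show ?thesis
      using L2norm_eq_0_iff[OF q] by simp
  next
    case False
    then have "q \<in> koopman_eigenfunctions M f"
      using q eigen by (auto simp: koopman_eigenfunctions_def)
    then have "L2inner M c q = 0"
      by (rule orth)
    moreover have "L2inner M p q = 0"
      using q_orth[OF p] L2inner_commute[of M p q] by simp
    ultimately have "L2inner M q q = 0"
      using L2inner_diff_left[OF c p_L2 q] by (simp add: q_def)
    then show ?thesis
      by (simp add: L2inner_self)
  qed
  then have cp0: "L2norm M (c - p) = 0"
    by (simp only: q_def)
  show ?thesis
  proof (rule LIMSEQ_I)
    fix e :: real assume e: "e > 0"
    then obtain \<eta> where \<eta>: "\<eta> \<in> L2 M" and close: "L2norm M (p - (V \<eta> - \<eta>)) < e / 2"
      using p unfolding L2_closure_iff R_def by (metis (no_types, lifting) half_gt_zero imageE)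
    define r where "r = c - (V \<eta> - \<eta>)"
    have r: "r \<in> L2 M"
      using c \<eta> V_L2 by (simp add: r_def)
    have r_small: "L2norm M r < e / 2"
      using L2norm_triangle_diff[OF c _ p_L2, of "V \<eta> - \<eta>"] cp0 close \<eta> V_L2 by (simp add: r_def)
    have bound: "L2norm M (twisted_sum z N c) \<le> 2 * L2norm M \<eta> + real N * L2norm M r" for N
    proof -
      have "c = (V \<eta> - \<eta>) + r"
        by (simp add: r_def)
      then have "twisted_sum z N c = twisted_sum z N (V \<eta> - \<eta>) + twisted_sum z N r"
        using twisted_sum_add by metis
      also have "twisted_sum z N (V \<eta> - \<eta>) = cscale (z ^ N) ((koopman f ^^ N) \<eta>) - \<eta>"
        unfolding V_def by (rule twisted_sum_coboundary)
      finally have "L2norm M (twisted_sum z N c)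
          \<le> L2norm M (cscale (z ^ N) ((koopman f ^^ N) \<eta>) - \<eta>) + L2norm M (twisted_sum z N r)"
        using L2norm_triangle[of "cscale (z ^ N) ((koopman f ^^ N) \<eta>) - \<eta>" M "twisted_sum z N r"] \<eta> r
        by (metis L2_diff L2_cscale koopman_pow_L2 twisted_sum_L2)
      moreover have "L2norm M (cscale (z ^ N) ((koopman f ^^ N) \<eta>) - \<eta>)
          \<le> L2norm M (cscale (z ^ N) ((koopman f ^^ N) \<eta>) - 0) + L2norm M (0 - \<eta>)"
        using \<eta> by (intro L2norm_triangle_diff L2_cscale koopman_pow_L2 L2_zero)
      moreover have "L2norm M (cscale (z ^ N) ((koopman f ^^ N) \<eta>) - 0) = L2norm M \<eta>"
        using \<eta> z by (simp add: L2norm_cscale norm_power)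
      moreover have "L2norm M (0 - \<eta>) = L2norm M \<eta>"
        using L2norm_minus_commute[of M 0 \<eta>] by simp
      moreover have "L2norm M (twisted_sum z N r) \<le> real N * L2norm M r"
        by (rule norm_twisted_sum_le[OF r z])
      ultimately show ?thesis by linarith
    qed
    obtain N0 :: nat where N0: "real N0 > 4 * L2norm M \<eta> / e"
      using reals_Archimedean2 by blast
    have "norm (L2norm M (twisted_sum z N c) / real N - 0) < e" if "N \<ge> Suc N0" for N
    proof -
      have N: "real N > 0" "real N > 4 * L2norm M \<eta> / e"
        using that N0 by auto
      have "4 * L2norm M \<eta> < e * real N"
        using N(2) e by (simp add: divide_less_eq mult.commute)
      moreover have "real N * L2norm M r < real N * (e / 2)"
        using r_small N(1) by (intro mult_strict_left_mono)
      ultimately have "L2norm M (twisted_sum z N c) < e * real N"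
        using bound[of N] by (simp add: field_simps)
      then show ?thesis
        using N(1) by (simp add: divide_less_eq)
    qed
    then show "\<exists>N0. \<forall>N\<ge>N0. norm (L2norm M (twisted_sum z N c) / real N - 0) < e"
      by blast
  qed
qed

lemma norm_square_twisted_sum:
  assumes "c \<in> L2 M"
  shows "complex_of_real ((L2norm M (twisted_sum z N c))\<^sup>2)
    = (\<Sum>n<N. \<Sum>m<N. z ^ n * cnj z ^ m * L2inner M ((koopman f ^^ n) c) ((koopman f ^^ m) c))"
proof -
  have "L2inner M (twisted_sum z N c) (twisted_sum z N c)
      = (\<Sum>n<N. L2inner M (cscale (z ^ n) ((koopman f ^^ n) c)) (twisted_sum z N c))"
    unfolding twisted_sum_def[of z N c] using assms
    by (intro L2inner_sum_left L2_sum L2_cscale koopman_pow_L2)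
  also have "\<dots> = (\<Sum>n<N. \<Sum>m<N.
      L2inner M (cscale (z ^ n) ((koopman f ^^ n) c)) (cscale (z ^ m) ((koopman f ^^ m) c)))"
    unfolding twisted_sum_def using assms
    by (intro sum.cong refl L2inner_sum_right L2_cscale koopman_pow_L2)
  finally show ?thesis
    unfolding L2inner_self by (simp add: L2inner_cscale_left L2inner_cscale_right mult.assoc mult.left_commute)
qed

text \<open>Along dyadic lengths the norms of the averages decrease, so Dini's argument on the unit circle
  makes their convergence uniform in the twist \<open>z\<close>.\<close>

lemma uniform_mean_ergodic:
  assumes c: "c \<in> L2 M" and orth: "\<And>\<psi>. \<psi> \<in> koopman_eigenfunctions M f \<Longrightarrow> L2inner M c \<psi> = 0"
    and e: "e > 0"
  shows "\<exists>J. \<forall>j\<ge>J. \<forall>z. norm z = 1 \<longrightarrow> L2norm M (twisted_sum z (2 ^ j) c) \<le> e * 2 ^ j"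
proof (rule ccontr)
  define g where "g j z = L2norm M (twisted_sum z (2 ^ j) c) / 2 ^ j" for j z
  have cont: "continuous_on UNIV (g j)" for j
  proof -
    have "g j z = sqrt (Re (\<Sum>n<2 ^ j. \<Sum>m<2 ^ j.
        z ^ n * cnj z ^ m * L2inner M ((koopman f ^^ n) c) ((koopman f ^^ m) c))) / 2 ^ j" for z
      unfolding norm_square_twisted_sum[OF c, symmetric] Re_complex_of_real
      by (simp add: g_def)
    then have "g j = (\<lambda>z. sqrt (Re (\<Sum>n<2 ^ j. \<Sum>m<2 ^ j.
        z ^ n * cnj z ^ m * L2inner M ((koopman f ^^ n) c) ((koopman f ^^ m) c))) / 2 ^ j)"
      by (rule ext)
    then show ?thesis
      by (simp only:) (intro continuous_intros, auto)
  qed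
  have mono: "g (Suc j) z \<le> g j z" if "norm z = 1" for j z
    using norm_twisted_sum_double[OF c that, of "2 ^ j"] by (simp add: g_def divide_simps)
  have anti: "g j z \<le> g i z" if "i \<le> j" "norm z = 1" for i j z
    using that(1) by (induction rule: dec_induct) (auto intro: order_trans[OF mono[OF that(2)]])
  assume "\<not> ?thesis"
  then have "\<forall>J. \<exists>j\<ge>J. \<exists>z. norm z = 1 \<and> e < g j z"
    by (simp add: g_def not_le pos_less_divide_eq)
  then have "\<forall>J. \<exists>z. norm z = 1 \<and> e < g J z"
    using anti by (meson less_le_trans)
  then obtain z where z: "\<And>J. norm (z J) = 1" "\<And>J. e < g J (z J)"
    by metis
  have "seq_compact (sphere (0 :: complex) 1)"
    using compact_sphere compact_imp_seq_compact by blast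
  then obtain l r where l: "l \<in> sphere 0 1" and r: "strict_mono r" and lim: "(z \<circ> r) \<longlonglongrightarrow> l"
    using z(1) by (elim seq_compactE[of _ z]) auto
  have "e \<le> g j l" for j
  proof (rule LIMSEQ_le_const)
    have "isCont (g j) l"
      using cont[of j] by (simp add: continuous_on_eq_continuous_at)
    then show "(\<lambda>k. g j ((z \<circ> r) k)) \<longlonglongrightarrow> g j l"
      using lim by (rule isCont_tendsto_compose)
    show "\<exists>K. \<forall>k\<ge>K. e \<le> g j ((z \<circ> r) k)"
    proof (intro exI allI impI)
      fix k assume "k \<ge> j"
      then have "j \<le> r k"
        using seq_suble[OF r, of k] by simp
      then show "e \<le> g j ((z \<circ> r) k)"
        using anti[of j "r k" "z (r k)"] z[of "r k"] by simp
    qed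
  qed
  moreover have "(\<lambda>j. g j l) \<longlonglongrightarrow> 0"
  proof -
    have "norm l = 1"
      using l by simp
    from mean_ergodic[OF c orth this]
    have "(\<lambda>j. L2norm M (twisted_sum l (2 ^ j) c) / real (2 ^ j)) \<longlonglongrightarrow> 0"
      by (rule filterlim_compose) (auto intro!: filterlim_subseq strict_monoI)
    then show ?thesis
      by (simp add: g_def)
  qed
  ultimately have "e \<le> 0"
    by (intro LIMSEQ_le_const[of _ 0]) auto
  with e show False by simp
qed

end

section \<open>Correlations vanish in mean square\<close>

lemma sum_root_of_unity_powers:
  fixes P n m :: nat
  assumes "n < P" "m < P"
  shows "(\<Sum>j<P. cis (2 * pi * real j / real P) ^ n * cnj (cis (2 * pi * real j / real P)) ^ m)
    = (if n = m then of_nat P else 0)"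
proof -
  define \<theta> where "\<theta> = 2 * pi * ((real n - real m) / real P)"
  have P: "real P > 0"
    using assms by simp
  have term_eq: "cis (2 * pi * real j / real P) ^ n * cnj (cis (2 * pi * real j / real P)) ^ m = cis \<theta> ^ j"
    for j
    unfolding cis_cnj Complex.DeMoivre cis_mult \<theta>_def using P by (intro arg_cong[where f = cis]) (simp add: field_simps)
  have "(\<Sum>j<P. cis \<theta> ^ j) = 0" if "n \<noteq> m"
  proof -
    have "cis \<theta> \<noteq> 1"
    proof
      assume "cis \<theta> = 1"
      then have "cos \<theta> = 1"
        by (metis cis.sel(1) one_complex.sel(1))
      then obtain k :: int where "\<theta> = real_of_int k * 2 * pi"
        using cos_one_2pi_int by blast
      then have "2 * pi * ((real n - real m) / real P) = 2 * pi * real_of_int k"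
        unfolding \<theta>_def by (simp only: mult_ac)
      then have "(real n - real m) / real P = real_of_int k"
        by (subst (asm) mult_left_cancel) auto
      then have k: "real n - real m = real_of_int k * real P"
        using P by (simp add: field_simps)
      then have "int n - int m = k * int P"
        by (metis (mono_tags, lifting) of_int_diff of_int_eq_iff of_int_mult of_int_of_nat_eq)
      moreover have "\<bar>int n - int m\<bar> < int P"
        using assms by linarith
      ultimately have "\<bar>k\<bar> * int P < 1 * int P"
        by (simp add: abs_mult)
      then have "k = 0"
        by (subst (asm) mult_less_cancel_right) auto
      with \<open>int n - int m = k * int P\<close> that show False
        by simp
    qed
    moreover have "cis \<theta> ^ P = 1"
    proof -
      have "cis \<theta> ^ P = cis (2 * pi * real_of_int (int n - int m))"
        using P by (simp add: Complex.DeMoivre \<theta>_def mult.commute)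
      also have "\<dots> = 1"
        by (rule cis_multiple_2pi) simp
      finally show ?thesis .
    qed
    ultimately show ?thesis
      by (simp add: geometric_sum)
  qed
  moreover have "(\<Sum>j<P. cis \<theta> ^ j) = of_nat P" if "n = m"
    using that by (simp add: \<theta>_def)
  ultimately show ?thesis
    unfolding term_eq by simp
qed

context measure_preserving
begin

text \<open>This is Wiener's lemma in quantitative form.  With \<open>H z\<close> the squared norm of the twisted sum,
  the autocorrelations \<open>a k\<close> are the Fourier coefficients of \<open>H \<ge> 0\<close> up to the weights \<open>N - k\<close>.
  Testing \<open>H\<close> against \<open>\<Sum>k<K. cnj (a k) * cnj z ^ k\<close> and using
  \<open>\<Sum>H * \<bar>r\<bar> \<le> sqrt (\<Sum>H) * sqrt (\<Sum>H * \<bar>r\<bar>\<^sup>2)\<close> exploits the positivity of \<open>H\<close>, which gains the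
  factor \<open>1 / N\<close>.  Averages over the circle are replaced by averages over \<open>2 * N\<close>-th roots of unity,
  which are exact for the degrees that occur.\<close>

lemma autocorrelation_square_sum_le:
  assumes c: "c \<in> L2 M" and KN: "2 * K \<le> N" "0 < N"
    and B: "\<And>z. norm z = 1 \<Longrightarrow> (L2norm M (twisted_sum z N c))\<^sup>2 \<le> B"
  shows "real N * (\<Sum>k<K. (norm (L2inner M ((koopman f ^^ k) c) c))\<^sup>2) \<le> 4 * (L2norm M c)\<^sup>2 * B"
proof -
  define a where "a k = L2inner M ((koopman f ^^ k) c) c" for k
  define G where "G n m = L2inner M ((koopman f ^^ n) c) ((koopman f ^^ m) c)" for n m
  define P where "P = 2 * N"
  define \<zeta> where "\<zeta> j = cis (2 * pi * real j / real P)" for j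
  define H where "H j = (L2norm M (twisted_sum (\<zeta> j) N c))\<^sup>2" for j
  define r where "r j = (\<Sum>k<K. cnj (a k) * cnj (\<zeta> j) ^ k)" for j
  define X where "X = (\<Sum>k<K. (norm (a k))\<^sup>2)"
  have roots: "(\<Sum>j<P. \<zeta> j ^ n * cnj (\<zeta> j) ^ m) = (if n = m then of_nat P else 0)"
    if "n < P" "m < P" for n m
    unfolding \<zeta>_def by (rule sum_root_of_unity_powers[OF that])
  have H_eq: "complex_of_real (H j) = (\<Sum>n<N. \<Sum>m<N. \<zeta> j ^ n * cnj (\<zeta> j) ^ m * G n m)" for j
    unfolding H_def G_def by (rule norm_square_twisted_sum[OF c])
  have H_nonneg: "0 \<le> H j" for j
    by (simp add: H_def)
  have H_le: "H j \<le> B" for j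
    unfolding H_def by (rule B) (simp add: \<zeta>_def)
  have G_shift: "G (m + k) m = a k" for m k
    unfolding G_def a_def by (rule L2inner_koopman_pow[OF c c])
  have X_nonneg: "0 \<le> X"
    unfolding X_def by (intro sum_nonneg) auto
  have coeff: "(\<Sum>j<P. cnj (\<zeta> j) ^ k * complex_of_real (H j)) = of_nat P * (of_nat (N - k) * a k)"
    if "k < N" for k
  proof -
    have "(\<Sum>j<P. cnj (\<zeta> j) ^ k * complex_of_real (H j))
        = (\<Sum>j<P. \<Sum>n<N. \<Sum>m<N. \<zeta> j ^ n * cnj (\<zeta> j) ^ (m + k) * G n m)"
      unfolding H_eq by (simp add: sum_distrib_left power_add mult_ac)
    also have "\<dots> = (\<Sum>n<N. \<Sum>m<N. \<Sum>j<P. \<zeta> j ^ n * cnj (\<zeta> j) ^ (m + k) * G n m)"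
      by (subst sum.swap, rule sum.cong[OF refl], rule sum.swap)
    also have "\<dots> = (\<Sum>n<N. \<Sum>m<N. (if n = m + k then of_nat P else 0) * G n m)"
      using that unfolding sum_distrib_right[symmetric]
      by (intro sum.cong refl arg_cong2[where f = "(*)"] roots) (auto simp: P_def)
    also have "\<dots> = (\<Sum>m<N. \<Sum>n<N. if n = m + k then of_nat P * G n m else 0)"
      by (subst sum.swap) (intro sum.cong refl, auto)
    also have "\<dots> = (\<Sum>m<N. if m + k < N then of_nat P * a k else 0)"
      by (intro sum.cong refl) (simp add: sum.delta G_shift)
    also have "\<dots> = (\<Sum>m<N - k. of_nat P * a k)"
      by (intro sum.mono_neutral_cong_right) auto
    finally show ?thesis
      by (simp add: mult_ac)
  qed
  have sum_H: "(\<Sum>j<P. H j) = real P * (real N * (L2norm M c)\<^sup>2)"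
  proof -
    have "complex_of_real (\<Sum>j<P. H j) = of_nat P * (of_nat N * a 0)"
      using coeff[OF KN(2)] by simp
    also have "\<dots> = complex_of_real (real P * (real N * (L2norm M c)\<^sup>2))"
      by (simp add: a_def L2inner_self)
    finally show ?thesis
      by (simp only: of_real_eq_iff)
  qed
  have sum_r: "(\<Sum>j<P. (norm (r j))\<^sup>2) = real P * X"
  proof -
    have "complex_of_real (\<Sum>j<P. (norm (r j))\<^sup>2) = (\<Sum>j<P. r j * cnj (r j))"
      unfolding of_real_sum complex_norm_square ..
    also have "\<dots> = (\<Sum>j<P. \<Sum>k<K. \<Sum>l<K. (cnj (a k) * cnj (\<zeta> j) ^ k) * (a l * \<zeta> j ^ l))"
      unfolding r_def by (simp add: sum_product)
    also have "\<dots> = (\<Sum>j<P. \<Sum>k<K. \<Sum>l<K. cnj (a k) * a l * (\<zeta> j ^ l * cnj (\<zeta> j) ^ k))"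
      by (intro sum.cong refl) (simp only: mult_ac)
    also have "\<dots> = (\<Sum>k<K. \<Sum>l<K. \<Sum>j<P. cnj (a k) * a l * (\<zeta> j ^ l * cnj (\<zeta> j) ^ k))"
      by (subst sum.swap, rule sum.cong[OF refl], rule sum.swap)
    also have "\<dots> = (\<Sum>k<K. \<Sum>l<K. cnj (a k) * a l * (if l = k then of_nat P else 0))"
      using KN unfolding sum_distrib_left[symmetric]
      by (intro sum.cong refl arg_cong2[where f = "(*)"] roots) (auto simp: P_def)
    also have "\<dots> = (\<Sum>k<K. \<Sum>l<K. if l = k then of_nat P * (a k * cnj (a k)) else 0)"
      by (intro sum.cong refl) (simp add: mult_ac)
    also have "\<dots> = (\<Sum>k<K. of_nat P * (a k * cnj (a k)))"
      by (intro sum.cong refl) (simp add: sum.delta)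
    also have "\<dots> = complex_of_real (real P * X)"
      unfolding X_def of_real_mult of_real_sum complex_norm_square sum_distrib_left by simp
    finally show ?thesis
      by (simp only: of_real_eq_iff)
  qed
  have "complex_of_real (real P * (\<Sum>k<K. real (N - k) * (norm (a k))\<^sup>2))
      = (\<Sum>k<K. cnj (a k) * (of_nat P * (of_nat (N - k) * a k)))"
    unfolding of_real_mult of_real_sum complex_norm_square sum_distrib_left
    by (intro sum.cong refl) (simp add: mult_ac)
  also have "\<dots> = (\<Sum>k<K. cnj (a k) * (\<Sum>j<P. cnj (\<zeta> j) ^ k * complex_of_real (H j)))"
    using KN by (intro sum.cong refl arg_cong2[where f = "(*)"] coeff[symmetric]) auto
  also have "\<dots> = (\<Sum>j<P. complex_of_real (H j) * r j)"
    unfolding r_def sum_distrib_left by (subst sum.swap) (simp only: mult_ac)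
  finally have "real P * (\<Sum>k<K. real (N - k) * (norm (a k))\<^sup>2)
      = norm (\<Sum>j<P. complex_of_real (H j) * r j)"
    by (metis (no_types, lifting) abs_of_nonneg mult_nonneg_nonneg norm_of_real of_nat_0_le_iff
        sum_nonneg zero_le_power2)
  also have "\<dots> \<le> (\<Sum>j<P. norm (complex_of_real (H j) * r j))"
    by (rule norm_sum)
  also have "\<dots> = (\<Sum>j<P. sqrt (H j) * (sqrt (H j) * norm (r j)))"
    by (simp add: norm_mult H_nonneg flip: mult.assoc)
  finally have upper: "real P * (\<Sum>k<K. real (N - k) * (norm (a k))\<^sup>2)
      \<le> (\<Sum>j<P. sqrt (H j) * (sqrt (H j) * norm (r j)))" .
  have "real N / 2 * X \<le> (\<Sum>k<K. real (N - k) * (norm (a k))\<^sup>2)"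
    unfolding X_def sum_distrib_left
  proof (intro sum_mono mult_right_mono)
    fix k assume "k \<in> {..<K}"
    then show "real N / 2 \<le> real (N - k)"
      using KN by (simp add: field_simps)
  qed auto
  then have "real P * (real N / 2 * X) \<le> real P * (\<Sum>k<K. real (N - k) * (norm (a k))\<^sup>2)"
    by (intro mult_left_mono) auto
  with upper have "real P * (real N / 2 * X) \<le> (\<Sum>j<P. sqrt (H j) * (sqrt (H j) * norm (r j)))"
    by linarith
  then have "(real P * (real N / 2 * X))\<^sup>2 \<le> (\<Sum>j<P. sqrt (H j) * (sqrt (H j) * norm (r j)))\<^sup>2"
    using X_nonneg by (intro power_mono mult_nonneg_nonneg) auto
  also have "\<dots> \<le> (\<Sum>j<P. (sqrt (H j))\<^sup>2) * (\<Sum>j<P. (sqrt (H j) * norm (r j))\<^sup>2)"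
    by (rule Cauchy_Schwarz_ineq_sum)
  also have "(\<Sum>j<P. (sqrt (H j) * norm (r j))\<^sup>2) = (\<Sum>j<P. H j * (norm (r j))\<^sup>2)"
    by (simp add: power_mult_distrib H_nonneg)
  also have "(\<Sum>j<P. (sqrt (H j))\<^sup>2) = real P * (real N * (L2norm M c)\<^sup>2)"
    by (simp add: H_nonneg flip: sum_H)
  also have "(real P * (real N * (L2norm M c)\<^sup>2)) * (\<Sum>j<P. H j * (norm (r j))\<^sup>2)
      \<le> (real P * (real N * (L2norm M c)\<^sup>2)) * (B * (real P * X))"
  proof (intro mult_left_mono)
    have "(\<Sum>j<P. H j * (norm (r j))\<^sup>2) \<le> (\<Sum>j<P. B * (norm (r j))\<^sup>2)"
      by (intro sum_mono mult_right_mono H_le) auto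
    also have "\<dots> = B * (real P * X)"
      by (simp only: sum_r flip: sum_distrib_left)
    finally show "(\<Sum>j<P. H j * (norm (r j))\<^sup>2) \<le> B * (real P * X)" .
  qed auto
  finally have key: "(real P)\<^sup>2 * real N * X / 4 * (real N * X) \<le> (real P)\<^sup>2 * real N * X / 4 * (4 * (L2norm M c)\<^sup>2 * B)"
    by (simp add: power2_eq_square algebra_simps)
  have pos: "0 < (real P)\<^sup>2 * real N * X / 4" if "X \<noteq> 0"
    using that X_nonneg KN by (simp add: P_def)
  have "0 \<le> B"
    using H_nonneg[of 0] H_le[of 0] by linarith
  then have "real N * X \<le> 4 * (L2norm M c)\<^sup>2 * B"
    using mult_left_le_imp_le[OF key pos] by (cases "X = 0") auto
  then show ?thesis
    by (simp add: X_def a_def)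
qed

text \<open>For \<open>K\<close> elements, the bound is applied at the dyadic length \<open>N\<close> between \<open>2 * K\<close> and \<open>4 * K\<close>.  There
  the squared norm of the twisted sum is uniformly \<open>o(N\<^sup>2)\<close>, so the sum over \<open>K\<close> elements is
  \<open>o(N) = o(K)\<close>.\<close>

lemma autocorrelation_mean_square_tendsto_0:
  assumes c: "c \<in> L2 M" and orth: "\<And>\<psi>. \<psi> \<in> koopman_eigenfunctions M f \<Longrightarrow> L2inner M c \<psi> = 0"
  shows "(\<lambda>K. (\<Sum>k<K. (norm (L2inner M ((koopman f ^^ k) c) c))\<^sup>2) / real K) \<longlonglongrightarrow> 0"
proof (rule LIMSEQ_I)
  fix t :: real assume t: "t > 0"
  define A where "A = (L2norm M c)\<^sup>2"
  define X where "X K = (\<Sum>k<K. (norm (L2inner M ((koopman f ^^ k) c) c))\<^sup>2)" for K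
  have A: "A \<ge> 0"
    by (simp add: A_def)
  define e where "e = sqrt (t / (16 * (A + 1)))"
  have e: "e > 0" and e2: "e\<^sup>2 = t / (16 * (A + 1))"
    using t A by (auto simp: e_def)
  obtain J where J: "\<And>j z. J \<le> j \<Longrightarrow> norm z = 1 \<Longrightarrow> L2norm M (twisted_sum z (2 ^ j) c) \<le> e * 2 ^ j"
    using uniform_mean_ergodic[OF c orth e] by blast
  have "norm (X K / real K - 0) < t" if K: "K \<ge> 2 ^ Suc J" for K
  proof -
    have K0: "K \<ge> 1" "2 * K \<ge> 2"
      using K one_le_power[of "2 :: nat" "Suc J"] by linarith+
    then obtain j where j: "2 ^ j < 2 * K" "2 * K \<le> 2 ^ (j + 1)"
      using ex_power_ivl2[of 2 "2 * K"] by auto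
    have "(2 :: nat) ^ J < 2 ^ (j + 1)"
    proof -
      have "(2 :: nat) ^ J < 2 ^ Suc J"
        by simp
      also have "\<dots> \<le> 2 * K"
        using K by simp
      finally show ?thesis
        using j by linarith
    qed
    then have "J < j + 1"
      by (subst (asm) power_strict_increasing_iff) auto
    define N where "N = (2 :: nat) ^ (j + 1)"
    have N: "2 * K \<le> N" "N \<le> 4 * K" "0 < N"
      using j by (auto simp: N_def)
    have "real N * X K \<le> 4 * A * (e * real N)\<^sup>2"
      unfolding X_def A_def
    proof (rule autocorrelation_square_sum_le[OF c N(1,3)])
      fix z :: complex assume "norm z = 1"
      then have "L2norm M (twisted_sum z N c) \<le> e * real N"
        using J[of "j + 1" z] \<open>J < j + 1\<close> by (simp add: N_def)
      then show "(L2norm M (twisted_sum z N c))\<^sup>2 \<le> (e * real N)\<^sup>2"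
        by (intro power_mono) auto
    qed
    then have "real N * X K \<le> real N * (4 * A * e\<^sup>2 * real N)"
      by (simp add: power2_eq_square algebra_simps)
    then have "X K \<le> 4 * A * e\<^sup>2 * real N"
      using N(3) by (simp add: mult_le_cancel_left_pos)
    also have "\<dots> \<le> 4 * A * e\<^sup>2 * (4 * real K)"
      using N(2) A by (intro mult_left_mono) auto
    also have "\<dots> = t * (A / (A + 1)) * real K"
      using A by (simp add: e2 field_simps)
    also have "\<dots> < t * 1 * real K"
      using t A K0 by (intro mult_strict_right_mono mult_strict_left_mono) auto
    finally have "X K / real K < t"
      using K0 by (simp add: divide_less_eq)
    moreover have "X K \<ge> 0"
      unfolding X_def by (intro sum_nonneg) auto
    ultimately show ?thesis
      by simp
  qed
  then show "\<exists>K0. \<forall>K\<ge>K0. norm ((\<Sum>k<K. (norm (L2inner M ((koopman f ^^ k) c) c))\<^sup>2) / real K - 0) < t"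
    unfolding X_def by blast
qed

end

section \<open>Limits along sets of density one\<close>

lemma at_infinity_along_le: "at_infinity_along S \<le> sequentially"
  by (simp add: at_infinity_along_def)

lemma eventually_at_infinity_along:
  "eventually P (at_infinity_along S) \<longleftrightarrow> (\<forall>\<^sub>F n in sequentially. n \<in> S \<longrightarrow> P n)"
  by (simp add: at_infinity_along_def eventually_inf_principal)

lemma density_one_UNIV: "density_one UNIV"
proof -
  have "\<forall>\<^sub>F N in sequentially. real (card (UNIV \<inter> {..<N})) / real N = 1"
    using eventually_gt_at_top[of 0] by eventually_elim simp
  then show ?thesis
    unfolding density_one_def by (rule tendsto_eventually)
qed

text \<open>The Koopman--von Neumann lemma.  The threshold \<open>sqrt (\<epsilon> (Suc n))\<close>, where \<open>\<epsilon> N\<close> bounds all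
  averages of length at least \<open>N\<close>, is chosen so that Markov's inequality makes the exceptional
  indices below \<open>N\<close> a proportion of at most \<open>sqrt (\<epsilon> N)\<close>.\<close>

lemma Koopman_von_Neumann:
  fixes b :: "nat \<Rightarrow> real"
  assumes b: "\<And>n. 0 \<le> b n" and mean: "(\<lambda>N. (\<Sum>n<N. b n) / real N) \<longlonglongrightarrow> 0"
  shows "\<exists>S. density_one S \<and> (b \<longlongrightarrow> 0) (at_infinity_along S)"
proof -
  define A where "A N = (\<Sum>n<N. b n) / real N" for N
  have A: "A \<longlonglongrightarrow> 0" "\<And>N. 0 \<le> A N"
    using mean b unfolding A_def by (auto intro!: sum_nonneg divide_nonneg_nonneg)
  \<comment> \<open>The summand \<open>inverse (Suc N)\<close> keeps the bound positive, so that it can be cancelled.\<close>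
  define \<epsilon> where "\<epsilon> N = (SUP m\<in>{N..}. A m) + inverse (real (Suc N))" for N
  have bdd: "bdd_above (A ` {N..})" for N
    using convergent_imp_Bseq[of A] A(1)
    by (meson bdd_above_mono Bseq_bdd_above convergentI image_mono subset_UNIV)
  have A_le: "A m \<le> (SUP m\<in>{N..}. A m)" if "N \<le> m" for m N
    using that by (intro cSUP_upper bdd) auto
  have \<epsilon>_pos: "0 < \<epsilon> N" for N
    unfolding \<epsilon>_def using order_trans[OF A(2) A_le[of N N]] by (intro add_nonneg_pos) auto
  have A_\<epsilon>: "A N \<le> \<epsilon> N" for N
    unfolding \<epsilon>_def by (rule add_increasing2[OF _ A_le]) auto
  have \<epsilon>_anti: "\<epsilon> m \<le> \<epsilon> n" if "n \<le> m" for m n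
    unfolding \<epsilon>_def using that
    by (intro add_mono cSUP_subset_mono bdd le_imp_inverse_le) auto
  have \<epsilon>_lim: "\<epsilon> \<longlonglongrightarrow> 0"
  proof -
    have "(\<lambda>N. SUP m\<in>{N..}. A m) \<longlonglongrightarrow> 0"
    proof (rule LIMSEQ_I)
      fix e :: real assume "e > 0"
      then obtain N0 where N0: "\<And>N. N \<ge> N0 \<Longrightarrow> norm (A N - 0) < e / 2"
        using LIMSEQ_D[OF A(1), of "e / 2"] by auto
      have "norm ((SUP m\<in>{N..}. A m) - 0) < e" if "N \<ge> N0" for N
      proof -
        have "(SUP m\<in>{N..}. A m) \<le> e / 2"
        proof (rule cSUP_least)
          fix m assume "m \<in> {N..}"
          then show "A m \<le> e / 2"
            using N0[of m] that by simp
        qed simp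
        moreover have "0 \<le> (SUP m\<in>{N..}. A m)"
          using order_trans[OF A(2) A_le[of N N]] by simp
        ultimately show ?thesis
          using \<open>e > 0\<close> by simp
      qed
      then show "\<exists>N0. \<forall>N\<ge>N0. norm ((SUP m\<in>{N..}. A m) - 0) < e"
        by blast
    qed
    from tendsto_add[OF this LIMSEQ_inverse_real_of_nat] show ?thesis
      by (simp add: \<epsilon>_def[abs_def])
  qed
  have sqrt_lim: "(\<lambda>N. sqrt (\<epsilon> N)) \<longlonglongrightarrow> 0"
    using tendsto_real_sqrt[OF \<epsilon>_lim] by simp
  define S where "S = {n. b n \<le> sqrt (\<epsilon> (Suc n))}"
  have bad: "real (card ({..<N} - S)) \<le> real N * sqrt (\<epsilon> N)" for N
  proof -
    have "real (card ({..<N} - S)) * sqrt (\<epsilon> N) = (\<Sum>n\<in>{..<N} - S. sqrt (\<epsilon> N))"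
      by simp
    also have "\<dots> \<le> (\<Sum>n\<in>{..<N} - S. b n)"
    proof (rule sum_mono)
      fix n assume "n \<in> {..<N} - S"
      then have "sqrt (\<epsilon> (Suc n)) < b n" "\<epsilon> N \<le> \<epsilon> (Suc n)"
        by (auto simp: S_def intro: \<epsilon>_anti)
      then show "sqrt (\<epsilon> N) \<le> b n"
        using real_sqrt_le_mono[of "\<epsilon> N" "\<epsilon> (Suc n)"] by linarith
    qed
    also have "\<dots> \<le> (\<Sum>n<N. b n)"
      using b by (intro sum_mono2) auto
    also have "\<dots> = real N * A N"
      by (cases "N = 0") (auto simp: A_def)
    also have "\<dots> \<le> real N * \<epsilon> N"
      by (intro mult_left_mono A_\<epsilon>) auto
    also have "\<dots> = real N * sqrt (\<epsilon> N) * sqrt (\<epsilon> N)"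
      using \<epsilon>_pos[of N] by simp
    finally show ?thesis
      using \<epsilon>_pos[of N] by (simp add: mult_le_cancel_right)
  qed
  have "(\<lambda>N. real (card (S \<inter> {..<N})) / real N) \<longlonglongrightarrow> 1"
  proof (rule tendsto_sandwich)
    show "(\<lambda>N. 1 - sqrt (\<epsilon> N)) \<longlonglongrightarrow> 1"
      using tendsto_diff[OF tendsto_const sqrt_lim, of 1] by simp
    show "\<forall>\<^sub>F N in sequentially. 1 - sqrt (\<epsilon> N) \<le> real (card (S \<inter> {..<N})) / real N"
      using eventually_gt_at_top[of 0]
    proof eventually_elim
      case (elim N)
      have "card (S \<inter> {..<N}) + card ({..<N} - S) = N"
        using card_Int_Diff[of "{..<N}" S] by (simp add: Int_commute)
      then have "real (card (S \<inter> {..<N})) = real N - real (card ({..<N} - S))"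
        by linarith
      then have "real N * (1 - sqrt (\<epsilon> N)) \<le> real (card (S \<inter> {..<N}))"
        using bad[of N] by (simp add: algebra_simps)
      then show ?case
        using elim by (simp add: le_divide_eq mult.commute)
    qed
    show "\<forall>\<^sub>F N in sequentially. real (card (S \<inter> {..<N})) / real N \<le> 1"
    proof (intro always_eventually allI)
      fix N
      have "card (S \<inter> {..<N}) \<le> N"
        using card_mono[of "{..<N}" "S \<inter> {..<N}"] by simp
      then show "real (card (S \<inter> {..<N})) / real N \<le> 1"
        by (simp add: divide_le_eq)
    qed
  qed auto
  then have "density_one S"
    by (simp add: density_one_def)
  moreover have "(b \<longlongrightarrow> 0) (at_infinity_along S)"
  proof (rule tendsto_sandwich[where f = "\<lambda>_. 0"])
    show "\<forall>\<^sub>F n in at_infinity_along S. b n \<le> sqrt (\<epsilon> (Suc n))"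
      by (simp add: eventually_at_infinity_along S_def)
    show "((\<lambda>n. sqrt (\<epsilon> (Suc n))) \<longlongrightarrow> 0) (at_infinity_along S)"
      using LIMSEQ_Suc[OF sqrt_lim] at_infinity_along_le by (rule tendsto_mono[rotated])
  qed (auto simp: b)
  ultimately show ?thesis
    by blast
qed

text \<open>This is the convolution of \<open>x\<close> with the weights \<open>2 ^ -k\<close>.  It dominates each shift of \<open>x\<close> up to a
  constant, while its averages are at most twice those of \<open>x\<close>, so one exceptional set serves all
  shifts.\<close>

primrec discounted :: "(nat \<Rightarrow> real) \<Rightarrow> nat \<Rightarrow> real" where
  "discounted x 0 = x 0"
| "discounted x (Suc n) = x (Suc n) + discounted x n / 2"

lemma Koopman_von_Neumann_shifts:
  fixes x :: "nat \<Rightarrow> real"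
  assumes x: "\<And>n. 0 \<le> x n" and mean: "(\<lambda>N. (\<Sum>n<N. x n) / real N) \<longlonglongrightarrow> 0"
  shows "\<exists>S. density_one S \<and> (\<forall>k. ((\<lambda>n. x (n - k)) \<longlongrightarrow> 0) (at_infinity_along S))"
proof -
  define b where "b = discounted x"
  have b: "0 \<le> b n" for n
    unfolding b_def by (induction n) (auto simp: x)
  have x_le: "x n \<le> b n" for n
    using b by (cases n) (auto simp: b_def)
  have b_shift: "b n \<le> 2 ^ k * b (n + k)" for n k
  proof (induction k)
    case (Suc k)
    have "b (n + k) \<le> 2 * b (n + Suc k)"
      using x[of "Suc (n + k)"] by (simp add: b_def)
    then have "2 ^ k * b (n + k) \<le> 2 ^ k * (2 * b (n + Suc k))"
      by (intro mult_left_mono) auto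
    then have "2 ^ k * b (n + k) \<le> 2 ^ Suc k * b (n + Suc k)"
      by (simp only: power_Suc2 mult.assoc)
    with Suc show ?case by (rule order_trans)
  qed simp
  have "(\<Sum>n<Suc N. b n) \<le> 2 * (\<Sum>n<Suc N. x n) - b N" for N
  proof (induction N)
    case (Suc N)
    then show ?case
      by (simp add: b_def)
  qed (simp add: b_def)
  then have "(\<Sum>n<Suc N. b n) \<le> 2 * (\<Sum>n<Suc N. x n)" for N
    using b[of N] by (smt (verit))
  then have sum_le: "(\<Sum>n<N. b n) \<le> 2 * (\<Sum>n<N. x n)" for N
    by (cases N) (simp_all only: sum.empty lessThan_0 mult_zero_right order_refl)
  have "(\<lambda>N. (\<Sum>n<N. b n) / real N) \<longlonglongrightarrow> 0"
  proof (rule tendsto_sandwich[where f = "\<lambda>_. 0"])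
    show "\<forall>\<^sub>F N in sequentially. (\<Sum>n<N. b n) / real N \<le> 2 * ((\<Sum>n<N. x n) / real N)"
      using sum_le by (intro always_eventually allI) (simp add: divide_right_mono)
    show "(\<lambda>N. 2 * ((\<Sum>n<N. x n) / real N)) \<longlonglongrightarrow> 0"
      using tendsto_mult_left[OF mean, of 2] by simp
  qed (auto simp: b sum_nonneg)
  then obtain S where S: "density_one S" "(b \<longlongrightarrow> 0) (at_infinity_along S)"
    using Koopman_von_Neumann[of b] b by blast
  have "((\<lambda>n. x (n - k)) \<longlongrightarrow> 0) (at_infinity_along S)" for k
  proof (rule tendsto_sandwich[where f = "\<lambda>_. 0"])
    have "\<forall>\<^sub>F n in sequentially. x (n - k) \<le> 2 ^ k * b n"
      using eventually_ge_at_top[of k]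
    proof eventually_elim
      case (elim n)
      then show ?case
        using order_trans[OF x_le b_shift[of "n - k" k]] by simp
    qed
    then show "\<forall>\<^sub>F n in at_infinity_along S. x (n - k) \<le> 2 ^ k * b n"
      using at_infinity_along_le by (rule filter_leD[rotated])
    show "((\<lambda>n. 2 ^ k * b n) \<longlongrightarrow> 0) (at_infinity_along S)"
      using tendsto_mult_left[OF S(2), of "2 ^ k"] by simp
  qed (auto simp: x)
  with S(1) show ?thesis
    by blast
qed

context measure_preserving
begin

text \<open>Only the projection of \<open>\<eta>\<close> to the closed span of the orbit enters the inner products, so the
  countably many vectors of the orbit suffice as test functions for all of \<open>L\<^sup>2\<close>.\<close>

lemma weakly_null_if_null_on_orbit:
  assumes c: "c \<in> L2 M" and \<eta>: "\<eta> \<in> L2 M"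
    and orbit: "\<And>k. ((\<lambda>n. L2inner M ((koopman f ^^ n) c) ((koopman f ^^ k) c)) \<longlongrightarrow> 0) F"
  shows "((\<lambda>n. L2inner M ((koopman f ^^ n) c) \<eta>) \<longlongrightarrow> 0) F"
proof -
  define Orb where "Orb = range (\<lambda>k. (koopman f ^^ k) c)"
  define R where "R = cfun.span Orb"
  have "Orb \<subseteq> L2 M"
    using c by (auto simp: Orb_def)
  from this have R: "cfun.subspace R" "R \<subseteq> L2 M"
    unfolding R_def by (simp_all add: cfun.span_minimal[OF _ subspace_L2])
  have null_R: "((\<lambda>n. L2inner M ((koopman f ^^ n) c) \<theta>) \<longlongrightarrow> 0) F" if "\<theta> \<in> R" for \<theta>
  proof -
    have "\<theta> \<in> L2 M \<and> ((\<lambda>n. L2inner M ((koopman f ^^ n) c) \<theta>) \<longlongrightarrow> 0) F"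
      using that unfolding R_def
    proof (induction rule: cfun.span_induct_alt)
      case base
      show ?case using L2_zero by (simp add: L2inner_def)
    next
      case (step k x y)
      have x: "x \<in> L2 M"
        using step \<open>Orb \<subseteq> L2 M\<close> by blast
      have "((\<lambda>n. cnj k * L2inner M ((koopman f ^^ n) c) x + L2inner M ((koopman f ^^ n) c) y) \<longlongrightarrow> cnj k * 0 + 0) F"
        using step orbit by (intro tendsto_intros) (auto simp: Orb_def)
      moreover have "L2inner M ((koopman f ^^ n) c) (cscale k x + y)
          = cnj k * L2inner M ((koopman f ^^ n) c) x + L2inner M ((koopman f ^^ n) c) y" for n
        using x step c L2inner_add_right[of "cscale k x" M y "(koopman f ^^ n) c"]
        by (metis L2_cscale L2inner_cscale_right koopman_pow_L2)
      ultimately have "((\<lambda>n. L2inner M ((koopman f ^^ n) c) (cscale k x + y)) \<longlongrightarrow> 0) F"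
        by simp
      then show ?case
        using x step by (blast intro: L2_add L2_cscale)
    qed
    then show ?thesis ..
  qed
  obtain p where p: "p \<in> L2_closure M R" and orth: "\<eta> - p \<in> L2_orthogonal M (L2_closure M R)"
    using L2_projection_exists[OF R \<eta>] by blast
  have p_L2: "p \<in> L2 M"
    using p by (simp add: L2_closure_iff)
  have eq: "L2inner M ((koopman f ^^ n) c) \<eta> = L2inner M ((koopman f ^^ n) c) p" for n
  proof -
    have "(koopman f ^^ n) c \<in> L2_closure M R"
      using subset_L2_closure[OF R(2)] unfolding R_def Orb_def by (blast intro: cfun.span_base)
    then have "L2inner M ((koopman f ^^ n) c) (\<eta> - p) = 0"
      using orth L2inner_commute[of M "(koopman f ^^ n) c" "\<eta> - p"] by (simp add: L2_orthogonal_iff)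
    then show ?thesis
      using c \<eta> p_L2 by (simp add: L2inner_diff_right)
  qed
  show ?thesis
    unfolding eq
  proof (rule tendstoI)
    fix e :: real assume e: "e > 0"
    define d where "d = e / (2 * (L2norm M c + 1))"
    have cpos: "0 < L2norm M c + 1"
      by (simp add: add_nonneg_pos)
    have d: "d > 0" "L2norm M c * d \<le> e / 2"
      using e cpos by (auto simp: d_def field_simps)
    obtain \<theta> where \<theta>: "\<theta> \<in> R" "L2norm M (p - \<theta>) < d"
      using p d(1) unfolding L2_closure_iff by blast
    have \<theta>_L2: "\<theta> \<in> L2 M"
      using \<theta>(1) R(2) by blast
    have "\<forall>\<^sub>F n in F. norm (L2inner M ((koopman f ^^ n) c) \<theta>) < e / 2"
      using tendstoD[OF null_R[OF \<theta>(1)], of "e / 2"] e by simp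
    then show "\<forall>\<^sub>F n in F. dist (L2inner M ((koopman f ^^ n) c) p) 0 < e"
    proof eventually_elim
      case (elim n)
      have "norm (L2inner M ((koopman f ^^ n) c) (p - \<theta>)) \<le> L2norm M c * L2norm M (p - \<theta>)"
        using L2_Cauchy_Schwarz[OF koopman_pow_L2[OF c] L2_diff[OF p_L2 \<theta>_L2], of n] c by simp
      also have "\<dots> \<le> L2norm M c * d"
        using \<theta>(2) by (intro mult_left_mono) auto
      finally have "norm (L2inner M ((koopman f ^^ n) c) (p - \<theta>)) \<le> e / 2"
        using d(2) by linarith
      moreover have "L2inner M ((koopman f ^^ n) c) p
          = L2inner M ((koopman f ^^ n) c) (p - \<theta>) + L2inner M ((koopman f ^^ n) c) \<theta>"
        using c p_L2 \<theta>_L2 by (simp add: L2inner_diff_right)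
      ultimately show ?case
        using elim norm_triangle_ineq[of "L2inner M ((koopman f ^^ n) c) (p - \<theta>)"
            "L2inner M ((koopman f ^^ n) c) \<theta>"] by (simp add: dist_norm)
    qed
  qed
qed

text \<open>The inner product of \<open>U ^ n c\<close> with \<open>U ^ k c\<close> is the autocorrelation of \<open>c\<close> at \<open>n - k\<close>.  Hence one set of
  density one must work for all shifts; summing over the finite family makes it work for all members.\<close>

lemma weakly_null_along_density_one:
  fixes c :: "'i::finite \<Rightarrow> 'a \<Rightarrow> complex"
  assumes c: "\<And>i. c i \<in> L2 M"
    and orth: "\<And>i \<psi>. \<psi> \<in> koopman_eigenfunctions M f \<Longrightarrow> L2inner M (c i) \<psi> = 0"
  shows "\<exists>S. density_one S \<and> (\<forall>i. \<forall>\<eta>\<in>L2 M.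
    ((\<lambda>n. L2inner M ((koopman f ^^ n) (c i)) \<eta>) \<longlongrightarrow> 0) (at_infinity_along S))"
proof -
  define a where "a i k = (norm (L2inner M ((koopman f ^^ k) (c i)) (c i)))\<^sup>2" for i k
  define x where "x k = (\<Sum>i\<in>UNIV. a i k)" for k
  have a_nonneg: "0 \<le> a i k" for i k
    by (simp add: a_def)
  have x_nonneg: "0 \<le> x k" for k
    unfolding x_def by (intro sum_nonneg a_nonneg)
  have "(\<lambda>N. \<Sum>i\<in>UNIV. (\<Sum>k<N. a i k) / real N) \<longlonglongrightarrow> (\<Sum>i\<in>(UNIV :: 'i set). 0)"
    unfolding a_def by (intro tendsto_sum autocorrelation_mean_square_tendsto_0 c orth)
  moreover have "(\<Sum>i\<in>UNIV. (\<Sum>k<N. a i k) / real N) = (\<Sum>k<N. x k) / real N" for N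
    unfolding x_def sum_divide_distrib[symmetric] by (subst sum.swap) simp
  ultimately have "(\<lambda>N. (\<Sum>k<N. x k) / real N) \<longlonglongrightarrow> 0"
    by simp
  then obtain S where S: "density_one S" and lim: "\<And>k. ((\<lambda>n. x (n - k)) \<longlongrightarrow> 0) (at_infinity_along S)"
    using Koopman_von_Neumann_shifts[of x] x_nonneg by blast
  have "((\<lambda>n. L2inner M ((koopman f ^^ n) (c i)) ((koopman f ^^ k) (c i))) \<longlongrightarrow> 0) (at_infinity_along S)"
    for i k
  proof (rule Lim_null_comparison)
    show "((\<lambda>n. sqrt (x (n - k))) \<longlongrightarrow> 0) (at_infinity_along S)"
      using tendsto_real_sqrt[OF lim[of k]] by simp
    have "\<forall>\<^sub>F n in sequentially.
        norm (L2inner M ((koopman f ^^ n) (c i)) ((koopman f ^^ k) (c i))) \<le> sqrt (x (n - k))"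
      using eventually_ge_at_top[of k]
    proof eventually_elim
      case (elim n)
      then have "L2inner M ((koopman f ^^ n) (c i)) ((koopman f ^^ k) (c i))
          = L2inner M ((koopman f ^^ (n - k)) (c i)) (c i)"
        using L2inner_koopman_pow[OF c[of i] c[of i], of k "n - k"] by simp
      moreover have "a i (n - k) \<le> x (n - k)"
        unfolding x_def by (intro member_le_sum a_nonneg) auto
      ultimately show ?case
        by (intro real_le_rsqrt) (simp add: a_def)
    qed
    then show "\<forall>\<^sub>F n in at_infinity_along S.
        norm (L2inner M ((koopman f ^^ n) (c i)) ((koopman f ^^ k) (c i))) \<le> sqrt (x (n - k))"
      using at_infinity_along_le by (rule filter_leD[rotated])
  qed
  then have "\<forall>i. \<forall>\<eta>\<in>L2 M. ((\<lambda>n. L2inner M ((koopman f ^^ n) (c i)) \<eta>) \<longlongrightarrow> 0) (at_infinity_along S)"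
    using weakly_null_if_null_on_orbit[OF c] by blast
  with S show ?thesis
    by blast
qed

end

section \<open>Finite-dimensional subspaces\<close>

text \<open>The proof adds one normalized Gram--Schmidt vector per generator, unless the generator already
  lies in the earlier span up to a null set.\<close>

lemma finite_span_projection:
  assumes "finite B" "B \<subseteq> L2 M"
  shows "\<exists>E. finite E \<and> E \<subseteq> cfun.span B \<and> (\<forall>\<psi>\<in>L2 M. \<forall>\<eta>\<in>cfun.span B.
    L2inner M (\<psi> - (\<Sum>e\<in>E. cscale (L2inner M \<psi> e) e)) \<eta> = 0)"
  using assms
proof (induction B rule: finite_induct)
  case empty
  show ?case
    by (intro exI[of _ "{}"]) (auto simp: L2inner_def)
next
  case (insert b B)
  obtain E where E: "finite E" "E \<subseteq> cfun.span B"
    and orth: "\<forall>\<psi>\<in>L2 M. \<forall>\<eta>\<in>cfun.span B.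
      L2inner M (\<psi> - (\<Sum>e\<in>E. cscale (L2inner M \<psi> e) e)) \<eta> = 0"
    using insert.IH insert.prems by blast
  define Q where "Q \<psi> = (\<Sum>e\<in>E. cscale (L2inner M \<psi> e) e)" for \<psi>
  have orth: "L2inner M (\<psi> - Q \<psi>) \<eta> = 0" if "\<psi> \<in> L2 M" "\<eta> \<in> cfun.span B" for \<psi> \<eta>
    using orth that unfolding Q_def by blast
  have spanB: "cfun.span B \<subseteq> L2 M"
    using insert.prems by (intro cfun.span_minimal subspace_L2) auto
  have sub: "cfun.span B \<subseteq> cfun.span (insert b B)"
    by (intro cfun.span_mono) auto
  have b: "b \<in> L2 M"
    using insert.prems by simp
  have Q_span: "Q \<psi> \<in> cfun.span B" for \<psi>
    unfolding Q_def using E by (intro cfun.span_sum cfun.span_scale) auto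
  then have Q_L2: "Q \<psi> \<in> L2 M" for \<psi>
    using spanB by blast
  define r where "r = b - Q b"
  have r: "r \<in> L2 M"
    using b Q_L2 by (simp add: r_def)
  have r_span: "r \<in> cfun.span (insert b B)"
    unfolding r_def using Q_span sub
    by (intro cfun.span_diff cfun.span_base[of b] subsetD[OF sub]) simp_all
  have r_orth: "L2inner M \<eta> r = 0" if "\<eta> \<in> cfun.span B" for \<eta>
    using orth[OF b that] L2inner_commute[of M \<eta> r] by (simp add: r_def)
  have extend: "L2inner M \<theta> \<eta> = 0"
    if \<theta>: "\<theta> \<in> L2 M" and B: "\<And>\<eta>. \<eta> \<in> cfun.span B \<Longrightarrow> L2inner M \<theta> \<eta> = 0"
      and "L2inner M \<theta> r = 0" and \<eta>: "\<eta> \<in> cfun.span (insert b B)" for \<theta> \<eta>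
  proof -
    obtain k where k: "\<eta> - cscale k b \<in> cfun.span B"
      using cfun.span_breakdown_eq[of \<eta> b B] \<eta> by blast
    have "L2inner M \<theta> (\<eta> - cscale k b) = 0" "L2inner M \<theta> (Q b) = 0"
      using B k Q_span by blast+
    moreover have "L2inner M \<theta> b = L2inner M \<theta> r + L2inner M \<theta> (Q b)"
      using L2inner_diff_right[OF b Q_L2 \<theta>, of b] by (simp add: r_def)
    moreover have "\<eta> \<in> L2 M"
      using \<eta> insert.prems cfun.span_minimal[OF insert.prems subspace_L2] by blast
    ultimately show ?thesis
      using that(3) L2inner_diff_right[OF _ L2_cscale[OF b] \<theta>, of \<eta> k]
      by (simp add: L2inner_cscale_right)
  qed
  show ?case
  proof (cases "L2norm M r = 0")
    case True
    have "L2inner M (\<psi> - Q \<psi>) r = 0" if "\<psi> \<in> L2 M" for \<psi>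
      using L2_Cauchy_Schwarz[OF L2_diff[OF that Q_L2] r, of \<psi>] True by simp
    then have "\<forall>\<psi>\<in>L2 M. \<forall>\<eta>\<in>cfun.span (insert b B). L2inner M (\<psi> - Q \<psi>) \<eta> = 0"
      using extend orth Q_L2 by (meson L2_diff)
    then show ?thesis
      using E sub unfolding Q_def by blast
  next
    case False
    define u where "u = cscale (inverse (complex_of_real (L2norm M r))) r"
    have u: "u \<in> L2 M" "u \<in> cfun.span (insert b B)"
      using r r_span by (auto simp: u_def intro: cfun.span_scale)
    have r_u: "r = cscale (complex_of_real (L2norm M r)) u"
      using False by (simp add: u_def cscale_def fun_eq_iff flip: mult.assoc)
    have "L2norm M u = 1"
      unfolding u_def L2norm_cscale using False by (simp add: norm_inverse)
    then have uu: "L2inner M u u = 1"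
      by (simp add: L2inner_self)
    have u_orth: "L2inner M \<eta> u = 0" "L2inner M u \<eta> = 0" if "\<eta> \<in> cfun.span B" for \<eta>
      using r_orth[OF that] L2inner_commute[of M r \<eta>]
      by (simp_all add: u_def L2inner_cscale_right L2inner_cscale_left)
    have "u \<notin> E"
      using u_orth(1)[of u] uu E by auto
    then have Q': "(\<Sum>e\<in>insert u E. cscale (L2inner M \<psi> e) e) = Q \<psi> + cscale (L2inner M \<psi> u) u" for \<psi>
      using E(1) unfolding Q_def by (subst sum.insert) (auto simp only: add.commute)
    have "L2inner M (\<psi> - (Q \<psi> + cscale (L2inner M \<psi> u) u)) \<eta> = 0"
      if \<psi>: "\<psi> \<in> L2 M" and \<eta>: "\<eta> \<in> cfun.span (insert b B)" for \<psi> \<eta>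
    proof (rule extend[OF _ _ _ \<eta>])
      show L2: "\<psi> - (Q \<psi> + cscale (L2inner M \<psi> u) u) \<in> L2 M"
        using \<psi> Q_L2 u(1) by (intro L2_diff L2_add L2_cscale)
      have inner: "L2inner M (\<psi> - (Q \<psi> + cscale (L2inner M \<psi> u) u)) \<theta>
          = L2inner M (\<psi> - Q \<psi>) \<theta> - L2inner M \<psi> u * L2inner M u \<theta>" if "\<theta> \<in> L2 M" for \<theta>
        using L2inner_diff_left[OF L2_diff[OF \<psi> Q_L2] L2_cscale[OF u(1)] that, of \<psi> "L2inner M \<psi> u"]
        by (simp only: diff_diff_eq L2inner_cscale_left)
      show "L2inner M (\<psi> - (Q \<psi> + cscale (L2inner M \<psi> u) u)) \<theta> = 0" if "\<theta> \<in> cfun.span B" for \<theta>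
        using inner[of \<theta>] orth[OF \<psi> that] u_orth(2)[OF that] that spanB by auto
      have "L2inner M (\<psi> - Q \<psi>) u = L2inner M \<psi> u"
        using L2inner_diff_left[OF \<psi> Q_L2 u(1), of \<psi>] u_orth(1)[OF Q_span] by simp
      then have "L2inner M (\<psi> - (Q \<psi> + cscale (L2inner M \<psi> u) u)) u = 0"
        using inner[OF u(1)] uu by simp
      then show "L2inner M (\<psi> - (Q \<psi> + cscale (L2inner M \<psi> u) u)) r = 0"
        by (subst r_u) (simp only: L2inner_cscale_right mult_zero_right)
    qed
    then have "\<forall>\<psi>\<in>L2 M. \<forall>\<eta>\<in>cfun.span (insert b B).
        L2inner M (\<psi> - (\<Sum>e\<in>insert u E. cscale (L2inner M \<psi> e) e)) \<eta> = 0"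
      unfolding Q' by blast
    moreover have "finite (insert u E)" "insert u E \<subseteq> cfun.span (insert b B)"
      using E sub u(2) by blast+
    ultimately show ?thesis
      by (intro exI conjI)
  qed
qed

lemma L2_subspaceD:
  assumes "L2_subspace M W"
  shows "W \<subseteq> L2 M" "cfun.subspace W"
    and "\<And>\<psi> \<eta>. \<psi> \<in> W \<Longrightarrow> \<eta> \<in> L2 M \<Longrightarrow> AE x in M. \<eta> x = \<psi> x \<Longrightarrow> \<eta> \<in> W"
  using assms unfolding L2_subspace_def by blast+

lemma finite_dim_projection:
  assumes W: "L2_subspace M W" and fin: "L2_finite_dim M W"
  shows "\<exists>E. finite E \<and> E \<subseteq> W \<and> (\<forall>\<psi>\<in>L2 M. \<forall>\<eta>\<in>W.
    L2inner M (\<psi> - (\<Sum>e\<in>E. cscale (L2inner M \<psi> e) e)) \<eta> = 0)"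
proof -
  obtain B where B: "finite B" "B \<subseteq> W" and gen: "\<And>\<psi>. \<psi> \<in> W \<Longrightarrow> \<exists>\<eta>\<in>cfun.span B. AE x in M. \<psi> x = \<eta> x"
    using fin unfolding L2_finite_dim_def by blast
  have span: "cfun.span B \<subseteq> W"
    by (rule cfun.span_minimal[OF B(2) L2_subspaceD(2)[OF W]])
  have "B \<subseteq> L2 M"
    using B(2) L2_subspaceD(1)[OF W] by blast
  obtain E where E: "finite E" "E \<subseteq> cfun.span B"
    and orth: "\<forall>\<psi>\<in>L2 M. \<forall>\<eta>\<in>cfun.span B.
      L2inner M (\<psi> - (\<Sum>e\<in>E. cscale (L2inner M \<psi> e) e)) \<eta> = 0"
    using finite_span_projection[OF B(1) \<open>B \<subseteq> L2 M\<close>] by (elim exE conjE)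
  have "L2inner M (\<psi> - (\<Sum>e\<in>E. cscale (L2inner M \<psi> e) e)) \<eta> = 0"
    if \<psi>: "\<psi> \<in> L2 M" and \<eta>: "\<eta> \<in> W" for \<psi> \<eta>
  proof -
    obtain \<eta>' where \<eta>': "\<eta>' \<in> cfun.span B" "AE x in M. \<eta> x = \<eta>' x"
      using gen[OF \<eta>] by blast
    have EL2: "E \<subseteq> L2 M"
      using E(2) span L2_subspaceD(1)[OF W] by blast
    have "\<psi> - (\<Sum>e\<in>E. cscale (L2inner M \<psi> e) e) \<in> L2 M"
      using \<psi> EL2 by (intro L2_diff L2_sum L2_cscale) auto
    then have "L2inner M (\<psi> - (\<Sum>e\<in>E. cscale (L2inner M \<psi> e) e)) \<eta>
        = L2inner M (\<psi> - (\<Sum>e\<in>E. cscale (L2inner M \<psi> e) e)) \<eta>'"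
      using \<eta> \<eta>' span L2_subspaceD(1)[OF W] by (intro L2inner_cong_AE) auto
    then show ?thesis
      using orth \<psi> \<eta>'(1) by simp
  qed
  with E span show ?thesis
    by blast
qed

text \<open>The residual of a limit point after projection lies in the closure of \<open>W\<close> and is orthogonal to it,
  so it vanishes almost everywhere.\<close>

lemma finite_dim_closed:
  assumes W: "L2_subspace M W" and fin: "L2_finite_dim M W"
  shows "L2_closure M W \<subseteq> W"
proof
  fix \<psi> assume \<psi>: "\<psi> \<in> L2_closure M W"
  then have \<psi>_L2: "\<psi> \<in> L2 M"
    by (simp add: L2_closure_iff)
  note W_L2 = L2_subspaceD(1)[OF W] and W_sub = L2_subspaceD(2)[OF W]
  obtain E where E: "finite E" "E \<subseteq> W" and orth: "\<And>\<eta>. \<eta> \<in> W \<Longrightarrow>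
      L2inner M (\<psi> - (\<Sum>e\<in>E. cscale (L2inner M \<psi> e) e)) \<eta> = 0"
    using finite_dim_projection[OF W fin] \<psi>_L2 by blast
  define p where "p = (\<Sum>e\<in>E. cscale (L2inner M \<psi> e) e)"
  have p: "p \<in> W"
    unfolding p_def using E by (intro cfun.subspace_sum[OF W_sub] cfun.subspace_scale[OF W_sub]) auto
  then have p_L2: "p \<in> L2 M"
    using W_L2 by blast
  have "\<psi> - p \<in> L2_orthogonal M W"
    using orth \<psi>_L2 p_L2 by (auto simp: L2_orthogonal_iff p_def)
  then have "\<psi> - p \<in> L2_orthogonal M (L2_closure M W)"
    by (rule L2_orthogonal_closure[OF W_L2])
  moreover have "\<psi> - p \<in> L2_closure M W"
    using \<psi> p subset_L2_closure[OF W_L2]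
    by (intro cfun.subspace_diff[OF subspace_L2_closure[OF W_sub W_L2]]) auto
  ultimately have "L2inner M (\<psi> - p) (\<psi> - p) = 0"
    by (simp add: L2_orthogonal_iff)
  then have "L2norm M (\<psi> - p) = 0"
    unfolding L2inner_self by simp
  then have "AE x in M. \<psi> x = p x"
    using L2norm_eq_0_iff[OF L2_diff[OF \<psi>_L2 p_L2]] by simp
  then show "\<psi> \<in> W"
    by (rule L2_subspaceD(3)[OF W p \<psi>_L2])
qed

context prob_space
begin

context
  fixes W
  assumes W: "L2_subspace M W" and closed: "L2_closure M W \<subseteq> W"
begin

lemmas W_L2 = L2_subspaceD(1)[OF W] and W_subspace = L2_subspaceD(2)[OF W]

lemma proj_in: "\<psi> \<in> L2 M \<Longrightarrow> L2_proj M W \<psi> \<in> W"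
  by (rule L2_proj_in[OF W_subspace W_L2 closed])

lemma proj_L2 [simp, intro]: "\<psi> \<in> L2 M \<Longrightarrow> L2_proj M W \<psi> \<in> L2 M"
  using proj_in W_L2 by blast

lemma proj_orthogonal: "\<psi> \<in> L2 M \<Longrightarrow> \<eta> \<in> W \<Longrightarrow> L2inner M (\<psi> - L2_proj M W \<psi>) \<eta> = 0"
  using L2_proj_orthogonal[OF W_subspace W_L2 closed] by (simp add: L2_orthogonal_iff)

lemma residual_le:
  assumes \<psi>: "\<psi> \<in> L2 M" and \<eta>: "\<eta> \<in> W"
  shows "L2norm M (\<psi> - L2_proj M W \<psi>) \<le> L2norm M (\<psi> - \<eta>)"
proof -
  have "L2_proj M W \<psi> - \<eta> \<in> W"
    by (rule cfun.subspace_diff[OF W_subspace proj_in[OF \<psi>] \<eta>])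
  then have "L2norm M (\<psi> - L2_proj M W \<psi>)
      \<le> L2norm M ((\<psi> - L2_proj M W \<psi>) + (L2_proj M W \<psi> - \<eta>))"
    using \<psi> W_L2 by (intro L2norm_square_mono proj_orthogonal) auto
  then show ?thesis
    by (simp only: diff_add_cancel add_diff_eq)
qed

lemma residual_add_le:
  assumes \<psi>: "\<psi> \<in> L2 M" and \<eta>: "\<eta> \<in> W" and \<theta>: "\<theta> \<in> L2 M"
  shows "L2norm M (\<theta> - L2_proj M W \<theta>) \<le> L2norm M (\<theta> - (\<psi> + \<eta>)) + L2norm M (\<psi> - L2_proj M W \<psi>)"
proof -
  have "L2_proj M W \<psi> + \<eta> \<in> W"
    by (rule cfun.subspace_add[OF W_subspace proj_in[OF \<psi>] \<eta>])
  then have "L2norm M (\<theta> - L2_proj M W \<theta>) \<le> L2norm M (\<theta> - (L2_proj M W \<psi> + \<eta>))"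
    by (rule residual_le[OF \<theta>])
  also have "\<dots> \<le> L2norm M (\<theta> - (\<psi> + \<eta>)) + L2norm M ((\<psi> + \<eta>) - (L2_proj M W \<psi> + \<eta>))"
    using \<psi> \<eta> \<theta> W_L2 by (intro L2norm_triangle_diff L2_add proj_L2) auto
  finally show ?thesis
    by (simp only: add_diff_cancel_right)
qed

text \<open>The residual norm is the distance to \<open>W\<close>: it is 1-Lipschitz and blind to elements of \<open>W\<close>.\<close>

lemma residual_perturbation:
  assumes \<psi>: "\<psi> \<in> L2 M" and \<eta>: "\<eta> \<in> W" and \<theta>: "\<theta> \<in> L2 M"
  shows "\<bar>L2norm M (\<theta> - L2_proj M W \<theta>) - L2norm M (\<psi> - L2_proj M W \<psi>)\<bar> \<le> L2norm M (\<theta> - (\<psi> + \<eta>))"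
proof -
  have "0 - \<eta> \<in> W"
    by (rule cfun.subspace_diff[OF W_subspace cfun.subspace_0[OF W_subspace] \<eta>])
  from residual_add_le[OF \<theta> this \<psi>]
  have "L2norm M (\<psi> - L2_proj M W \<psi>) \<le> L2norm M (\<psi> - (\<theta> + (0 - \<eta>))) + L2norm M (\<theta> - L2_proj M W \<theta>)" .
  moreover have "\<psi> - (\<theta> + (0 - \<eta>)) = (\<psi> + \<eta>) - \<theta>"
    by (simp add: fun_eq_iff)
  then have "L2norm M (\<psi> - (\<theta> + (0 - \<eta>))) = L2norm M (\<theta> - (\<psi> + \<eta>))"
    using L2norm_minus_commute[of M "\<psi> + \<eta>" \<theta>] by (simp only:)
  ultimately show ?thesis
    using residual_add_le[OF \<psi> \<eta> \<theta>] by linarith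
qed

lemma residual_near_norm:
  assumes \<psi>: "\<psi> \<in> L2 M"
  shows "\<bar>L2norm M (\<psi> - L2_proj M W \<psi>) - L2norm M \<psi>\<bar> \<le> L2norm M (L2_proj M W \<psi>)"
  using L2norm_reverse_triangle[OF L2_diff[OF \<psi> proj_L2[OF \<psi>]] \<psi>]
    L2norm_minus_commute[of M "\<psi> - L2_proj M W \<psi>" \<psi>] by simp

lemma norm_proj_le:
  assumes \<psi>: "\<psi> \<in> L2 M"
  shows "L2norm M (L2_proj M W \<psi>) \<le> L2norm M \<psi>"
proof -
  have "L2inner M (L2_proj M W \<psi>) (\<psi> - L2_proj M W \<psi>) = 0"
    using proj_orthogonal[OF \<psi> proj_in[OF \<psi>]]
      L2inner_commute[of M "L2_proj M W \<psi>" "\<psi> - L2_proj M W \<psi>"] by simp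
  then have "L2norm M (L2_proj M W \<psi>) \<le> L2norm M (L2_proj M W \<psi> + (\<psi> - L2_proj M W \<psi>))"
    using \<psi> by (intro L2norm_square_mono) auto
  moreover have "L2_proj M W \<psi> + (\<psi> - L2_proj M W \<psi>) = \<psi>"
    by simp
  ultimately show ?thesis
    by (simp only:)
qed

text \<open>The norm of the projection is bounded by a finite sum of inner products with fixed functions.\<close>

lemma finite_dim_proj_tendsto_0:
  assumes fin: "L2_finite_dim M W" and \<psi>: "\<And>n. \<psi> n \<in> L2 M"
    and weak: "\<And>\<eta>. \<eta> \<in> L2 M \<Longrightarrow> ((\<lambda>n. L2inner M (\<psi> n) \<eta>) \<longlongrightarrow> 0) F"
  shows "((\<lambda>n. L2norm M (L2_proj M W (\<psi> n))) \<longlongrightarrow> 0) F"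
proof -
  obtain E where E: "finite E" "E \<subseteq> W" and orth: "\<And>\<psi> \<eta>. \<psi> \<in> L2 M \<Longrightarrow> \<eta> \<in> W \<Longrightarrow>
      L2inner M (\<psi> - (\<Sum>e\<in>E. cscale (L2inner M \<psi> e) e)) \<eta> = 0"
    using finite_dim_projection[OF W fin] by blast
  have E_L2: "e \<in> L2 M" if "e \<in> E" for e
    using that E(2) W_L2 by blast
  have le: "L2norm M (L2_proj M W \<theta>) \<le> (\<Sum>e\<in>E. norm (L2inner M \<theta> e) * L2norm M e)"
    if \<theta>: "\<theta> \<in> L2 M" for \<theta>
  proof -
    define p q where "p = L2_proj M W \<theta>" and "q = (\<Sum>e\<in>E. cscale (L2inner M \<theta> e) e)"
    have p: "p \<in> W" "p \<in> L2 M" and q: "q \<in> L2 M"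
      using \<theta> E_L2 proj_in by (auto simp: p_def q_def)
    have "L2inner M p p = L2inner M \<theta> p"
      using proj_orthogonal[OF \<theta> p(1)] L2inner_diff_left[OF \<theta> p(2) p(2)] by (simp add: p_def)
    moreover have "L2inner M q p = L2inner M \<theta> p"
      using orth[OF \<theta> p(1)] L2inner_diff_left[OF \<theta> q p(2)] by (simp add: q_def)
    ultimately have "norm (L2inner M p p) \<le> L2norm M q * L2norm M p"
      using L2_Cauchy_Schwarz[OF q p(2)] by simp
    then have "L2norm M p * L2norm M p \<le> L2norm M q * L2norm M p"
      unfolding L2inner_self norm_of_real by (simp add: power2_eq_square)
    then have "L2norm M p \<le> L2norm M q"
      using L2norm_nonneg[of M p] L2norm_nonneg[of M q] by (cases "L2norm M p = 0") auto
    also have "\<dots> \<le> (\<Sum>e\<in>E. L2norm M (cscale (L2inner M \<theta> e) e))"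
      unfolding q_def using E_L2 by (intro L2norm_sum_le L2_cscale)
    finally show ?thesis
      by (simp only: L2norm_cscale p_def)
  qed
  have "((\<lambda>n. \<Sum>e\<in>E. norm (L2inner M (\<psi> n) e) * L2norm M e) \<longlongrightarrow> (\<Sum>e\<in>E. norm (0 :: complex) * L2norm M e)) F"
    using E_L2 by (intro tendsto_sum tendsto_mult tendsto_norm weak tendsto_const)
  then have "((\<lambda>n. \<Sum>e\<in>E. norm (L2inner M (\<psi> n) e) * L2norm M e) \<longlongrightarrow> 0) F"
    by simp
  then show ?thesis
    by (rule Lim_null_comparison[rotated]) (use le[OF \<psi>] in simp)
qed

end

end

section \<open>The error of direct forecast\<close>

lemma borel_measurable_vec:
  fixes \<psi> :: "'a \<Rightarrow> complex ^ 'd"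
  assumes "\<And>i. (\<lambda>x. \<psi> x $ i) \<in> borel_measurable M"
  shows "\<psi> \<in> borel_measurable M"
proof (rule borel_measurable_euclidean_space[THEN iffD2], rule ballI)
  fix b :: "complex ^ 'd" assume "b \<in> Basis"
  then obtain i u where b: "b = axis i u"
    unfolding Basis_vec_def by blast
  have [measurable]: "(\<lambda>x. \<psi> x $ i) \<in> borel_measurable M"
    by (rule assms)
  show "(\<lambda>x. \<psi> x \<bullet> b) \<in> borel_measurable M"
    unfolding b inner_axis by measurable
qed

lemma L2norm_vec:
  fixes \<psi> :: "'a \<Rightarrow> complex ^ 'd"
  assumes "\<And>i. (\<lambda>x. \<psi> x $ i) \<in> L2 M"
  shows "L2norm M \<psi> = L2_set (\<lambda>i. L2norm M (\<lambda>x. \<psi> x $ i)) UNIV"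
proof -
  have "(norm (\<psi> x))\<^sup>2 = (\<Sum>i\<in>UNIV. (norm (\<psi> x $ i))\<^sup>2)" for x
    unfolding norm_vec_def L2_set_def by (simp add: sum_nonneg)
  then have "(\<integral>x. (norm (\<psi> x))\<^sup>2 \<partial>M) = (\<Sum>i\<in>UNIV. \<integral>x. (norm (\<psi> x $ i))\<^sup>2 \<partial>M)"
    using L2_integrable_square[OF assms] by (simp add: Bochner_Integration.integral_sum)
  then show ?thesis
    unfolding L2_set_def L2norm_square unfolding L2norm_def by simp
qed

lemma L2_set_diff_le:
  fixes a b :: "'i \<Rightarrow> real"
  shows "\<bar>L2_set a I - L2_set b I\<bar> \<le> (\<Sum>i\<in>I. \<bar>a i - b i\<bar>)"
proof -
  have *: "L2_set a I - L2_set b I \<le> (\<Sum>i\<in>I. \<bar>a i - b i\<bar>)" for a b :: "'i \<Rightarrow> real"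
  proof -
    have "L2_set a I = L2_set (\<lambda>i. (a i - b i) + b i) I"
      by simp
    also have "\<dots> \<le> L2_set (\<lambda>i. a i - b i) I + L2_set b I"
      by (rule L2_set_triangle_ineq)
    also have "L2_set (\<lambda>i. a i - b i) I \<le> (\<Sum>i\<in>I. \<bar>a i - b i\<bar>)"
      by (rule L2_set_le_sum_abs)
    finally show ?thesis by simp
  qed
  show ?thesis
    using *[of a b] *[of b a] by (simp add: abs_minus_commute)
qed

text \<open>Closure under changes on null sets turns a space of functions into a subspace of \<open>L\<^sup>2\<close>.  Both the
  space \<open>W\<close> of a hypothesis space and the span of finitely many eigenfunctions are of this form.\<close>

definition AE_hull :: "'a measure \<Rightarrow> ('a \<Rightarrow> complex) set \<Rightarrow> ('a \<Rightarrow> complex) set" where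
  "AE_hull M R = {\<psi> \<in> L2 M. \<exists>\<eta>\<in>R. AE x in M. \<psi> x = \<eta> x}"

lemma subset_AE_hull: "R \<subseteq> L2 M \<Longrightarrow> R \<subseteq> AE_hull M R"
  by (auto simp: AE_hull_def)

lemma L2_subspace_AE_hull:
  assumes R: "cfun.subspace R"
  shows "L2_subspace M (AE_hull M R)"
  unfolding L2_subspace_def cfun.subspace_def
proof (intro conjI ballI allI impI)
  show "AE_hull M R \<subseteq> L2 M"
    by (auto simp: AE_hull_def)
  show "0 \<in> AE_hull M R"
    using cfun.subspace_0[OF R] L2_zero unfolding AE_hull_def by blast
next
  fix \<psi> \<eta> assume "\<psi> \<in> AE_hull M R" "\<eta> \<in> AE_hull M R"
  then obtain a b where *: "\<psi> \<in> L2 M" "\<eta> \<in> L2 M" "a \<in> R" "b \<in> R"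
      "AE x in M. \<psi> x = a x" "AE x in M. \<eta> x = b x"
    unfolding AE_hull_def by blast
  have "AE x in M. (\<psi> + \<eta>) x = (a + b) x"
    using *(5,6) by eventually_elim simp
  then show "\<psi> + \<eta> \<in> AE_hull M R"
    unfolding AE_hull_def using * cfun.subspace_add[OF R] L2_add by blast
next
  fix c \<psi> assume "\<psi> \<in> AE_hull M R"
  then obtain a where *: "\<psi> \<in> L2 M" "a \<in> R" "AE x in M. \<psi> x = a x"
    unfolding AE_hull_def by blast
  have "AE x in M. cscale c \<psi> x = cscale c a x"
    using *(3) by eventually_elim (simp add: cscale_def)
  then show "cscale c \<psi> \<in> AE_hull M R"
    unfolding AE_hull_def using * cfun.subspace_scale[OF R] L2_cscale by blast
next
  fix \<psi> \<eta> assume "\<psi> \<in> AE_hull M R" and \<eta>: "\<eta> \<in> L2 M" and eq: "AE x in M. \<eta> x = \<psi> x"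
  then obtain a where a: "a \<in> R" "AE x in M. \<psi> x = a x"
    unfolding AE_hull_def by blast
  have "AE x in M. \<eta> x = a x"
    using eq a(2) by eventually_elim simp
  then show "\<eta> \<in> AE_hull M R"
    unfolding AE_hull_def using \<eta> a(1) by blast
qed

lemma L2_finite_dim_AE_hull:
  assumes "finite T" "T \<subseteq> L2 M"
  shows "L2_finite_dim M (AE_hull M (cfun.span T))"
  unfolding L2_finite_dim_def
proof (intro exI[of _ T] conjI ballI assms(1))
  show "T \<subseteq> AE_hull M (cfun.span T)"
    using assms(2) by (auto simp: AE_hull_def intro: cfun.span_base)
qed (auto simp: AE_hull_def)

lemma hyp_subspace_L2_subspace:
  assumes "hypothesis_space M \<Phi> H"
  shows "L2_subspace M (hyp_subspace M \<Phi> H)"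
proof -
  have H: "cfun.subspace H"
    using assms by (simp add: hypothesis_space_def)
  have "cfun.subspace ((\<lambda>h. h \<circ> \<Phi>) ` H)"
    unfolding cfun.subspace_def
  proof (intro conjI ballI allI)
    have "0 = 0 \<circ> \<Phi>"
      by (simp add: fun_eq_iff)
    then show "0 \<in> (\<lambda>h. h \<circ> \<Phi>) ` H"
      using cfun.subspace_0[OF H] by blast
  next
    fix x y assume "x \<in> (\<lambda>h. h \<circ> \<Phi>) ` H" "y \<in> (\<lambda>h. h \<circ> \<Phi>) ` H"
    then obtain h k where hk: "h \<in> H" "k \<in> H" "x = h \<circ> \<Phi>" "y = k \<circ> \<Phi>"
      by blast
    have "x + y = (h + k) \<circ> \<Phi>"
      unfolding hk(3,4) by (simp add: fun_eq_iff)
    then show "x + y \<in> (\<lambda>h. h \<circ> \<Phi>) ` H"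
      using cfun.subspace_add[OF H] hk by blast
  next
    fix c x assume "x \<in> (\<lambda>h. h \<circ> \<Phi>) ` H"
    then obtain h where h: "h \<in> H" "x = h \<circ> \<Phi>"
      by blast
    have "cscale c x = cscale c h \<circ> \<Phi>"
      unfolding h(2) by (simp add: fun_eq_iff cscale_def)
    then show "cscale c x \<in> (\<lambda>h. h \<circ> \<Phi>) ` H"
      using cfun.subspace_scale[OF H] h by blast
  qed
  then have "L2_subspace M (AE_hull M ((\<lambda>h. h \<circ> \<Phi>) ` H))"
    by (rule L2_subspace_AE_hull)
  then show ?thesis
    by (simp add: AE_hull_def hyp_subspace_def)
qed

context measure_preserving
begin

lemma koopman_pow_component:
  fixes \<psi> :: "'a \<Rightarrow> complex ^ 'd"
  shows "(\<lambda>x. (koopman f ^^ n) \<psi> x $ i) = (koopman f ^^ n) (\<lambda>x. \<psi> x $ i)"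
  by (simp add: koopman_funpow fun_eq_iff)

text \<open>The projection lies in \<open>W\<close>, so it is realized by hypothesis functions and the choice in the
  direct forecast has a witness.  Any such choice agrees with the projection almost everywhere along
  \<open>\<Phi>\<close>, whatever its values off the range of \<open>\<Phi>\<close> are.\<close>

lemma error_direct_eq:
  fixes \<phi> :: "'a \<Rightarrow> complex ^ 'd"
  assumes \<phi>: "\<And>i. (\<lambda>x. \<phi> x $ i) \<in> L2 M"
    and H: "hypothesis_space M \<Phi> H" and closed: "L2_closure M (hyp_subspace M \<Phi> H) \<subseteq> hyp_subspace M \<Phi> H"
  shows "error_direct M f \<phi> \<Phi> H n = L2norm M (\<lambda>x. (koopman f ^^ n) \<phi> x
    - L2_proj_vec M (hyp_subspace M \<Phi> H) ((koopman f ^^ n) \<phi>) x)"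
proof -
  define W where "W = hyp_subspace M \<Phi> H"
  define \<psi> where "\<psi> = (koopman f ^^ n) \<phi>"
  note W = hyp_subspace_L2_subspace[OF H, folded W_def] and closed = closed[folded W_def]
  have \<psi>: "(\<lambda>x. \<psi> x $ i) \<in> L2 M" for i
    unfolding \<psi>_def koopman_pow_component by (intro koopman_pow_L2 \<phi>)
  have proj: "L2_proj M W (\<lambda>x. \<psi> x $ i) \<in> W" for i
    by (rule proj_in[OF W closed \<psi>])
  then have "\<exists>h\<in>H. AE x in M. L2_proj M W (\<lambda>x. \<psi> x $ i) x = h (\<Phi> x)" for i
    unfolding W_def hyp_subspace_def by blast
  then obtain h where h: "\<And>i. h i \<in> H" "\<And>i. AE x in M. L2_proj M W (\<lambda>x. \<psi> x $ i) x = h i (\<Phi> x)"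
    by metis
  define P where "P w \<longleftrightarrow> (\<forall>i. (\<lambda>y. w y $ i) \<in> H) \<and> (AE x in M. w (\<Phi> x) = L2_proj_vec M W \<psi> x)"
    for w :: "'b \<Rightarrow> complex ^ 'd"
  have "AE x in M. \<forall>i\<in>UNIV. L2_proj M W (\<lambda>x. \<psi> x $ i) x = h i (\<Phi> x)"
    by (rule AE_finite_allI) (auto intro: h(2))
  then have "AE x in M. (\<chi> i. h i (\<Phi> x)) = L2_proj_vec M W \<psi> x"
    by eventually_elim (simp add: L2_proj_vec_def vec_eq_iff)
  then have "P (\<lambda>y. \<chi> i. h i y)"
    unfolding P_def using h(1) by simp
  then have "P (SOME w. P w)"
    by (rule someI[of P])
  moreover have "direct_forecast M f \<phi> \<Phi> H n = (SOME w. P w)"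
    unfolding direct_forecast_def P_def W_def \<psi>_def ..
  ultimately have "P (direct_forecast M f \<phi> \<Phi> H n)"
    by (simp only:)
  then have w_H: "\<And>i. (\<lambda>y. direct_forecast M f \<phi> \<Phi> H n y $ i) \<in> H"
    and w_AE: "AE x in M. direct_forecast M f \<phi> \<Phi> H n (\<Phi> x) = L2_proj_vec M W \<psi> x"
    by (auto simp: P_def)
  have "\<forall>h\<in>H. (\<lambda>x. h (\<Phi> x)) \<in> L2 M"
    using H unfolding hypothesis_space_def comp_def by blast
  from bspec[OF this w_H] have w_L2: "(\<lambda>x. direct_forecast M f \<phi> \<Phi> H n (\<Phi> x) $ i) \<in> L2 M" for i .
  have "L2norm M (\<lambda>x. \<psi> x - direct_forecast M f \<phi> \<Phi> H n (\<Phi> x))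
      = L2norm M (\<lambda>x. \<psi> x - L2_proj_vec M W \<psi> x)"
  proof (rule L2norm_cong_AE)
    show "(\<lambda>x. \<psi> x - direct_forecast M f \<phi> \<Phi> H n (\<Phi> x)) \<in> borel_measurable M"
    proof (rule borel_measurable_vec)
      fix i
      show "(\<lambda>x. (\<psi> x - direct_forecast M f \<phi> \<Phi> H n (\<Phi> x)) $ i) \<in> borel_measurable M"
        unfolding vector_minus_component
        by (intro borel_measurable_diff L2_measurable[OF \<psi>] L2_measurable[OF w_L2])
    qed
    show "(\<lambda>x. \<psi> x - L2_proj_vec M W \<psi> x) \<in> borel_measurable M"
    proof (rule borel_measurable_vec)
      fix i
      have "(\<lambda>x. L2_proj M W (\<lambda>x. \<psi> x $ i) x) \<in> borel_measurable M"
        by (intro L2_measurable) (use proj_L2[OF W closed \<psi>] in simp)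
      then show "(\<lambda>x. (\<psi> x - L2_proj_vec M W \<psi> x) $ i) \<in> borel_measurable M"
        unfolding vector_minus_component L2_proj_vec_def vec_lambda_beta
        by (intro borel_measurable_diff L2_measurable[OF \<psi>])
    qed
    show "AE x in M. \<psi> x - direct_forecast M f \<phi> \<Phi> H n (\<Phi> x) = \<psi> x - L2_proj_vec M W \<psi> x"
      using w_AE by eventually_elim simp
  qed
  then show ?thesis
    by (simp only: error_direct_def W_def \<psi>_def)
qed

lemma L2norm_residual_vec:
  fixes \<psi> :: "'a \<Rightarrow> complex ^ 'd"
  assumes W: "L2_subspace M W" "L2_closure M W \<subseteq> W" and \<psi>: "\<And>i. (\<lambda>x. \<psi> x $ i) \<in> L2 M"
  shows "L2norm M (\<lambda>x. \<psi> x - L2_proj_vec M W \<psi> x)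
    = L2_set (\<lambda>i. L2norm M ((\<lambda>x. \<psi> x $ i) - L2_proj M W (\<lambda>x. \<psi> x $ i))) UNIV"
proof -
  have comp: "(\<lambda>x. (\<psi> x - L2_proj_vec M W \<psi> x) $ i) = (\<lambda>x. \<psi> x $ i) - L2_proj M W (\<lambda>x. \<psi> x $ i)" for i
    by (simp add: L2_proj_vec_def fun_eq_iff)
  have "(\<lambda>x. (\<psi> x - L2_proj_vec M W \<psi> x) $ i) \<in> L2 M" for i
    unfolding comp by (intro L2_diff \<psi> proj_L2[OF W])
  from L2norm_vec[OF this] show ?thesis
    unfolding comp .
qed

text \<open>The part \<open>s i\<close> of the discrete component that \<open>W\<close> captures at all times is invisible to the
  error, the rest \<open>d i - s i\<close> contributes at most its norm, and the remaining \<open>c i\<close> is lost up to its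
  projection to \<open>W\<close>.\<close>

lemma error_direct_close:
  fixes \<phi> :: "'a \<Rightarrow> complex ^ 'd"
  assumes \<phi>: "\<And>i. (\<lambda>x. \<phi> x $ i) = d i + c i" and d: "\<And>i. d i \<in> L2 M" and c: "\<And>i. c i \<in> L2 M"
    and H: "hypothesis_space M \<Phi> H" and fin: "L2_finite_dim M (hyp_subspace M \<Phi> H)"
    and s: "\<And>i. s i \<in> L2 M" "\<And>i n. (koopman f ^^ n) (s i) \<in> hyp_subspace M \<Phi> H"
    and \<delta>: "\<And>i. L2norm M (d i - s i) \<le> \<delta>"
  shows "\<bar>error_direct M f \<phi> \<Phi> H n - L2_set (\<lambda>i. L2norm M (c i)) UNIV\<bar>
    \<le> real CARD('d) * \<delta> + (\<Sum>i\<in>UNIV. L2norm M (L2_proj M (hyp_subspace M \<Phi> H) ((koopman f ^^ n) (c i))))"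
proof -
  define W where "W = hyp_subspace M \<Phi> H"
  define res where "res \<psi> = L2norm M (\<psi> - L2_proj M W \<psi>)" for \<psi>
  have W: "L2_subspace M W"
    unfolding W_def by (rule hyp_subspace_L2_subspace[OF H])
  have closed: "L2_closure M W \<subseteq> W"
    using finite_dim_closed[OF W] fin by (simp add: W_def)
  have \<phi>_L2: "(\<lambda>x. \<phi> x $ i) \<in> L2 M" for i
    unfolding \<phi> by (intro L2_add d c)
  have \<psi>_L2: "(\<lambda>x. (koopman f ^^ n) \<phi> x $ i) \<in> L2 M" for i
    unfolding koopman_pow_component by (intro koopman_pow_L2 \<phi>_L2)
  have "error_direct M f \<phi> \<Phi> H n = L2_set (\<lambda>i. res ((koopman f ^^ n) (d i + c i))) UNIV"
    unfolding error_direct_eq[OF \<phi>_L2 H closed[unfolded W_def]] W_def[symmetric]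
      L2norm_residual_vec[OF W closed \<psi>_L2] koopman_pow_component \<phi> res_def ..
  then have "\<bar>error_direct M f \<phi> \<Phi> H n - L2_set (\<lambda>i. L2norm M (c i)) UNIV\<bar>
      \<le> (\<Sum>i\<in>UNIV. \<bar>res ((koopman f ^^ n) (d i + c i)) - L2norm M (c i)\<bar>)"
    by (simp only: L2_set_diff_le)
  also have "\<dots> \<le> (\<Sum>i\<in>UNIV. \<delta> + L2norm M (L2_proj M W ((koopman f ^^ n) (c i))))"
  proof (rule sum_mono)
    fix i
    define U where "U \<psi> = (koopman f ^^ n) \<psi>" for \<psi> :: "'a \<Rightarrow> complex"
    have U: "U (c i) \<in> L2 M" "U (d i + c i) \<in> L2 M" "U (s i) \<in> W"
      using c d s by (auto simp: U_def W_def simp del: koopman_pow_add)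
    have "U (d i + c i) - (U (c i) + U (s i)) = U (d i - s i)"
      by (simp add: U_def koopman_funpow fun_eq_iff)
    then have "\<bar>res (U (d i + c i)) - res (U (c i))\<bar> \<le> L2norm M (U (d i - s i))"
      using residual_perturbation[OF W closed U(1,3,2)] by (simp only: res_def)
    also have "\<dots> \<le> \<delta>"
      using \<delta>[of i] L2norm_koopman_pow[OF L2_diff[OF d s(1)]] by (simp only: U_def)
    finally have "\<bar>res (U (d i + c i)) - res (U (c i))\<bar> \<le> \<delta>" .
    moreover have "\<bar>res (U (c i)) - L2norm M (U (c i))\<bar> \<le> L2norm M (L2_proj M W (U (c i)))"
      unfolding res_def by (rule residual_near_norm[OF W closed U(1)])
    moreover have "L2norm M (U (c i)) = L2norm M (c i)"
      unfolding U_def by (rule L2norm_koopman_pow[OF c])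
    ultimately show "\<bar>res ((koopman f ^^ n) (d i + c i)) - L2norm M (c i)\<bar>
        \<le> \<delta> + L2norm M (L2_proj M W ((koopman f ^^ n) (c i)))"
      unfolding U_def by linarith
  qed
  finally show ?thesis
    by (simp add: sum.distrib W_def)
qed

text \<open>Finitely many eigenfunctions span a space that is invariant under \<open>U\<close>.  Once \<open>W\<close> contains this space,
  it contains the whole orbits of the approximations \<open>s i\<close>, which makes the error uniform in time.\<close>

lemma approximation_in_invariant_subspace:
  fixes d :: "'i::finite \<Rightarrow> 'a \<Rightarrow> complex"
  assumes d: "\<And>i. d i \<in> discrete_part M f" and \<delta>: "\<delta> > 0"
  shows "\<exists>W\<^sub>0 s. L2_subspace M W\<^sub>0 \<and> L2_finite_dim M W\<^sub>0 \<and>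
    (\<forall>i. s i \<in> L2 M \<and> L2norm M (d i - s i) \<le> \<delta> \<and> (\<forall>n. (koopman f ^^ n) (s i) \<in> W\<^sub>0))"
proof -
  define E where "E = koopman_eigenfunctions M f"
  have E_L2: "E \<subseteq> L2 M"
    by (auto simp: E_def koopman_eigenfunctions_def)
  have "\<exists>s\<in>cfun.span E. L2norm M (d i - s) < \<delta>" for i
    using d[of i] \<delta> unfolding discrete_part_def L2_closure_iff E_def by blast
  then obtain s where s: "\<And>i. s i \<in> cfun.span E" "\<And>i. L2norm M (d i - s i) < \<delta>"
    by metis
  have "\<exists>T. finite T \<and> T \<subseteq> E \<and> s i \<in> cfun.span T" for i
    using s(1)[of i] unfolding cfun.span_explicit by (smt (verit) mem_Collect_eq subset_refl)
  then obtain T where T: "\<And>i. finite (T i)" "\<And>i. T i \<subseteq> E" "\<And>i. s i \<in> cfun.span (T i)"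
    by metis
  define B where "B = (\<Union>i. T i)"
  have B: "finite B" "B \<subseteq> E"
    using T(1,2) by (auto simp: B_def)
  then have B_L2: "B \<subseteq> L2 M"
    using E_L2 by blast
  define W\<^sub>0 where "W\<^sub>0 = AE_hull M (cfun.span B)"
  have span_L2: "cfun.span B \<subseteq> L2 M"
    by (rule cfun.span_minimal[OF B_L2 subspace_L2])
  have s_B: "s i \<in> cfun.span B" for i
    using T(3)[of i] cfun.span_mono[of "T i" B] by (auto simp: B_def)
  have koop: "\<exists>\<eta>'\<in>cfun.span B. AE x in M. \<eta> (f x) = \<eta>' x" if "\<eta> \<in> cfun.span B" for \<eta>
    using that
  proof (induction rule: cfun.span_induct_alt)
    case base
    show ?case
      using cfun.span_zero[of B] by (intro bexI[of _ 0]) auto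
  next
    case (step k x y)
    then obtain y' where y': "y' \<in> cfun.span B" "AE t in M. y (f t) = y' t"
      by blast
    obtain l where l: "AE t in M. koopman f x t = l * x t"
      using step B(2) by (auto simp: E_def koopman_eigenfunctions_def)
    have "AE t in M. (cscale k x + y) (f t) = (cscale (k * l) x + y') t"
      using l y'(2) by eventually_elim (simp add: cscale_def koopman_def)
    moreover have "cscale (k * l) x + y' \<in> cfun.span B"
      by (rule cfun.span_add[OF cfun.span_scale[OF cfun.span_base[OF step(1)]] y'(1)])
    ultimately show ?case
      by blast
  qed
  have inv: "koopman f \<psi> \<in> W\<^sub>0" if \<psi>: "\<psi> \<in> W\<^sub>0" for \<psi>
  proof -
    obtain \<eta> where \<eta>: "\<psi> \<in> L2 M" "\<eta> \<in> cfun.span B" "AE x in M. \<psi> x = \<eta> x"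
      using \<psi> unfolding W\<^sub>0_def AE_hull_def by blast
    obtain \<eta>' where \<eta>': "\<eta>' \<in> cfun.span B" "AE x in M. \<eta> (f x) = \<eta>' x"
      using koop[OF \<eta>(2)] by blast
    have "AE x in M. koopman f \<psi> x = \<eta>' x"
      using AE_comp[OF \<eta>(3)] \<eta>'(2) by eventually_elim (simp add: koopman_def)
    then show ?thesis
      unfolding W\<^sub>0_def AE_hull_def using \<eta>'(1) koopman_L2[OF \<eta>(1)] by blast
  qed
  have "(koopman f ^^ n) (s i) \<in> W\<^sub>0" for n i
  proof (induction n)
    case 0
    show ?case
      using s_B subset_AE_hull[OF span_L2] by (auto simp: W\<^sub>0_def)
  next
    case (Suc n)
    then show ?case
      using inv by simp
  qed
  moreover have "L2_subspace M W\<^sub>0"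
    unfolding W\<^sub>0_def by (intro L2_subspace_AE_hull cfun.subspace_span)
  moreover have "L2_finite_dim M W\<^sub>0"
    unfolding W\<^sub>0_def by (rule L2_finite_dim_AE_hull[OF B(1) B_L2])
  moreover have "s i \<in> L2 M \<and> L2norm M (d i - s i) \<le> \<delta>" for i
    using s_B span_L2 s(2)[of i] by (auto intro: less_imp_le)
  ultimately show ?thesis
    by blast
qed

lemma discrete_part_subspace:
  shows "L2_subspace M (discrete_part M f)"
    and "L2_closure M (discrete_part M f) \<subseteq> discrete_part M f"
    and "koopman_eigenfunctions M f \<subseteq> discrete_part M f"
proof -
  have "koopman_eigenfunctions M f \<subseteq> L2 M"
    by (auto simp: koopman_eigenfunctions_def)
  then have span: "cfun.span (koopman_eigenfunctions M f) \<subseteq> L2 M"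
    by (rule cfun.span_minimal[OF _ subspace_L2])
  show "L2_closure M (discrete_part M f) \<subseteq> discrete_part M f"
    unfolding discrete_part_def by (rule L2_closure_closed[OF span])
  show "koopman_eigenfunctions M f \<subseteq> discrete_part M f"
    unfolding discrete_part_def using subset_L2_closure[OF span] cfun.span_superset by blast
  show "L2_subspace M (discrete_part M f)"
    unfolding L2_subspace_def discrete_part_def
    using L2_closure_subset_L2 subspace_L2_closure[OF cfun.subspace_span span] L2_closure_AE[OF _ _ span]
    by (intro conjI ballI impI) auto
qed

lemma one_eigenfunction: "(\<lambda>_. 1) \<in> koopman_eigenfunctions M f"
proof -
  have "\<not> (AE x in M. (1 :: complex) = 0)"
    using AE_False by simp
  moreover have "\<exists>c. AE x in M. koopman f (\<lambda>_. 1 :: complex) x = c * 1"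
    by (intro exI[of _ 1]) (simp add: koopman_def)
  ultimately show ?thesis
    unfolding koopman_eigenfunctions_def by simp
qed

text \<open>In the strongly mixing case there are no exceptional times: the constants are eigenfunctions, so the
  part of \<open>\<phi>\<close> orthogonal to the discrete part has mean zero and its correlations tend to zero.\<close>

lemma direct_forecast_errors:
  fixes \<phi> :: "'a \<Rightarrow> complex ^ 'd"
  assumes \<phi>: "\<And>i. (\<lambda>x. \<phi> x $ i) \<in> L2 M"
  shows "\<exists>S. density_one S \<and>
     (\<forall>\<epsilon>>0. \<exists>W\<^sub>0. L2_subspace M W\<^sub>0 \<and> L2_finite_dim M W\<^sub>0 \<and>
        (\<forall>H. admissible_hypothesis_space M \<Phi> H \<longrightarrow> W\<^sub>0 \<subseteq> hyp_subspace M \<Phi> H \<longrightarrow>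
           Limsup (at_infinity_along S)
             (\<lambda>n. ereal \<bar>error_direct M f \<phi> \<Phi> H n
                - L2norm M (\<lambda>x. \<phi> x - L2_proj_vec M (discrete_part M f) \<phi> x)\<bar>)
           \<le> ereal \<epsilon>)) \<and>
     (weakly_mixing M f \<longrightarrow>
        (\<forall>H. admissible_hypothesis_space M \<Phi> H \<longrightarrow>
           ((\<lambda>n. error_direct M f \<phi> \<Phi> H n)
              \<longlongrightarrow> L2norm M (\<lambda>x. \<phi> x - (\<integral>y. \<phi> y \<partial>M))) (at_infinity_along S))) \<and>
     (strongly_mixing M f \<longrightarrow> S = UNIV) \<and>
     (purely_discrete_spectrum M f \<longrightarrow>
        (\<forall>\<epsilon>>0. \<exists>W\<^sub>0. L2_subspace M W\<^sub>0 \<and> L2_finite_dim M W\<^sub>0 \<and>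
           (\<forall>H. admissible_hypothesis_space M \<Phi> H \<longrightarrow> W\<^sub>0 \<subseteq> hyp_subspace M \<Phi> H \<longrightarrow>
              (\<forall>n. error_direct M f \<phi> \<Phi> H n < \<epsilon>))))"
proof -
  define D where "D = discrete_part M f"
  note D = discrete_part_subspace[folded D_def]
  define d where "d i = L2_proj M D (\<lambda>x. \<phi> x $ i)" for i
  define c where "c i = (\<lambda>x. \<phi> x $ i) - d i" for i
  have d_D: "d i \<in> D" for i
    unfolding d_def by (rule proj_in[OF D(1,2) \<phi>])
  have d: "d i \<in> L2 M" for i
    using d_D L2_subspaceD(1)[OF D(1)] by blast
  have c: "c i \<in> L2 M" for i
    unfolding c_def by (intro L2_diff \<phi> d)
  have \<phi>_eq: "(\<lambda>x. \<phi> x $ i) = d i + c i" for i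
    by (simp add: c_def)
  have c_orth: "L2inner M (c i) \<eta> = 0" if "\<eta> \<in> D" for i \<eta>
    unfolding c_def d_def by (rule proj_orthogonal[OF D(1,2) \<phi> that])
  have limit_eq: "L2norm M (\<lambda>x. \<phi> x - L2_proj_vec M D \<phi> x) = L2_set (\<lambda>i. L2norm M (c i)) UNIV"
    unfolding L2norm_residual_vec[OF D(1,2) \<phi>] c_def d_def ..
  obtain S' where S': "density_one S'" "\<And>i \<eta>. \<eta> \<in> L2 M \<Longrightarrow>
      ((\<lambda>n. L2inner M ((koopman f ^^ n) (c i)) \<eta>) \<longlongrightarrow> 0) (at_infinity_along S')"
    using weakly_null_along_density_one[of c] c c_orth D(3) by (metis subsetD)
  define S where "S = (if strongly_mixing M f then UNIV else S')"
  have "density_one S"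
    using S'(1) density_one_UNIV by (simp add: S_def)
  have null: "((\<lambda>n. L2inner M ((koopman f ^^ n) (c i)) \<eta>) \<longlongrightarrow> 0) (at_infinity_along S)"
    if \<eta>: "\<eta> \<in> L2 M" for i \<eta>
  proof (cases "strongly_mixing M f")
    case True
    have "(\<integral>x. c i x \<partial>M) = L2inner M (c i) (\<lambda>_. 1)"
      by (simp add: L2inner_def)
    also have "\<dots> = 0"
      using one_eigenfunction D(3) by (intro c_orth) blast
    finally have "(\<lambda>n. L2inner M \<eta> ((koopman f ^^ n) (c i))) \<longlonglongrightarrow> 0"
      using True \<eta> c[of i] unfolding strongly_mixing_def by force
    then have "(\<lambda>n. cnj (L2inner M \<eta> ((koopman f ^^ n) (c i)))) \<longlonglongrightarrow> cnj 0"
      by (rule tendsto_cnj)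
    then have "(\<lambda>n. L2inner M ((koopman f ^^ n) (c i)) \<eta>) \<longlonglongrightarrow> 0"
      unfolding L2inner_commute[of M _ \<eta>, symmetric] by simp
    then show ?thesis
      using at_infinity_along_le by (rule tendsto_mono[rotated])
  next
    case False
    then show ?thesis
      using S'(2)[OF \<eta>] by (simp add: S_def)
  qed
  define lost where
    "lost H n = (\<Sum>i\<in>UNIV. L2norm M (L2_proj M (hyp_subspace M \<Phi> H) ((koopman f ^^ n) (c i))))" for H n
  have adm: "hypothesis_space M \<Phi> H" "L2_finite_dim M (hyp_subspace M \<Phi> H)"
      "L2_subspace M (hyp_subspace M \<Phi> H)" "L2_closure M (hyp_subspace M \<Phi> H) \<subseteq> hyp_subspace M \<Phi> H"
    if "admissible_hypothesis_space M \<Phi> H" for H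
    using that hyp_subspace_L2_subspace finite_dim_closed
    unfolding admissible_hypothesis_space_def by blast+
  have lost_lim: "(lost H \<longlongrightarrow> 0) (at_infinity_along S)" if "admissible_hypothesis_space M \<Phi> H" for H
  proof -
    have "((\<lambda>n. L2norm M (L2_proj M (hyp_subspace M \<Phi> H) ((koopman f ^^ n) (c i)))) \<longlongrightarrow> 0)
        (at_infinity_along S)" for i
      using c by (intro finite_dim_proj_tendsto_0[OF adm(3,4,2)[OF that]] null) auto
    then have "((\<lambda>n. lost H n) \<longlongrightarrow> (\<Sum>i\<in>(UNIV :: 'd set). 0)) (at_infinity_along S)"
      unfolding lost_def by (intro tendsto_sum)
    then show ?thesis
      by simp
  qed
  have approx: "\<exists>W\<^sub>0. L2_subspace M W\<^sub>0 \<and> L2_finite_dim M W\<^sub>0 \<and>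
      (\<forall>H. admissible_hypothesis_space M \<Phi> H \<longrightarrow> W\<^sub>0 \<subseteq> hyp_subspace M \<Phi> H \<longrightarrow>
        (\<forall>n. \<bar>error_direct M f \<phi> \<Phi> H n - L2_set (\<lambda>i. L2norm M (c i)) UNIV\<bar> \<le> \<epsilon> / 2 + lost H n))"
    if \<epsilon>: "\<epsilon> > 0" for \<epsilon>
  proof -
    define \<delta> where "\<delta> = \<epsilon> / (2 * real CARD('d))"
    have \<delta>: "\<delta> > 0" "real CARD('d) * \<delta> = \<epsilon> / 2"
      using \<epsilon> by (simp_all add: \<delta>_def)
    obtain W\<^sub>0 s where W0: "L2_subspace M W\<^sub>0" "L2_finite_dim M W\<^sub>0"
      and s: "\<And>i. s i \<in> L2 M" "\<And>i. L2norm M (d i - s i) \<le> \<delta>" "\<And>i n. (koopman f ^^ n) (s i) \<in> W\<^sub>0"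
      using approximation_in_invariant_subspace[of d, OF d_D[unfolded D_def] \<delta>(1)] by metis
    have "\<bar>error_direct M f \<phi> \<Phi> H n - L2_set (\<lambda>i. L2norm M (c i)) UNIV\<bar> \<le> \<epsilon> / 2 + lost H n"
      if H: "admissible_hypothesis_space M \<Phi> H" "W\<^sub>0 \<subseteq> hyp_subspace M \<Phi> H" for H n
      unfolding lost_def \<delta>(2)[symmetric] using s H(2)
      by (intro error_direct_close[where s = s, OF \<phi>_eq d c adm(1,2)[OF H(1)]]) auto
    with W0 show ?thesis
      by blast
  qed
  have part_i: "\<exists>W\<^sub>0. L2_subspace M W\<^sub>0 \<and> L2_finite_dim M W\<^sub>0 \<and>
      (\<forall>H. admissible_hypothesis_space M \<Phi> H \<longrightarrow> W\<^sub>0 \<subseteq> hyp_subspace M \<Phi> H \<longrightarrow>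
        Limsup (at_infinity_along S) (\<lambda>n. ereal \<bar>error_direct M f \<phi> \<Phi> H n
          - L2norm M (\<lambda>x. \<phi> x - L2_proj_vec M (discrete_part M f) \<phi> x)\<bar>) \<le> ereal \<epsilon>)"
    if \<epsilon>: "\<epsilon> > 0" for \<epsilon>
  proof -
    have "Limsup (at_infinity_along S) (\<lambda>n. ereal \<bar>error_direct M f \<phi> \<Phi> H n
        - L2norm M (\<lambda>x. \<phi> x - L2_proj_vec M (discrete_part M f) \<phi> x)\<bar>) \<le> ereal \<epsilon>"
      if H: "admissible_hypothesis_space M \<Phi> H"
        and le: "\<forall>n. \<bar>error_direct M f \<phi> \<Phi> H n - L2_set (\<lambda>i. L2norm M (c i)) UNIV\<bar> \<le> \<epsilon> / 2 + lost H n"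
      for H
    proof (rule Limsup_bounded)
      have "\<forall>\<^sub>F n in at_infinity_along S. lost H n < \<epsilon> / 2"
        using order_tendstoD(2)[OF lost_lim[OF H], of "\<epsilon> / 2"] \<epsilon> by simp
      then show "\<forall>\<^sub>F n in at_infinity_along S. ereal \<bar>error_direct M f \<phi> \<Phi> H n
          - L2norm M (\<lambda>x. \<phi> x - L2_proj_vec M (discrete_part M f) \<phi> x)\<bar> \<le> ereal \<epsilon>"
      proof eventually_elim
        case (elim n)
        then show ?case
          using le[rule_format, of n] unfolding D_def[symmetric] limit_eq ereal_less_eq by linarith
      qed
    qed
    with approx[OF \<epsilon>] show ?thesis
      by blast
  qed
  have part_ii: "((\<lambda>n. error_direct M f \<phi> \<Phi> H n)
      \<longlongrightarrow> L2norm M (\<lambda>x. \<phi> x - (\<integral>y. \<phi> y \<partial>M))) (at_infinity_along S)"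
    if wm: "weakly_mixing M f" and H: "admissible_hypothesis_space M \<Phi> H" for H
  proof -
    have "\<exists>k. AE x in M. d i x = k" for i
      using wm d_D[of i] unfolding weakly_mixing_def D_def by blast
    then obtain k where k: "\<And>i. AE x in M. d i x = k i"
      by metis
    have in_W: "(koopman f ^^ n) (d i) \<in> hyp_subspace M \<Phi> H" for i n
    proof -
      have "AE x in M. (koopman f ^^ n) (d i) x = k i"
      proof (induction n)
        case 0
        show ?case using k by simp
      next
        case (Suc n)
        from AE_comp[OF this] show ?case
          by (simp add: koopman_def)
      qed
      moreover have "(\<lambda>_. k i) \<in> hyp_subspace M \<Phi> H"
        using H unfolding admissible_hypothesis_space_def by blast
      ultimately show ?thesis
        using L2_subspaceD(3)[OF adm(3)[OF H]] d by blast
    qed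
    have zero: "L2norm M (d i - d i) \<le> 0" for i
      by (simp add: L2norm_def)
    have "\<bar>error_direct M f \<phi> \<Phi> H n - L2_set (\<lambda>i. L2norm M (c i)) UNIV\<bar> \<le> lost H n" for n
      using error_direct_close[OF \<phi>_eq d c adm(1,2)[OF H] d in_W zero, of n] unfolding lost_def by simp
    then have "((\<lambda>n. error_direct M f \<phi> \<Phi> H n - L2_set (\<lambda>i. L2norm M (c i)) UNIV) \<longlongrightarrow> 0)
        (at_infinity_along S)"
      by (intro Lim_null_comparison[OF _ lost_lim[OF H]]) simp
    then have lim: "((\<lambda>n. error_direct M f \<phi> \<Phi> H n) \<longlongrightarrow> L2_set (\<lambda>i. L2norm M (c i)) UNIV)
        (at_infinity_along S)"
      by (rule LIM_zero_cancel)
    have \<phi>_int: "integrable M (\<lambda>x. \<phi> x $ i)" for i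
      using L2_integrable_mult[OF \<phi>[of i] L2_const[of 1]] by simp
    have int_k: "(\<integral>x. \<phi> x $ i \<partial>M) = k i" for i
    proof -
      have "0 = L2inner M (c i) (\<lambda>_. 1)"
        using one_eigenfunction D(3) by (intro c_orth[symmetric]) blast
      also have "\<dots> = L2inner M (\<lambda>x. \<phi> x $ i) (\<lambda>_. 1) - L2inner M (d i) (\<lambda>_. 1)"
        unfolding c_def by (intro L2inner_diff_left \<phi> d L2_const)
      also have "L2inner M (d i) (\<lambda>_. 1) = L2inner M (\<lambda>_. k i) (\<lambda>_. 1)"
        by (intro L2inner_cong_AE d k L2_const) simp
      finally show ?thesis
        by (simp add: L2inner_def prob_space)
    qed
    have "integrable M \<phi>"
    proof (rule Bochner_Integration.integrable_bound)
      show "integrable M (\<lambda>x. \<Sum>i\<in>UNIV. norm (\<phi> x $ i))"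
        using \<phi>_int by (intro Bochner_Integration.integrable_sum integrable_norm)
      show "\<phi> \<in> borel_measurable M"
        by (intro borel_measurable_vec L2_measurable \<phi>)
      show "AE x in M. norm (\<phi> x) \<le> norm (\<Sum>i\<in>UNIV. norm (\<phi> x $ i))"
        unfolding norm_vec_def by (intro always_eventually allI order_trans[OF L2_set_le_sum]) auto
    qed
    then have "(\<integral>y. \<phi> y \<partial>M) $ i = k i" for i
      using integral_bounded_linear[OF bounded_linear_vec_nth[of i], of M \<phi>] int_k by simp
    then have comp: "(\<lambda>x. (\<phi> x - (\<integral>y. \<phi> y \<partial>M)) $ i) = (\<lambda>x. \<phi> x $ i) - (\<lambda>_. k i)" for i
      by (simp add: fun_eq_iff)
    have "(\<lambda>x. (\<phi> x - (\<integral>y. \<phi> y \<partial>M)) $ i) \<in> L2 M" for i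
      unfolding comp by (intro L2_diff \<phi> L2_const)
    then have "L2norm M (\<lambda>x. \<phi> x - (\<integral>y. \<phi> y \<partial>M))
        = L2_set (\<lambda>i. L2norm M ((\<lambda>x. \<phi> x $ i) - (\<lambda>_. k i))) UNIV"
      using L2norm_vec[of "\<lambda>x. \<phi> x - (\<integral>y. \<phi> y \<partial>M)" M] unfolding comp by blast
    also have "\<dots> = L2_set (\<lambda>i. L2norm M (c i)) UNIV"
    proof (intro L2_set_cong refl L2norm_cong_AE L2_measurable L2_diff \<phi> L2_const c)
      fix i
      show "AE x in M. ((\<lambda>x. \<phi> x $ i) - (\<lambda>_. k i)) x = c i x"
        using k[of i] by eventually_elim (simp add: c_def)
    qed
    finally show ?thesis
      using lim by simp
  qed
  have part_iv: "\<exists>W\<^sub>0. L2_subspace M W\<^sub>0 \<and> L2_finite_dim M W\<^sub>0 \<and>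
      (\<forall>H. admissible_hypothesis_space M \<Phi> H \<longrightarrow> W\<^sub>0 \<subseteq> hyp_subspace M \<Phi> H \<longrightarrow>
        (\<forall>n. error_direct M f \<phi> \<Phi> H n < \<epsilon>))"
    if pd: "purely_discrete_spectrum M f" and \<epsilon>: "\<epsilon> > 0" for \<epsilon>
  proof -
    have c0: "L2norm M (c i) = 0" for i
    proof -
      have "c i \<in> L2_orthogonal M (discrete_part M f)"
        using c c_orth unfolding L2_orthogonal_iff D_def by blast
      then show ?thesis
        using pd L2norm_eq_0_iff[OF c] unfolding purely_discrete_spectrum_def by blast
    qed
    have "error_direct M f \<phi> \<Phi> H n < \<epsilon>"
      if H: "admissible_hypothesis_space M \<Phi> H"
        and le: "\<forall>n. \<bar>error_direct M f \<phi> \<Phi> H n - L2_set (\<lambda>i. L2norm M (c i)) UNIV\<bar> \<le> \<epsilon> / 2 + lost H n"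
      for H n
    proof -
      have "L2norm M (L2_proj M (hyp_subspace M \<Phi> H) ((koopman f ^^ n) (c i))) \<le> 0" for i
        using norm_proj_le[OF adm(3,4)[OF H] koopman_pow_L2[OF c[of i], of n]] c c0 by simp
      then have "lost H n \<le> 0"
        unfolding lost_def by (intro sum_nonpos)
      moreover have "L2_set (\<lambda>i. L2norm M (c i)) UNIV = 0"
        unfolding c0 by (simp add: L2_set_def)
      ultimately show ?thesis
        using le[rule_format, of n] \<epsilon> by linarith
    qed
    with approx[OF \<epsilon>] show ?thesis
      by blast
  qed
  have part_iii: "strongly_mixing M f \<longrightarrow> S = UNIV"
    by (simp add: S_def)
  show ?thesis
    using \<open>density_one S\<close> part_i part_ii part_iii part_iv by blast
qed

end

section \<open>Restriction to the support\<close>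

text \<open>The complement of the support is a union of open null sets, and by Lindelof's property
  countably many of them suffice.\<close>

lemma measure_support_conull:
  fixes \<mu> :: "'a::second_countable_topology measure"
  assumes "sets \<mu> = sets borel"
  shows "closed (measure_support \<mu>)" "- measure_support \<mu> \<in> null_sets \<mu>"
proof -
  define F where "F = {U. open U \<and> emeasure \<mu> U = 0}"
  have compl: "- measure_support \<mu> = \<Union>F"
    by (auto simp: measure_support_def F_def zero_less_iff_neq_zero)
  then have "open (- measure_support \<mu>)"
    unfolding compl by (intro open_Union) (auto simp: F_def)
  then show "closed (measure_support \<mu>)"
    by (simp add: closed_def)
  obtain F' where F': "F' \<subseteq> F" "countable F'" "\<Union>F' = \<Union>F"
    using Lindelof[of F] by (auto simp: F_def)
  have "(\<Union>U\<in>F'. U) \<in> null_sets \<mu>"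
  proof (rule null_sets_UN'[OF F'(2)])
    fix U assume "U \<in> F'"
    then show "U \<in> null_sets \<mu>"
      using F'(1) assms by (auto simp: F_def intro!: null_setsI)
  qed
  then show "- measure_support \<mu> \<in> null_sets \<mu>"
    using F'(3) compl by simp
qed

lemma measure_support_invariant:
  fixes \<mu> :: "'a::topological_space measure"
  assumes "sets \<mu> = sets borel" "continuous_on UNIV f" "invariant_measure \<mu> f" "x \<in> measure_support \<mu>"
  shows "f x \<in> measure_support \<mu>"
  unfolding measure_support_def
proof (intro CollectI allI impI)
  fix U assume U: "open U" "f x \<in> U"
  have space: "space \<mu> = UNIV"
    using sets_eq_imp_space_eq[OF assms(1)] by simp
  have "open (f -` U)"
    using assms(2) U(1) by (simp add: continuous_on_open_vimage)
  then have "0 < emeasure \<mu> (f -` U)"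
    using assms(4) U(2) by (simp add: measure_support_def)
  also have "emeasure \<mu> (f -` U) = emeasure (distr \<mu> \<mu> f) U"
    using assms(1,3) U(1) space by (subst emeasure_distr) (auto simp: invariant_measure_def)
  finally show "0 < emeasure \<mu> U"
    using assms(3) by (simp add: invariant_measure_def)
qed

lemma measure_preserving_on_support:
  fixes \<mu> :: "'a::second_countable_topology measure"
  assumes prob: "prob_space \<mu>" and borel: "sets \<mu> = sets borel"
    and cont: "continuous_on UNIV f" and inv: "invariant_measure \<mu> f"
  shows "measure_preserving (restrict_space \<mu> (measure_support \<mu>)) f"
proof -
  define \<Omega> where "\<Omega> = measure_support \<mu>"
  define M where "M = restrict_space \<mu> \<Omega>"
  interpret \<mu>: prob_space \<mu> by (rule prob)
  have \<Omega>: "\<Omega> \<in> sets \<mu>"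
    using measure_support_conull(1)[OF borel] borel by (simp add: \<Omega>_def)
  have null: "- \<Omega> \<in> null_sets \<mu>"
    unfolding \<Omega>_def by (rule measure_support_conull(2)[OF borel])
  have space: "space \<mu> = UNIV"
    using sets_eq_imp_space_eq[OF borel] by simp
  have f_meas: "f \<in> measurable \<mu> \<mu>" and distr: "distr \<mu> \<mu> f = \<mu>"
    using inv by (auto simp: invariant_measure_def)
  have AE_\<Omega>: "AE x in \<mu>. x \<in> \<Omega>"
    using AE_not_in[OF null] by simp
  have "emeasure \<mu> \<Omega> = 1"
    using \<mu>.emeasure_eq_1_AE[OF \<Omega>] AE_\<Omega> by simp
  then have "prob_space M"
    unfolding M_def using \<Omega> by (intro prob_space_restrict_space) auto
  moreover have fM: "f \<in> measurable M M"
    unfolding M_def using measure_support_invariant[OF borel cont inv]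
    by (intro measurable_restrict_space3 f_meas) (auto simp: \<Omega>_def)
  moreover have "distr M M f = M"
  proof (rule measure_eqI)
    fix A assume "A \<in> sets (distr M M f)"
    then have A: "A \<in> sets M" "A \<in> sets \<mu>" "A \<subseteq> \<Omega>"
      using \<Omega> by (auto simp: M_def sets_restrict_space_iff)
    have "emeasure (distr M M f) A = emeasure M (f -` A \<inter> space M)"
      by (rule emeasure_distr[OF fM A(1)])
    also have "\<dots> = emeasure \<mu> (f -` A \<inter> \<Omega>)"
      using \<Omega> by (simp add: M_def emeasure_restrict_space space)
    also have "\<dots> = emeasure \<mu> (f -` A \<inter> space \<mu>)"
      using AE_\<Omega> \<Omega> measurable_sets[OF f_meas A(2)] space by (intro emeasure_eq_AE) auto
    also have "\<dots> = emeasure (distr \<mu> \<mu> f) A"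
      by (rule emeasure_distr[OF f_meas A(2), symmetric])
    also have "\<dots> = emeasure M A"
      using A \<Omega> by (simp add: M_def distr emeasure_restrict_space space)
    finally show "emeasure (distr M M f) A = emeasure M A" .
  qed simp
  ultimately show ?thesis
    unfolding measure_preserving_def measure_preserving_axioms_def M_def \<Omega>_def by blast
qed

theorem mainTheorem2:
  fixes A :: "('a::{second_countable_topology, t2_space}, 'm::finite) chart set"
    and f :: "'a \<Rightarrow> 'a"
    and \<mu> M :: "'a measure"
    and \<Omega> :: "'a set"
    and \<phi> :: "'a \<Rightarrow> real ^ 'd"
    and \<phi>\<^sub>C :: "'a \<Rightarrow> complex ^ 'd"
    and \<Phi> :: "'a \<Rightarrow> real ^ 'l"
    and g :: "(real ^ 'd) \<times> (real ^ 'l) \<Rightarrow> real ^ 'l"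
  assumes manifold: "C1_atlas A"
    and C1_system: "C1_map A f"
    and prob: "prob_space \<mu>"
    and borel: "sets \<mu> = sets borel"
    and invariant: "invariant_measure \<mu> f"
    and ergodic: "ergodic_measure \<mu> f"
    and support: "\<Omega> = measure_support \<mu>"
    and compact_support: "compact \<Omega>"
    and on_support: "M = restrict_space \<mu> \<Omega>"
    and complexification: "\<phi>\<^sub>C = (\<lambda>x. \<chi> i. complex_of_real (\<phi> x $ i))"
    and phi_L2: "\<forall>i. (\<lambda>x. \<phi>\<^sub>C x $ i) \<in> L2 M"
    and Phi_inj: "inj_on \<Phi> \<Omega>"
    and Phi_g: "\<forall>x\<in>\<Omega>. \<Phi> (f x) = g (\<phi> x, \<Phi> x)"
  shows "(\<forall>H. hypothesis_space M \<Phi> H \<longrightarrow>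
            L2_closure M (hyp_subspace M \<Phi> H) \<subseteq> hyp_subspace M \<Phi> H \<longrightarrow>
            (\<forall>n. error_direct M f \<phi>\<^sub>C \<Phi> H n =
               L2norm M (\<lambda>x. (koopman f ^^ n) \<phi>\<^sub>C x
                 - L2_proj_vec M (hyp_subspace M \<Phi> H) ((koopman f ^^ n) \<phi>\<^sub>C) x)))
       \<and>
       (\<exists>S. density_one S \<and>
         (\<forall>\<epsilon>>0. \<exists>W\<^sub>0. L2_subspace M W\<^sub>0 \<and> L2_finite_dim M W\<^sub>0 \<and>
            (\<forall>H. admissible_hypothesis_space M \<Phi> H \<longrightarrow> W\<^sub>0 \<subseteq> hyp_subspace M \<Phi> H \<longrightarrow>
               Limsup (at_infinity_along S)
                 (\<lambda>n. ereal \<bar>error_direct M f \<phi>\<^sub>C \<Phi> H n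
                    - L2norm M (\<lambda>x. \<phi>\<^sub>C x - L2_proj_vec M (discrete_part M f) \<phi>\<^sub>C x)\<bar>)
               \<le> ereal \<epsilon>)) \<and>
         (weakly_mixing M f \<longrightarrow>
            (\<forall>H. admissible_hypothesis_space M \<Phi> H \<longrightarrow>
               ((\<lambda>n. error_direct M f \<phi>\<^sub>C \<Phi> H n)
                  \<longlongrightarrow> L2norm M (\<lambda>x. \<phi>\<^sub>C x - (\<integral>y. \<phi>\<^sub>C y \<partial>M))) (at_infinity_along S))) \<and>
         (strongly_mixing M f \<longrightarrow> S = UNIV) \<and>
         (purely_discrete_spectrum M f \<longrightarrow>
            (\<forall>\<epsilon>>0. \<exists>W\<^sub>0. L2_subspace M W\<^sub>0 \<and> L2_finite_dim M W\<^sub>0 \<and>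
               (\<forall>H. admissible_hypothesis_space M \<Phi> H \<longrightarrow> W\<^sub>0 \<subseteq> hyp_subspace M \<Phi> H \<longrightarrow>
                  (\<forall>n. error_direct M f \<phi>\<^sub>C \<Phi> H n < \<epsilon>)))))"
proof -
  have "continuous_on UNIV f"
    using C1_system by (simp add: C1_map_def)
  then interpret measure_preserving M f
    unfolding on_support support by (intro measure_preserving_on_support prob borel invariant)
  have \<phi>: "(\<lambda>x. \<phi>\<^sub>C x $ i) \<in> L2 M" for i
    using phi_L2 by blast
  show ?thesis
    using error_direct_eq[OF \<phi>] direct_forecast_errors[OF \<phi>]
    by (intro conjI allI impI) assumption
qed

end
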